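(* Let $\varphi: G\to\mathbb{R}$ be a functional that is $ci$-smooth of the order $\alpha$ and satisfies the Hamilton--Jacobi--Bellman equation $$\partial_t^\alpha \varphi(t,w(\cdot)) + \mathcal{H}\big(t, w(t), \nabla^\alpha \varphi(t,w(\cdot))\big) = 0,\quad (t,w(\cdot))\in G^0,$$ where $\mathcal{H}(\tau,x,s)=\min_{u\in P}\big(\langle s, f(\tau,x,u)\rangle+\chi(\tau,x,u)\big)$, and the right-end condition $$\varphi(T,w(\cdot))=\sigma(w(T)),\quad w(\cdot)\in AC^\alpha([0,T],\mathbb{R}^n).$$ Then $\varphi(t,w(\cdot))=\rho(t,w(\cdot))$ for all $(t,w(\cdot))\in G$, where $\rho$ is the value functional, and any control strategy $U^\circ:G^0\to P$ satisfying $$U^\circ(t,w(\cdot))\in\arg\min_{u\in P}\big(\langle\nabla^\alpha\varphi(t,w(\cdot)),f(t,w(t),u)\rangle+\chi(t,w(t),u)\big),\quad (t,w(\cdot))\in G^0,$$ is optimal.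
   Context: Fix $T>0$, $n \in \mathbb{N}$, $\alpha \in (0,1)$. $\|\cdot\|$ and $\langle\cdot,\cdot\rangle$ are the Euclidean norm and inner product in $\mathbb{R}^n$. Function spaces. For $t\in[0,T]$, $L^\infty([0,t],\mathbb{R}^n)$ is the set of measurable essentially bounded $\psi:[0,t]\to\mathbb{R}^n$. For $\beta\in(0,1)$, $(I^\beta\psi)(\tau)=\frac{1}{\Gamma(\beta)}\int_0^\tau \frac{\psi(\xi)}{(\tau-\xi)^{1-\beta}}d\xi$. $AC^\alpha([0,t],\mathbb{R}^n)$ is the set of functions $x:[0,t]\to\mathbb{R}^n$ of the form $x(\tau)=x(0)+(I^\alpha\psi)(\tau)$, $\tau\in[0,t]$, for some $\psi(\cdot)\in L^\infty([0,t],\mathbb{R}^n)$ (for $t=0$ it is identified with $\mathbb{R}^n$). For such $x(\cdot)$ the Caputo derivative $({}^CD^\alpha x)(\tau)=\frac{d}{d\tau}\big(I^{1-\alpha}(x(\cdot)-x(0))\big)(\tau)$ exists for a.e. $\tau\in[0,t]$ and equals $\psi(\tau)$ a.e. Positions. $G$ is the set of pairs $(t,w(\cdot))$ with $t\in[0,T]$ and $w(\cdot)\in AC^\alpha([0,t],\mathbb{R}^n)$; $G^0=\{(t,w(\cdot))\in G: t<T\}$. $G$ (and its subset $G^0$) carries the metric $\operatorname{dist}((t,w),(t',w'))=\max\{\operatorname{dist}^*((t,w),(t',w')),\operatorname{dist}^*((t',w'),(t,w))\}$, where $\operatorname{dist}^*((t,w),(t',w'))=\max_{\tau\in[0,t]}\min_{\tau'\in[0,t']}(|\tau-\tau'|^2+\|w(\tau)-w'(\tau')\|^2)^{1/2}$.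 Data. $P\subset\mathbb{R}^{n_u}$ is a nonempty compact set. $f:[0,T]\times\mathbb{R}^n\times P\to\mathbb{R}^n$ is continuous; for every $R>0$ there is $\lambda_f>0$ with $\|f(\tau,x,u)-f(\tau,x',u)\|\le\lambda_f\|x-x'\|$ for all $\tau\in[0,T]$, $\|x\|,\|x'\|\le R$, $u\in P$; and there is $c_f>0$ with $\|f(\tau,x,u)\|\le(1+\|x\|)c_f$ for all $(\tau,x,u)$. $\sigma:\mathbb{R}^n\to\mathbb{R}$ and $\chi:[0,T]\times\mathbb{R}^n\times P\to\mathbb{R}$ are continuous. Motions. For $0\le t\le\theta\le T$, $\mathcal{U}(t,\theta)$ is the set of measurable functions $u:[t,\theta]\to P$. For $(t,w(\cdot))\in G$, $\theta\in[t,T]$, $u(\cdot)\in\mathcal{U}(t,\theta)$, the motion $x(\cdot\mid t,w(\cdot),\theta,u(\cdot))$ is the unique $x(\cdot)\in AC^\alpha([0,\theta],\mathbb{R}^n)$ with $x(\tau)=w(\tau)$ for $\tau\in[0,t]$ and $({}^CD^\alpha x)(\tau)=f(\tau,x(\tau),u(\tau))$ for a.e. $\tau\in[t,\theta]$ (it exists and is unique because $f$ is continuous and, in its second argument, locally Lipschitz continuous and of sublinear growth). Value functional. $J(t,w(\cdot),u(\cdot))=\sigma(x(T))+\int_t^T\chi(\tau,x(\tau),u(\tau))\,d\tau$ with $x(\cdot)=x(\cdot\mid t,w(\cdot),T,u(\cdot))$, and $\rho(t,w(\cdot))=\inf_{u(\cdot)\in\mathcal{U}(t,T)}J(t,w(\cdot),u(\cdot))$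 for $(t,w(\cdot))\in G$. Coinvariant derivatives. For a function $x(\cdot)$ on $[0,T]$, $x_\tau(\cdot)$ denotes its restriction to $[0,\tau]$. For $(t,w(\cdot))\in G^0$, $X(t,w(\cdot))=\{x(\cdot)\in AC^\alpha([0,T],\mathbb{R}^n): x(\tau)=w(\tau),\ \tau\in[0,t]\}$. A functional $\varphi:G\to\mathbb{R}$ is $ci$-differentiable of the order $\alpha$ at $(t,w(\cdot))\in G^0$ if there exist $\partial_t^\alpha\varphi(t,w(\cdot))\in\mathbb{R}$ and $\nabla^\alpha\varphi(t,w(\cdot))\in\mathbb{R}^n$ such that for every $x(\cdot)\in X(t,w(\cdot))$ and $\tau\in(t,T)$ $$\varphi(\tau,x_\tau(\cdot))-\varphi(t,w(\cdot))=\partial_t^\alpha\varphi(t,w(\cdot))(\tau-t)+\Big\langle\nabla^\alpha\varphi(t,w(\cdot)),\big(I^{1-\alpha}(x(\cdot)-x(0))\big)(\tau)-\big(I^{1-\alpha}(w(\cdot)-w(0))\big)(t)\Big\rangle+o(\tau-t),$$ where $o(\tau-t)$ may depend on $x(\cdot)$ and $o(\tau-t)/(\tau-t)\to0$ as $\tau\downarrow t$ (equivalently, the second entry of the inner product is $\int_t^\tau({}^CD^\alpha x)(\xi)d\xi$). These quantities are then unique. $\varphi$ is $ci$-smooth of the order $\alpha$ if $\varphi$ is continuous on $G$, is $ci$-differentiable of the order $\alpha$ at every point of $G^0$, and $\partial_t^\alpha\varphi:G^0\to\mathbb{R}$, $\nabla^\alpha\varphi:G^0\to\mathbb{R}^n$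 are continuous (all with respect to $\operatorname{dist}$). Control strategies. A control strategy is an arbitrary map $U:G^0\to P$. Given $(t,w(\cdot))\in G^0$ and a partition $\Delta=\{\tau_j\}$ with $t=\tau_1<\tau_2<\dots<\tau_{k+1}=T$, $k\in\mathbb{N}$, the control law $\{U,\Delta\}$ forms recursively a control $u(\cdot)=u(\cdot\mid t,w(\cdot),U,\Delta)\in\mathcal{U}(t,T)$ and the corresponding motion $x(\cdot)=x(\cdot\mid t,w(\cdot),T,u(\cdot))$ by $u(\tau)=U(\tau_j,x_{\tau_j}(\cdot))$ for $\tau\in[\tau_j,\tau_{j+1})$, $j=1,\dots,k$ (and $u(T)=\tilde u$ for some fixed $\tilde u\in P$). Let $\operatorname{diam}(\Delta)=\max_{j}(\tau_{j+1}-\tau_j)$. A strategy $U^\circ$ is optimal if for any $(t,w(\cdot))\in G^0$ and $\varepsilon>0$ there is $\delta>0$ such that for any partition $\Delta$ with $\operatorname{diam}(\Delta)\le\delta$ one has $J(t,w(\cdot),u(\cdot\mid t,w(\cdot),U^\circ,\Delta))\le\rho(t,w(\cdot))+\varepsilon$. *)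

theory Defs
  imports "HOL-Analysis.Analysis" "HOL-Library.Landau_Symbols"
begin

text \<open>
  A function on \<open>[a, b]\<close> with values in \<open>\<real>\<^sup>n\<close> is represented by an element of
  \<open>extensional {a..b}\<close>, so that two such functions are equal iff they agree on \<open>[a, b]\<close>, and the
  restriction \<open>x\<^sub>\<tau>\<close> of \<open>x\<close> to \<open>[0, \<tau>]\<close> is \<open>restrict x {0..\<tau>}\<close>.
\<close>

type_synonym 'n position = "real \<times> (real \<Rightarrow> real ^ 'n)"


section \<open>Fractional integrals and derivatives\<close>

definition Linf :: "real \<Rightarrow> (real \<Rightarrow> real ^ 'n) set" where
  "Linf t = {\<psi> \<in> borel_measurable (lebesgue_on {0..t}).
     \<exists>M. AE \<xi> in lebesgue_on {0..t}. norm (\<psi> \<xi>) \<le> M}"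

definition frac_int :: "real \<Rightarrow> (real \<Rightarrow> real ^ 'n) \<Rightarrow> real \<Rightarrow> real ^ 'n" where
  "frac_int \<beta> \<psi> \<tau> =
     (1 / Gamma \<beta>) *\<^sub>R (LINT \<xi>:{0..\<tau>}|lebesgue. (1 / (\<tau> - \<xi>) powr (1 - \<beta>)) *\<^sub>R \<psi> \<xi>)"

definition AC :: "real \<Rightarrow> real \<Rightarrow> (real \<Rightarrow> real ^ 'n) set" where
  "AC \<alpha> t = {x \<in> extensional {0..t}.
     \<exists>\<psi> \<in> Linf t. \<forall>\<tau> \<in> {0..t}. x \<tau> = x 0 + frac_int \<alpha> \<psi> \<tau>}"

text \<open>For \<open>x\<close> defined on \<open>[0, t]\<close>: the Caputo derivative of \<open>x\<close> at \<open>\<tau>\<close> exists and equals \<open>d\<close>.\<close>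

definition has_caputo_deriv ::
    "real \<Rightarrow> real \<Rightarrow> (real \<Rightarrow> real ^ 'n) \<Rightarrow> real ^ 'n \<Rightarrow> real \<Rightarrow> bool" where
  "has_caputo_deriv \<alpha> t x d \<tau> \<longleftrightarrow>
     ((\<lambda>s. frac_int (1 - \<alpha>) (\<lambda>\<xi>. x \<xi> - x 0) s) has_vector_derivative d) (at \<tau> within {0..t})"


section \<open>Positions\<close>

definition G :: "real \<Rightarrow> real \<Rightarrow> ('n::finite) position set" where
  "G \<alpha> T = {(t, w). t \<in> {0..T} \<and> w \<in> AC \<alpha> t}"

definition G0 :: "real \<Rightarrow> real \<Rightarrow> ('n::finite) position set" where
  "G0 \<alpha> T = {(t, w) \<in> G \<alpha> T. t < T}"

text \<open>
  Elements of \<open>AC \<alpha> t\<close> are continuous on \<open>[0, t]\<close>, so on \<open>G\<close> the supremum and infimum below are a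
  maximum and a minimum.
\<close>

definition pos_dist_star :: "('n::finite) position \<Rightarrow> ('n::finite) position \<Rightarrow> real" where
  "pos_dist_star = (\<lambda>(t, w) (t', w').
     SUP \<tau>\<in>{0..t}. INF \<tau>'\<in>{0..t'}. sqrt (\<bar>\<tau> - \<tau>'\<bar>\<^sup>2 + (norm (w \<tau> - w' \<tau>'))\<^sup>2))"

definition pos_dist :: "('n::finite) position \<Rightarrow> ('n::finite) position \<Rightarrow> real" where
  "pos_dist p q = max (pos_dist_star p q) (pos_dist_star q p)"

definition pos_continuous_on ::
    "('n::finite) position set \<Rightarrow> (('n::finite) position \<Rightarrow> 'b::metric_space) \<Rightarrow> bool" where
  "pos_continuous_on S \<phi> \<longleftrightarrow>
     (\<forall>p \<in> S. \<forall>\<epsilon> > 0. \<exists>\<delta> > 0. \<forall>q \<in> S. pos_dist p q < \<delta> \<longrightarrow> dist (\<phi> p) (\<phi> q) < \<epsilon>)"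


section \<open>Motions and the value functional\<close>

definition controls :: "(real ^ 'm) set \<Rightarrow> real \<Rightarrow> real \<Rightarrow> (real \<Rightarrow> real ^ 'm) set" where
  "controls P t \<theta> = {u \<in> {t..\<theta>} \<rightarrow>\<^sub>E P. u \<in> borel_measurable (lebesgue_on {t..\<theta>})}"

definition motion ::
    "real \<Rightarrow> (real \<Rightarrow> real ^ 'n \<Rightarrow> real ^ 'm \<Rightarrow> real ^ 'n) \<Rightarrow>
     real \<Rightarrow> (real \<Rightarrow> real ^ 'n) \<Rightarrow> real \<Rightarrow> (real \<Rightarrow> real ^ 'm) \<Rightarrow> real \<Rightarrow> real ^ 'n" where
  "motion \<alpha> f t w \<theta> u = (THE x. x \<in> AC \<alpha> \<theta> \<and> (\<forall>\<tau> \<in> {0..t}. x \<tau> = w \<tau>) \<and>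
     (AE \<tau> in lebesgue_on {t..\<theta>}. has_caputo_deriv \<alpha> \<theta> x (f \<tau> (x \<tau>) (u \<tau>)) \<tau>))"

definition cost ::
    "real \<Rightarrow> real \<Rightarrow> (real \<Rightarrow> real ^ 'n \<Rightarrow> real ^ 'm \<Rightarrow> real ^ 'n) \<Rightarrow>
     (real ^ 'n \<Rightarrow> real) \<Rightarrow> (real \<Rightarrow> real ^ 'n \<Rightarrow> real ^ 'm \<Rightarrow> real) \<Rightarrow>
     ('n::finite) position \<Rightarrow> (real \<Rightarrow> real ^ 'm) \<Rightarrow> real" where
  "cost \<alpha> T f \<sigma> chi = (\<lambda>(t, w) u. let x = motion \<alpha> f t w T u in
     \<sigma> (x T) + (LINT \<tau>:{t..T}|lebesgue. chi \<tau> (x \<tau>) (u \<tau>)))"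

definition val ::
    "real \<Rightarrow> real \<Rightarrow> (real ^ 'm) set \<Rightarrow> (real \<Rightarrow> real ^ 'n \<Rightarrow> real ^ 'm \<Rightarrow> real ^ 'n) \<Rightarrow>
     (real ^ 'n \<Rightarrow> real) \<Rightarrow> (real \<Rightarrow> real ^ 'n \<Rightarrow> real ^ 'm \<Rightarrow> real) \<Rightarrow>
     ('n::finite) position \<Rightarrow> real" where
  "val \<alpha> T P f \<sigma> chi = (\<lambda>(t, w). INF u\<in>controls P t T. cost \<alpha> T f \<sigma> chi (t, w) u)"


section \<open>Coinvariant derivatives\<close>

definition extensions :: "real \<Rightarrow> real \<Rightarrow> ('n::finite) position \<Rightarrow> (real \<Rightarrow> real ^ 'n) set" where
  "extensions \<alpha> T = (\<lambda>(t, w). {x \<in> AC \<alpha> T. \<forall>\<tau> \<in> {0..t}. x \<tau> = w \<tau>})"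

definition has_ci_derivs ::
    "real \<Rightarrow> real \<Rightarrow> (('n::finite) position \<Rightarrow> real) \<Rightarrow> ('n::finite) position \<Rightarrow> real \<Rightarrow> real ^ 'n \<Rightarrow> bool" where
  "has_ci_derivs \<alpha> T \<phi> = (\<lambda>(t, w) p s. \<forall>x \<in> extensions \<alpha> T (t, w).
     (\<lambda>\<tau>. \<phi> (\<tau>, restrict x {0..\<tau>}) - \<phi> (t, w) - p * (\<tau> - t)
        - s \<bullet> (frac_int (1 - \<alpha>) (\<lambda>\<xi>. x \<xi> - x 0) \<tau> - frac_int (1 - \<alpha>) (\<lambda>\<xi>. w \<xi> - w 0) t))
       \<in> o[at_right t](\<lambda>\<tau>. \<tau> - t))"

definition ci_differentiable ::
    "real \<Rightarrow> real \<Rightarrow> (('n::finite) position \<Rightarrow> real) \<Rightarrow> ('n::finite) position \<Rightarrow> bool" where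
  "ci_differentiable \<alpha> T \<phi> z \<longleftrightarrow> (\<exists>p s. has_ci_derivs \<alpha> T \<phi> z p s)"

text \<open>
  The pair of coinvariant derivatives is uniquely determined at points of \<open>G0\<close>; as for
  \<^const>\<open>deriv\<close>, it is selected with a choice operator.
\<close>

definition ci_derivs :: "real \<Rightarrow> real \<Rightarrow> (('n::finite) position \<Rightarrow> real) \<Rightarrow> ('n::finite) position \<Rightarrow> real \<times> (real ^ 'n)" where
  "ci_derivs \<alpha> T \<phi> z = (SOME (p, s). has_ci_derivs \<alpha> T \<phi> z p s)"

definition ci_dt :: "real \<Rightarrow> real \<Rightarrow> (('n::finite) position \<Rightarrow> real) \<Rightarrow> ('n::finite) position \<Rightarrow> real" where
  "ci_dt \<alpha> T \<phi> z = fst (ci_derivs \<alpha> T \<phi> z)"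

definition ci_grad :: "real \<Rightarrow> real \<Rightarrow> (('n::finite) position \<Rightarrow> real) \<Rightarrow> ('n::finite) position \<Rightarrow> real ^ 'n" where
  "ci_grad \<alpha> T \<phi> z = snd (ci_derivs \<alpha> T \<phi> z)"

definition ci_smooth :: "real \<Rightarrow> real \<Rightarrow> (('n::finite) position \<Rightarrow> real) \<Rightarrow> bool" where
  "ci_smooth \<alpha> T \<phi> \<longleftrightarrow>
     pos_continuous_on (G \<alpha> T) \<phi> \<and>
     (\<forall>z \<in> G0 \<alpha> T. ci_differentiable \<alpha> T \<phi> z) \<and>
     pos_continuous_on (G0 \<alpha> T) (ci_dt \<alpha> T \<phi>) \<and>
     pos_continuous_on (G0 \<alpha> T) (ci_grad \<alpha> T \<phi>)"

text \<open>For compact nonempty \<open>P\<close> and continuous \<open>f\<close>, \<open>chi\<close> the infimum is a minimum.\<close>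

definition hamiltonian ::
    "(real ^ 'm) set \<Rightarrow> (real \<Rightarrow> real ^ 'n \<Rightarrow> real ^ 'm \<Rightarrow> real ^ 'n) \<Rightarrow>
     (real \<Rightarrow> real ^ 'n \<Rightarrow> real ^ 'm \<Rightarrow> real) \<Rightarrow> real \<Rightarrow> real ^ 'n \<Rightarrow> real ^ 'n \<Rightarrow> real" where
  "hamiltonian P f chi \<tau> x s = (INF u\<in>P. s \<bullet> f \<tau> x u + chi \<tau> x u)"


section \<open>Control strategies\<close>

text \<open>Partition points are numbered from \<open>0\<close>: \<open>t = \<Delta> 0 < \<dots> < \<Delta> k = T\<close> with \<open>k \<ge> 1\<close>.\<close>

definition is_partition :: "real \<Rightarrow> real \<Rightarrow> nat \<Rightarrow> (nat \<Rightarrow> real) \<Rightarrow> bool" where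
  "is_partition t T k \<Delta> \<longleftrightarrow>
     1 \<le> k \<and> \<Delta> 0 = t \<and> \<Delta> k = T \<and> (\<forall>j < k. \<Delta> j < \<Delta> (Suc j))"

definition diam :: "nat \<Rightarrow> (nat \<Rightarrow> real) \<Rightarrow> real" where
  "diam k \<Delta> = (MAX j\<in>{..<k}. \<Delta> (Suc j) - \<Delta> j)"

text \<open>
  \<open>law_motion \<alpha> f w U \<Delta> j\<close> is the part on \<open>[0, \<Delta> j]\<close> of the motion formed by the control law
  \<open>{U, \<Delta>}\<close> from the position \<open>(\<Delta> 0, w)\<close>.
\<close>

primrec law_motion ::
    "real \<Rightarrow> (real \<Rightarrow> real ^ 'n \<Rightarrow> real ^ 'm \<Rightarrow> real ^ 'n) \<Rightarrow> (real \<Rightarrow> real ^ 'n) \<Rightarrow>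
     (('n::finite) position \<Rightarrow> real ^ 'm) \<Rightarrow> (nat \<Rightarrow> real) \<Rightarrow> nat \<Rightarrow> real \<Rightarrow> real ^ 'n" where
  "law_motion \<alpha> f w U \<Delta> 0 = w"
| "law_motion \<alpha> f w U \<Delta> (Suc j) =
     motion \<alpha> f (\<Delta> j) (law_motion \<alpha> f w U \<Delta> j) (\<Delta> (Suc j))
       (\<lambda>\<tau>\<in>{\<Delta> j..\<Delta> (Suc j)}. U (\<Delta> j, law_motion \<alpha> f w U \<Delta> j))"

definition law_control ::
    "real \<Rightarrow> (real \<Rightarrow> real ^ 'n \<Rightarrow> real ^ 'm \<Rightarrow> real ^ 'n) \<Rightarrow> (real \<Rightarrow> real ^ 'n) \<Rightarrow>
     (('n::finite) position \<Rightarrow> real ^ 'm) \<Rightarrow> real ^ 'm \<Rightarrow> nat \<Rightarrow> (nat \<Rightarrow> real) \<Rightarrow> real \<Rightarrow> real ^ 'm" where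
  "law_control \<alpha> f w U u_end k \<Delta> = (\<lambda>\<tau>\<in>{\<Delta> 0..\<Delta> k}.
     if \<tau> = \<Delta> k then u_end
     else (let j = (THE j. j < k \<and> \<tau> \<in> {\<Delta> j..<\<Delta> (Suc j)})
           in U (\<Delta> j, law_motion \<alpha> f w U \<Delta> j)))"

definition optimal_strategy ::
    "real \<Rightarrow> real \<Rightarrow> (real ^ 'm) set \<Rightarrow> (real \<Rightarrow> real ^ 'n \<Rightarrow> real ^ 'm \<Rightarrow> real ^ 'n) \<Rightarrow>
     (real ^ 'n \<Rightarrow> real) \<Rightarrow> (real \<Rightarrow> real ^ 'n \<Rightarrow> real ^ 'm \<Rightarrow> real) \<Rightarrow> real ^ 'm \<Rightarrow>
     (('n::finite) position \<Rightarrow> real ^ 'm) \<Rightarrow> bool" where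
  "optimal_strategy \<alpha> T P f \<sigma> chi u_end U \<longleftrightarrow>
     (\<forall>(t, w) \<in> G0 \<alpha> T. \<forall>\<epsilon> > 0. \<exists>\<delta> > 0. \<forall>k \<Delta>. is_partition t T k \<Delta> \<and> diam k \<Delta> \<le> \<delta> \<longrightarrow>
        cost \<alpha> T f \<sigma> chi (t, w) (law_control \<alpha> f w U u_end k \<Delta>) \<le> val \<alpha> T P f \<sigma> chi (t, w) + \<epsilon>)"

end

theory Submission
  imports Defs "HOL-Complex_Analysis.Great_Picard"
begin

text \<open>
  Along a trajectory \<open>x\<close> with Caputo derivative \<open>\<psi>\<close> the identity
  \<open>I\<^bsup>1-\<alpha>\<^esup> I\<^bsup>\<alpha>\<^esup> \<psi> = \<integral> \<psi>\<close> turns ci-differentiability of \<open>\<phi>\<close> into the formula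
  \<open>\<phi>(s, x\<^sub>s) - \<phi>(t, x\<^sub>t) = \<integral>\<^sub>t\<^sup>s \<partial>\<^sub>t\<phi> + \<langle>\<nabla>\<phi>, \<psi>\<rangle>\<close> for \<open>s < T\<close>. Hence the cost of a control exceeds
  \<open>\<phi>(t, w)\<close> by the integral of the defect \<open>\<partial>\<^sub>t\<phi> + \<langle>\<nabla>\<phi>, f\<rangle> + \<chi>\<close> along its motion (the end point \<open>T\<close> is
  reached by continuity of \<open>\<phi>\<close>). The Hamilton--Jacobi--Bellman equation makes the defect nonnegative,
  so \<open>\<phi> \<le> \<rho>\<close>, and zero at the nodes of a partition under the extremal strategy. That it is uniformly
  small between the nodes for fine partitions follows by contradiction: all motions from \<open>(t, w)\<close>
  are bounded and equicontinuous, so those of a sequence of partitions have a uniform limit point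
  \<open>x\<close> by Arzela--Ascoli; it belongs to \<open>AC\<^sup>\<alpha>\<close>, so the coinvariant derivatives are continuous along \<open>x\<close>.
\<close>

section \<open>Fractional integrals of bounded functions\<close>

text \<open>An extremal strategy is an arbitrary, possibly discontinuous map, and the velocities
  \<open>f t x u\<close> with u in \<open>P\<close> need not form a convex set. So the limit of the
  motions along finer and finer partitions need not be a motion under any control. The argument
  never asks it to solve the equation: the limit only has to lie in \<open>AC \<alpha> T\<close>,
  since positions outside that space are beyond the domain on which the coinvariant derivatives are
  continuous. Convergence of control values comes from compactness of \<open>P\<close> alone, at the
  instants that matter. The detour through compactness is forced by the space of positions: the
  coinvariant derivatives are continuous on \<open>G0\<close>, but nothing makes them uniformly
  continuous near the family of all motions, and they may be unbounded as t approaches T. Hence the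
  defect is estimated on intervals [t, s] with s < T, and the remaining piece is handled through
  \<phi> and a bound for chi.\<close>

definition kern :: "real \<Rightarrow> real \<Rightarrow> real \<Rightarrow> real" where
  "kern \<beta> s r = (if 0 \<le> r \<and> r \<le> s then (s - r) powr (\<beta> - 1) / Gamma \<beta> else 0)"

lemma kern_nonneg: "0 < \<beta> \<Longrightarrow> 0 \<le> kern \<beta> s r"
  by (simp add: kern_def Gamma_real_pos less_imp_le)

lemma kern_measurable_pair [measurable]:
  "(\<lambda>(s, r). kern \<beta> s r) \<in> borel_measurable (borel \<Otimes>\<^sub>M borel)"
  unfolding kern_def by measurable

lemma kern_measurable [measurable]: "kern \<beta> s \<in> borel_measurable borel"
  unfolding kern_def by measurable

lemma borel_measurable_lebesgue_on: "g \<in> borel_measurable borel \<Longrightarrow> g \<in> borel_measurable (lebesgue_on S)"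
  by (rule measurable_restrict_space1) (simp add: measurable_completion)

lemma kern_measurable_lebesgue_on [measurable]: "kern \<beta> s \<in> borel_measurable (lebesgue_on S)"
  by (intro borel_measurable_lebesgue_on kern_measurable)

text \<open>Cutting the kernel off outside 0 <= r <= s puts the integrals for all s over the one
  space \<open>lebesgue_on {0..t}\<close>, as Fubini and dominated convergence require. At r = s
  both forms of the kernel are 0, since \<open>0 powr x = 0\<close> and division by zero gives
  0.\<close>

lemma frac_int_kern:
  assumes "0 \<le> s" "s \<le> t"
  shows "frac_int \<beta> \<psi> s = (LINT r|lebesgue_on {0..t}. kern \<beta> s r *\<^sub>R \<psi> r)"
proof -
  have "(LINT r|lebesgue_on {0..t}. kern \<beta> s r *\<^sub>R \<psi> r)
      = (LINT r|lebesgue. indicator {0..t} r *\<^sub>R (kern \<beta> s r *\<^sub>R \<psi> r))"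
    by (subst integral_restrict_space) auto
  also have "\<dots> = (LINT r|lebesgue. (1 / Gamma \<beta>) *\<^sub>R (indicator {0..s} r *\<^sub>R ((1 / (s - r) powr (1 - \<beta>)) *\<^sub>R \<psi> r)))"
    using assms by (intro Bochner_Integration.integral_cong)
      (auto simp: kern_def indicator_def powr_minus_divide[of _ "1 - \<beta>", simplified])
  also have "\<dots> = frac_int \<beta> \<psi> s"
    by (simp only: frac_int_def set_lebesgue_integral_def integral_scaleR_right)
  finally show ?thesis by simp
qed

text \<open>Power and Beta integrals are available as gauge integrals; nonnegativity makes them
  absolutely integrable, hence Lebesgue integrals with the same value.\<close>

lemma lebesgue_on_of_has_integral:
  fixes g :: "real \<Rightarrow> real"
  assumes "(g has_integral I) {a..b}" "\<And>x. x \<in> {a..b} \<Longrightarrow> 0 \<le> g x"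
  shows "integrable (lebesgue_on {a..b}) g" "(LINT x|lebesgue_on {a..b}. g x) = I"
proof -
  have "g absolutely_integrable_on {a..b}"
    using assms by (intro nonnegative_absolutely_integrable_1) auto
  then show 1: "integrable (lebesgue_on {a..b}) g"
    by (subst integrable_restrict_space) (auto simp: set_integrable_def)
  show "(LINT x|lebesgue_on {a..b}. g x) = I"
    using assms(1) lebesgue_integral_eq_integral[OF 1] by auto
qed

text \<open>The reflection r -> s - r leads to the integral of x powr (\<beta> - 1), and Gamma
  (\<beta> + 1) = \<beta> * Gamma \<beta> absorbs the factor 1 / \<beta>.\<close>

lemma kern_has_integral:
  assumes "0 < \<beta>" "0 \<le> s" "s \<le> t"
  shows "(kern \<beta> s has_integral (s powr \<beta> / Gamma (\<beta> + 1))) {0..t}"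
proof -
  have "((\<lambda>x. x powr (\<beta> - 1)) has_integral (s powr \<beta> / \<beta>)) {0..s}"
    using has_integral_powr_from_0[of "\<beta> - 1" s] assms by simp
  then have "((\<lambda>x. (- x) powr (\<beta> - 1)) has_integral (s powr \<beta> / \<beta>)) {-s..-0}"
    by (subst has_integral_reflect_real) simp
  from has_integral_affinity[OF this[folded cbox_interval], of 1 "-s"]
  have "((\<lambda>x. (s - x) powr (\<beta> - 1)) has_integral (s powr \<beta> / \<beta>)) {0..s}"
    by (simp add: algebra_simps)
  from has_integral_divide[OF this, of "Gamma \<beta>"]
  have "((\<lambda>x. (s - x) powr (\<beta> - 1) / Gamma \<beta>) has_integral (s powr \<beta> / Gamma (\<beta> + 1))) {0..s}"
    using assms Gamma_plus1[of \<beta>] by (force dest: nonpos_Ints_nonpos)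
  then have "((\<lambda>x. if x \<in> {0..s} then (s - x) powr (\<beta> - 1) / Gamma \<beta> else 0)
      has_integral (s powr \<beta> / Gamma (\<beta> + 1))) {0..t}"
    using assms by (subst has_integral_restrict) auto
  then show ?thesis
    by (simp add: kern_def[abs_def])
qed

lemma kern_integrable:
  assumes "0 < \<beta>" "0 \<le> s" "s \<le> t"
  shows "integrable (lebesgue_on {0..t}) (kern \<beta> s)"
    and "(LINT r|lebesgue_on {0..t}. kern \<beta> s r) = s powr \<beta> / Gamma (\<beta> + 1)"
  using lebesgue_on_of_has_integral[OF kern_has_integral[OF assms]] kern_nonneg assms by auto

lemma kern_integrable_scaleR:
  fixes \<psi> :: "real \<Rightarrow> 'a::euclidean_space"
  assumes "0 < \<beta>" "0 \<le> s" "s \<le> t"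
    and [measurable]: "\<psi> \<in> borel_measurable (lebesgue_on {0..t})"
    and b: "AE r in lebesgue_on {0..t}. norm (\<psi> r) \<le> M"
  shows "integrable (lebesgue_on {0..t}) (\<lambda>r. kern \<beta> s r *\<^sub>R \<psi> r)"
proof (rule Bochner_Integration.integrable_bound)
  show "integrable (lebesgue_on {0..t}) (\<lambda>r. M * kern \<beta> s r)"
    using kern_integrable[OF assms(1-3)] by auto
  show "AE r in lebesgue_on {0..t}. norm (kern \<beta> s r *\<^sub>R \<psi> r) \<le> norm (M * kern \<beta> s r)"
    using b
  proof eventually_elim
    case (elim r)
    then show ?case using kern_nonneg[of \<beta> s r] assms(1)
      by (simp add: abs_mult mult.commute[of _ "kern \<beta> s r"] mult_left_mono)
  qed
qed measurable

lemma frac_int_cong_AE: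
  fixes \<psi> :: "real \<Rightarrow> real ^ 'n"
  assumes "0 \<le> s" "s \<le> t"
    and [measurable]: "\<psi> \<in> borel_measurable (lebesgue_on {0..t})" "\<psi>' \<in> borel_measurable (lebesgue_on {0..t})"
    and b: "AE r in lebesgue_on {0..t}. r \<le> s \<longrightarrow> \<psi> r = \<psi>' r"
  shows "frac_int \<beta> \<psi> s = frac_int \<beta> \<psi>' s"
proof -
  have "AE r in lebesgue_on {0..t}. kern \<beta> s r *\<^sub>R \<psi> r = kern \<beta> s r *\<^sub>R \<psi>' r"
    using b by eventually_elim (auto simp: kern_def)
  then show ?thesis
    unfolding frac_int_kern[OF assms(1,2)] by (intro integral_cong_AE) auto
qed

lemma frac_int_cong:
  fixes \<psi> :: "real \<Rightarrow> real ^ 'n"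
  assumes "\<And>r. r \<in> {0..s} \<Longrightarrow> \<psi> r = \<psi>' r"
  shows "frac_int \<beta> \<psi> s = frac_int \<beta> \<psi>' s"
  unfolding frac_int_def set_lebesgue_integral_def
  by (rule arg_cong[where f="scaleR _"], rule Bochner_Integration.integral_cong)
    (use assms in \<open>auto simp: indicator_def\<close>)

lemma frac_int_0: "frac_int \<beta> \<psi> 0 = (0 :: real ^ 'n)"
proof -
  have "kern \<beta> 0 r = 0" for r
    by (auto simp: kern_def)
  then show ?thesis
    by (simp add: frac_int_kern[of 0 0])
qed

lemma frac_int_diff:
  fixes \<psi> :: "real \<Rightarrow> real ^ 'n"
  assumes "0 < \<beta>" "0 \<le> s" "s \<le> t"
    and "\<psi> \<in> borel_measurable (lebesgue_on {0..t})" "AE r in lebesgue_on {0..t}. norm (\<psi> r) \<le> M"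
    and "\<psi>' \<in> borel_measurable (lebesgue_on {0..t})" "AE r in lebesgue_on {0..t}. norm (\<psi>' r) \<le> M'"
  shows "frac_int \<beta> \<psi> s - frac_int \<beta> \<psi>' s = frac_int \<beta> (\<lambda>r. \<psi> r - \<psi>' r) s"
  unfolding frac_int_kern[OF assms(2,3)] scaleR_diff_right
  by (rule Bochner_Integration.integral_diff[symmetric])
    (rule kern_integrable_scaleR[OF assms(1-3)], fact, fact)+

text \<open>The pointwise majorant \<open>v\<close> stays under the integral, as the Gronwall and
  contraction estimates require; \<open>M\<close> secures integrability.\<close>

lemma norm_frac_int_le:
  fixes \<psi> :: "real \<Rightarrow> real ^ 'n"
  assumes "0 < \<beta>" "0 \<le> s" "s \<le> t"
    and "\<psi> \<in> borel_measurable (lebesgue_on {0..t})"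
    and v: "v \<in> borel_measurable (lebesgue_on {0..t})" "\<And>r. r \<in> {0..t} \<Longrightarrow> \<bar>v r\<bar> \<le> M"
    and b: "AE r in lebesgue_on {0..t}. norm (\<psi> r) \<le> v r"
  shows "norm (frac_int \<beta> \<psi> s) \<le> (LINT r|lebesgue_on {0..t}. kern \<beta> s r * v r)"
proof -
  have "AE r in lebesgue_on {0..t}. norm (\<psi> r) \<le> M"
    using b AE_space
  proof eventually_elim
    case (elim r)
    then show ?case using v(2)[of r] by auto
  qed
  then have 1: "integrable (lebesgue_on {0..t}) (\<lambda>r. kern \<beta> s r *\<^sub>R \<psi> r)"
    using assms by (intro kern_integrable_scaleR) auto
  have 2: "integrable (lebesgue_on {0..t}) (\<lambda>r. kern \<beta> s r * v r)"
    using kern_integrable_scaleR[OF assms(1-3) v(1) AE_I2, of M] v(2) by simp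
  have "norm (frac_int \<beta> \<psi> s) \<le> (LINT r|lebesgue_on {0..t}. norm (kern \<beta> s r *\<^sub>R \<psi> r))"
    unfolding frac_int_kern[OF assms(2,3)] by (rule integral_norm_bound)
  also have "\<dots> \<le> (LINT r|lebesgue_on {0..t}. kern \<beta> s r * v r)"
  proof (rule integral_mono_AE)
    show "AE r in lebesgue_on {0..t}. norm (kern \<beta> s r *\<^sub>R \<psi> r) \<le> kern \<beta> s r * v r"
      using b by eventually_elim (use kern_nonneg[OF assms(1)] in \<open>simp add: mult_left_mono\<close>)
  qed (use integrable_norm[OF 1] 2 in auto)
  finally show ?thesis .
qed

section \<open>Increments and continuity of fractional integrals\<close>

lemma kern_tail_has_integral:
  assumes "0 < \<beta>" "0 \<le> a" "a \<le> \<tau>" "\<tau> \<le> t"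
  shows "((\<lambda>r. if a \<le> r then kern \<beta> \<tau> r else 0) has_integral ((\<tau> - a) powr \<beta> / Gamma (\<beta> + 1))) {0..t}"
proof -
  have "(kern \<beta> (\<tau> - a) has_integral ((\<tau> - a) powr \<beta> / Gamma (\<beta> + 1))) {0..t - a}"
    by (rule kern_has_integral) (use assms in auto)
  from has_integral_affinity[OF this[folded cbox_interval], of 1 "-a"]
  have "((\<lambda>r. kern \<beta> (\<tau> - a) (r - a)) has_integral ((\<tau> - a) powr \<beta> / Gamma (\<beta> + 1))) {a..t}"
    using assms by (simp add: algebra_simps)
  then have "((\<lambda>r. if r \<in> {a..t} then kern \<beta> (\<tau> - a) (r - a) else 0) has_integral
      ((\<tau> - a) powr \<beta> / Gamma (\<beta> + 1))) {0..t}"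
    using assms by (subst has_integral_restrict) auto
  then show ?thesis
    by (rule has_integral_eq[rotated]) (use assms in \<open>auto simp: kern_def\<close>)
qed

text \<open>Hoelder continuity of order \<beta>. For \<beta> <= 1 and fixed r the kernel decreases
  in its first argument once that exceeds r, so the kernel difference has one sign before a and the
  other after it. Its absolute value integrates to (a powr \<beta> - b powr \<beta> + 2 * (b - a)
  powr \<beta>) / Gamma (\<beta> + 1), where the first two terms together are at most 0.\<close>

lemma norm_frac_int_increment_le:
  fixes \<psi> :: "real \<Rightarrow> real ^ 'n"
  assumes \<beta>: "0 < \<beta>" "\<beta> \<le> 1" and ab: "0 \<le> a" "a \<le> b" "b \<le> t"
    and [measurable]: "\<psi> \<in> borel_measurable (lebesgue_on {0..t})"
    and bd: "AE r in lebesgue_on {0..t}. norm (\<psi> r) \<le> M" and M: "0 \<le> M"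
  shows "norm (frac_int \<beta> \<psi> b - frac_int \<beta> \<psi> a) \<le> 2 * M * (b - a) powr \<beta> / Gamma (\<beta> + 1)"
proof -
  let ?\<mu> = "lebesgue_on {0..t}"
  let ?k = "\<lambda>r. if a \<le> r then kern \<beta> b r else 0"
  have tail: "integrable ?\<mu> ?k" "(LINT r|?\<mu>. ?k r) = (b - a) powr \<beta> / Gamma (\<beta> + 1)"
    by (rule lebesgue_on_of_has_integral[OF kern_tail_has_integral], use assms kern_nonneg in auto)+
  have ia: "integrable ?\<mu> (kern \<beta> a)" "(LINT r|?\<mu>. kern \<beta> a r) = a powr \<beta> / Gamma (\<beta> + 1)"
    and ib: "integrable ?\<mu> (kern \<beta> b)" "(LINT r|?\<mu>. kern \<beta> b r) = b powr \<beta> / Gamma (\<beta> + 1)"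
    using assms by (auto intro!: kern_integrable)
  \<comment> \<open>Adding twice the tail \<open>?k\<close> corrects the sign past a, so three known
    integrals suffice and no interval has to be split.\<close>
  have abs: "\<bar>kern \<beta> b r - kern \<beta> a r\<bar> = kern \<beta> a r - kern \<beta> b r + 2 * ?k r" for r
  proof (cases "a \<le> r")
    case True
    then have "kern \<beta> a r = 0" by (auto simp: kern_def)
    with True show ?thesis using kern_nonneg[of \<beta> b r] \<beta> by auto
  next
    case False
    have "(b - r) powr (\<beta> - 1) \<le> (a - r) powr (\<beta> - 1)"
      by (rule powr_mono2') (use False assms in auto)
    then have "kern \<beta> b r \<le> kern \<beta> a r"
      using False assms by (auto simp: kern_def intro!: divide_right_mono Gamma_real_nonneg less_imp_le[OF Gamma_real_pos])
    with False show ?thesis by auto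
  qed
  have intb: "integrable ?\<mu> (\<lambda>r. kern \<beta> b r *\<^sub>R \<psi> r)" "integrable ?\<mu> (\<lambda>r. kern \<beta> a r *\<^sub>R \<psi> r)"
    using assms by (auto intro!: kern_integrable_scaleR[of _ _ _ _ M])
  have "norm (frac_int \<beta> \<psi> b - frac_int \<beta> \<psi> a) = norm (LINT r|?\<mu>. (kern \<beta> b r - kern \<beta> a r) *\<^sub>R \<psi> r)"
    using ab by (simp add: frac_int_kern[of _ t] scaleR_diff_left Bochner_Integration.integral_diff[OF intb])
  also have "\<dots> \<le> (LINT r|?\<mu>. norm ((kern \<beta> b r - kern \<beta> a r) *\<^sub>R \<psi> r))"
    by (rule integral_norm_bound)
  also have "\<dots> \<le> (LINT r|?\<mu>. (kern \<beta> a r - kern \<beta> b r + 2 * ?k r) * M)"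
  proof (rule integral_mono_AE)
    show "integrable ?\<mu> (\<lambda>r. norm ((kern \<beta> b r - kern \<beta> a r) *\<^sub>R \<psi> r))"
      using Bochner_Integration.integrable_diff[OF intb] by (simp add: scaleR_diff_left del: norm_scaleR)
    show "integrable ?\<mu> (\<lambda>r. (kern \<beta> a r - kern \<beta> b r + 2 * ?k r) * M)"
      using ia ib tail by (intro integrable_mult_left Bochner_Integration.integrable_add
        Bochner_Integration.integrable_diff integrable_mult_right) auto
    show "AE r in ?\<mu>. norm ((kern \<beta> b r - kern \<beta> a r) *\<^sub>R \<psi> r) \<le> (kern \<beta> a r - kern \<beta> b r + 2 * ?k r) * M"
      using bd
    proof eventually_elim
      case (elim r)
      show ?case unfolding norm_scaleR abs[symmetric] using elim by (intro mult_left_mono) auto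
    qed
  qed
  also have "\<dots> = (a powr \<beta> - b powr \<beta> + 2 * (b - a) powr \<beta>) / Gamma (\<beta> + 1) * M"
    using ia ib tail by (simp add: add_divide_distrib diff_divide_distrib del: if_split)
  also have "\<dots> \<le> (2 * (b - a) powr \<beta>) / Gamma (\<beta> + 1) * M"
    using ab \<beta> M powr_mono2[of \<beta> a b]
    by (intro mult_right_mono divide_right_mono less_imp_le[OF Gamma_real_pos]) auto
  finally show ?thesis by (simp add: mult_ac)
qed

lemma continuous_on_frac_int:
  fixes \<psi> :: "real \<Rightarrow> real ^ 'n"
  assumes \<beta>: "0 < \<beta>" "\<beta> \<le> 1"
    and m: "\<psi> \<in> borel_measurable (lebesgue_on {0..t})"
    and bd: "AE r in lebesgue_on {0..t}. norm (\<psi> r) \<le> M" and M: "0 \<le> M"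
  shows "continuous_on {0..t} (frac_int \<beta> \<psi>)"
  unfolding continuous_on
proof
  fix a assume a: "a \<in> {0..t}"
  have *: "norm (frac_int \<beta> \<psi> b - frac_int \<beta> \<psi> a) \<le> 2 * M * \<bar>b - a\<bar> powr \<beta> / Gamma (\<beta> + 1)"
    if "b \<in> {0..t}" for b
    using norm_frac_int_increment_le[OF \<beta> _ _ _ m bd M, of a b]
      norm_frac_int_increment_le[OF \<beta> _ _ _ m bd M, of b a] a that
    by (cases "a \<le> b") (auto simp: norm_minus_commute)
  have "((\<lambda>b. 2 * M * \<bar>b - a\<bar> powr \<beta> / Gamma (\<beta> + 1)) \<longlongrightarrow> 2 * M * \<bar>a - a\<bar> powr \<beta> / Gamma (\<beta> + 1)) (at a within {0..t})"
    using \<beta> by (intro tendsto_intros tendsto_powr') (auto simp: Gamma_eq_zero_iff dest: nonpos_Ints_nonpos)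
  then have "((\<lambda>b. 2 * M * \<bar>b - a\<bar> powr \<beta> / Gamma (\<beta> + 1)) \<longlongrightarrow> 0) (at a within {0..t})"
    by simp
  then have "((\<lambda>b. frac_int \<beta> \<psi> b - frac_int \<beta> \<psi> a) \<longlongrightarrow> 0) (at a within {0..t})"
    by (rule Lim_null_comparison[rotated]) (use * in \<open>auto simp: eventually_at_filter\<close>)
  then show "(frac_int \<beta> \<psi> \<longlongrightarrow> frac_int \<beta> \<psi> a) (at a within {0..t})"
    by (rule Lim_null[THEN iffD2])
qed

section \<open>Composition of complementary fractional integrals; Lebesgue differentiation\<close>

lemma kern_Beta:
  assumes \<beta>: "0 < \<beta>" "\<beta> < 1" and r: "0 \<le> r" "r < \<tau>" "\<tau> \<le> t"
  shows "((\<lambda>s. kern (1 - \<beta>) \<tau> s * kern \<beta> s r) has_integral 1) {0..t}"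
proof -
  have G: "Gamma \<beta> > 0" "Gamma (1 - \<beta>) > 0" using \<beta> by auto
  have "((\<lambda>s. s powr (\<beta> - 1) * (1 - s) powr (1 - \<beta> - 1)) has_integral Beta \<beta> (1 - \<beta>)) {0..1}"
    using \<beta> by (intro has_integral_Beta_real) auto
  \<comment> \<open>Substitution s = r + (\<tau> - r) x. The powers of \<tau> - r have total
    exponent (\<beta> - 1) - \<beta> + 1 = 0, and Beta \<beta> (1 - \<beta>) = Gamma \<beta> * Gamma
    (1 - \<beta>) cancels the normalisations of the two kernels.\<close>
  from has_integral_affinity[OF this[folded cbox_interval], of "1 / (\<tau> - r)" "-r / (\<tau> - r)"] r
  have "((\<lambda>s. (1 / (\<tau> - r) * s + - r / (\<tau> - r)) powr (\<beta> - 1) * (1 - (1 / (\<tau> - r) * s + - r / (\<tau> - r))) powr (1 - \<beta> - 1))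
      has_integral (\<tau> - r) * Beta \<beta> (1 - \<beta>)) ((\<lambda>s. (\<tau> - r) * s + r) ` {0..1})"
    by simp
  also have "(\<lambda>s. (\<tau> - r) * s + r) ` {0..1} = {r..\<tau>}"
    using r by (subst image_affinity_atLeastAtMost) auto
  finally have "((\<lambda>s. 1 / ((\<tau> - r) * Gamma \<beta> * Gamma (1 - \<beta>)) *
      ((1 / (\<tau> - r) * s + - r / (\<tau> - r)) powr (\<beta> - 1) * (1 - (1 / (\<tau> - r) * s + - r / (\<tau> - r))) powr (1 - \<beta> - 1)))
      has_integral 1 / ((\<tau> - r) * Gamma \<beta> * Gamma (1 - \<beta>)) * ((\<tau> - r) * Beta \<beta> (1 - \<beta>))) {r..\<tau>}"
    by (rule has_integral_mult_right)
  also have "1 / ((\<tau> - r) * Gamma \<beta> * Gamma (1 - \<beta>)) * ((\<tau> - r) * Beta \<beta> (1 - \<beta>)) = 1"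
    using G r by (simp add: Beta_def)
  finally have "((\<lambda>s. kern (1 - \<beta>) \<tau> s * kern \<beta> s r) has_integral 1) {r..\<tau>}"
  proof (rule has_integral_eq[rotated])
    fix s assume s: "s \<in> {r..\<tau>}"
    define d where "d = \<tau> - r"
    have d: "d > 0" using r by (simp add: d_def)
    have 1: "1 / d * s + - r / d = (s - r) / d"
      by (simp add: diff_divide_distrib)
    have 2: "1 - (s - r) / d = (\<tau> - s) / d"
      using d by (simp add: d_def field_simps)
    have dd: "d * (d powr (\<beta> - 1) * d powr (- \<beta>)) = 1"
      using d powr_add[of d "\<beta> - 1" "- \<beta>"] by (simp add: powr_minus_divide field_simps)
    have "1 / (d * Gamma \<beta> * Gamma (1 - \<beta>)) * (((s - r) / d) powr (\<beta> - 1) * ((\<tau> - s) / d) powr (1 - \<beta> - 1))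
        = (\<tau> - s) powr (- \<beta>) / Gamma (1 - \<beta>) * ((s - r) powr (\<beta> - 1) / Gamma \<beta>) * (1 / (d * (d powr (\<beta> - 1) * d powr (- \<beta>))))"
      using s d by (simp add: powr_divide mult_ac)
    also have "\<dots> = kern (1 - \<beta>) \<tau> s * kern \<beta> s r"
      unfolding dd using s r by (simp add: kern_def)
    finally show "1 / ((\<tau> - r) * Gamma \<beta> * Gamma (1 - \<beta>)) *
        ((1 / (\<tau> - r) * s + - r / (\<tau> - r)) powr (\<beta> - 1) * (1 - (1 / (\<tau> - r) * s + - r / (\<tau> - r))) powr (1 - \<beta> - 1))
      = kern (1 - \<beta>) \<tau> s * kern \<beta> s r"
      unfolding d_def[symmetric] 1 2 .
  qed
  then have "((\<lambda>s. if s \<in> {r..\<tau>} then kern (1 - \<beta>) \<tau> s * kern \<beta> s r else 0) has_integral 1) {0..t}"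
    using r by (subst has_integral_restrict) auto
  then show ?thesis
    by (rule has_integral_eq[rotated]) (use assms in \<open>auto simp: kern_def\<close>)
qed

lemma bounded_integrable_lebesgue_on:
  fixes \<psi> :: "real \<Rightarrow> 'a::euclidean_space"
  assumes "\<psi> \<in> borel_measurable (lebesgue_on {a..b})" "AE r in lebesgue_on {a..b}. norm (\<psi> r) \<le> M"
  shows "integrable (lebesgue_on {a..b}) \<psi>"
    and "\<psi> integrable_on {a..b}"
    and "(LINT x|lebesgue_on {a..b}. \<psi> x) = integral {a..b} \<psi>"
proof -
  interpret finite_measure "lebesgue_on {a..b}"
    by (rule finite_measure_lebesgue_on) auto
  show 1: "integrable (lebesgue_on {a..b}) \<psi>"
    by (rule integrable_const_bound) (use assms in auto)
  show "\<psi> integrable_on {a..b}" by (rule integrable_on_lebesgue_on[OF 1]) auto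
  show "(LINT x|lebesgue_on {a..b}. \<psi> x) = integral {a..b} \<psi>"
    by (rule lebesgue_integral_eq_integral[OF 1]) auto
qed

text \<open>Interchanging the integrations leaves for each r the inner integral of
  \<open>kern_Beta\<close>, which is 1 for r < \<tau>; for r >= \<tau> the product of the kernels
  vanishes.\<close>

lemma frac_int_frac_int:
  fixes \<psi> :: "real \<Rightarrow> real ^ 'n"
  assumes \<beta>: "0 < \<beta>" "\<beta> < 1" and \<tau>: "0 \<le> \<tau>" "\<tau> \<le> t"
    and [measurable]: "\<psi> \<in> borel_measurable (lebesgue_on {0..t})"
    and bd: "AE r in lebesgue_on {0..t}. norm (\<psi> r) \<le> M"
  shows "frac_int (1 - \<beta>) (frac_int \<beta> \<psi>) \<tau> = integral {0..\<tau>} \<psi>"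
proof -
  let ?\<mu> = "lebesgue_on {0..t}"
  interpret finite_measure ?\<mu> by (rule finite_measure_lebesgue_on) auto
  interpret pair_sigma_finite ?\<mu> ?\<mu> ..
  have [measurable]: "(\<lambda>x. x) \<in> ?\<mu> \<rightarrow>\<^sub>M borel"
    by (rule borel_measurable_lebesgue_on) simp
  have pm: "(\<lambda>p. (fst p, snd p)) \<in> ?\<mu> \<Otimes>\<^sub>M ?\<mu> \<rightarrow>\<^sub>M borel \<Otimes>\<^sub>M borel"
    by (intro measurable_Pair measurable_compose[OF measurable_fst] measurable_compose[OF measurable_snd]) measurable
  have [measurable]: "(\<lambda>p. kern \<beta> (fst p) (snd p)) \<in> borel_measurable (?\<mu> \<Otimes>\<^sub>M ?\<mu>)"
    using measurable_compose[OF pm kern_measurable_pair[of \<beta>]] by simp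
  let ?F = "\<lambda>s r. (kern (1 - \<beta>) \<tau> s * kern \<beta> s r) *\<^sub>R \<psi> r"
  have nn: "kern (1 - \<beta>) \<tau> s \<ge> 0" "kern \<beta> s r \<ge> 0" for s r
    using \<beta> by (auto intro!: kern_nonneg)
  have ik: "integrable ?\<mu> (\<lambda>r. kern \<beta> s r *\<^sub>R \<psi> r)" if "s \<in> {0..t}" for s
    using that \<beta> bd by (intro kern_integrable_scaleR) auto
  \<comment> \<open>The inner integral of the norm is at most kern (1 - \<beta>) \<tau> s times |M|
    t^\<beta> / Gamma (\<beta> + 1), which is integrable in s.\<close>
  have int: "integrable (?\<mu> \<Otimes>\<^sub>M ?\<mu>) (case_prod ?F)"
  proof (rule Fubini_integrable)
    show "case_prod ?F \<in> borel_measurable (?\<mu> \<Otimes>\<^sub>M ?\<mu>)"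
      unfolding split_beta by measurable
    show "AE s in ?\<mu>. integrable ?\<mu> (\<lambda>r. case_prod ?F (s, r))"
    proof (rule AE_I2)
      fix s assume "s \<in> space ?\<mu>"
      then have "integrable ?\<mu> (\<lambda>r. kern (1 - \<beta>) \<tau> s *\<^sub>R (kern \<beta> s r *\<^sub>R \<psi> r))"
        using ik by (intro integrable_scaleR_right) auto
      then show "integrable ?\<mu> (\<lambda>r. case_prod ?F (s, r))" by simp
    qed
    show "integrable ?\<mu> (\<lambda>s. LINT r|?\<mu>. norm (case_prod ?F (s, r)))"
    proof (rule Bochner_Integration.integrable_bound)
      show "integrable ?\<mu> (\<lambda>s. kern (1 - \<beta>) \<tau> s * (\<bar>M\<bar> * t powr \<beta> / Gamma (\<beta> + 1)))"
        using \<beta> \<tau> by (intro integrable_mult_left kern_integrable) auto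
      show "(\<lambda>s. LINT r|?\<mu>. norm (case_prod ?F (s, r))) \<in> borel_measurable ?\<mu>"
        unfolding split_beta fst_conv snd_conv by measurable
      show "AE s in ?\<mu>. norm (LINT r|?\<mu>. norm (case_prod ?F (s, r)))
          \<le> norm (kern (1 - \<beta>) \<tau> s * (\<bar>M\<bar> * t powr \<beta> / Gamma (\<beta> + 1)))"
      proof (rule AE_I2)
        fix s assume s: "s \<in> space ?\<mu>"
        have "(LINT r|?\<mu>. norm (case_prod ?F (s, r)))
            = kern (1 - \<beta>) \<tau> s * (LINT r|?\<mu>. norm (kern \<beta> s r *\<^sub>R \<psi> r))"
          using nn by (simp add: abs_mult mult.assoc)
        also have "(LINT r|?\<mu>. norm (kern \<beta> s r *\<^sub>R \<psi> r)) \<le> (LINT r|?\<mu>. kern \<beta> s r * \<bar>M\<bar>)"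
        proof (rule integral_mono_AE)
          show "integrable ?\<mu> (\<lambda>r. norm (kern \<beta> s r *\<^sub>R \<psi> r))"
            using ik s by (intro integrable_norm) auto
          show "integrable ?\<mu> (\<lambda>r. kern \<beta> s r * \<bar>M\<bar>)"
            using \<beta> s by (intro integrable_mult_left kern_integrable) auto
          show "AE r in ?\<mu>. norm (kern \<beta> s r *\<^sub>R \<psi> r) \<le> kern \<beta> s r * \<bar>M\<bar>"
            using bd by eventually_elim (use nn in \<open>auto intro!: mult_left_mono\<close>)
        qed
        also have "(LINT r|?\<mu>. kern \<beta> s r * \<bar>M\<bar>) = s powr \<beta> / Gamma (\<beta> + 1) * \<bar>M\<bar>"
          using \<beta> s kern_integrable[of \<beta> s t] by simp
        also have "\<dots> \<le> \<bar>M\<bar> * t powr \<beta> / Gamma (\<beta> + 1)"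
          using s \<beta> by (auto intro!: mult_left_mono divide_right_mono powr_mono2 less_imp_le[OF Gamma_real_pos] simp: mult.commute[of _ "\<bar>M\<bar>"])
        finally have "(LINT r|?\<mu>. norm (case_prod ?F (s, r))) \<le> kern (1 - \<beta>) \<tau> s * (\<bar>M\<bar> * t powr \<beta> / Gamma (\<beta> + 1))"
          using nn by (simp add: mult_left_mono)
        moreover have "(LINT r|?\<mu>. norm (case_prod ?F (s, r))) \<ge> 0"
          by (rule Bochner_Integration.integral_nonneg) auto
        ultimately show "norm (LINT r|?\<mu>. norm (case_prod ?F (s, r)))
          \<le> norm (kern (1 - \<beta>) \<tau> s * (\<bar>M\<bar> * t powr \<beta> / Gamma (\<beta> + 1)))"
          unfolding real_norm_def by linarith
      qed
    qed
  qed
  have "frac_int (1 - \<beta>) (frac_int \<beta> \<psi>) \<tau> = (LINT s|?\<mu>. kern (1 - \<beta>) \<tau> s *\<^sub>R frac_int \<beta> \<psi> s)"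
    using \<tau> by (rule frac_int_kern)
  also have "\<dots> = (LINT s|?\<mu>. LINT r|?\<mu>. ?F s r)"
    by (rule Bochner_Integration.integral_cong) (auto simp: frac_int_kern[of _ t] simp flip: scaleR_scaleR)
  also have "\<dots> = (LINT r|?\<mu>. LINT s|?\<mu>. ?F s r)"
    using Fubini_integral[OF int] by simp
  also have "\<dots> = (LINT r|?\<mu>. indicator {0..<\<tau>} r *\<^sub>R \<psi> r)"
  proof (rule Bochner_Integration.integral_cong)
    fix r assume r: "r \<in> space ?\<mu>"
    show "(LINT s|?\<mu>. ?F s r) = indicator {0..<\<tau>} r *\<^sub>R \<psi> r"
    proof (cases "r < \<tau>")
      case True
      have I: "((\<lambda>s. kern (1 - \<beta>) \<tau> s * kern \<beta> s r) has_integral 1) {0..t}"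
        using r True \<tau> \<beta> by (intro kern_Beta) auto
      have "integrable ?\<mu> (\<lambda>s. kern (1 - \<beta>) \<tau> s * kern \<beta> s r)"
        "(LINT s|?\<mu>. kern (1 - \<beta>) \<tau> s * kern \<beta> s r) = 1"
        by (rule lebesgue_on_of_has_integral[OF I], use nn in auto)+
      then show ?thesis using True r by simp
    next
      case False
      then have "kern (1 - \<beta>) \<tau> s * kern \<beta> s r = 0" for s by (auto simp: kern_def)
      then show ?thesis using False by (simp only: scaleR_zero_left) simp
    qed
  qed simp
  also have "\<dots> = (LINT r|?\<mu>. indicator {0..\<tau>} r *\<^sub>R \<psi> r)"
  proof (rule integral_cong_AE)
    have "AE r in lebesgue. r \<noteq> \<tau>"
      by (rule AE_completion) (rule AE_lborel_singleton)
    then have "AE r in ?\<mu>. r \<noteq> \<tau>"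
      by (auto simp: AE_restrict_space_iff elim!: eventually_mono)
    then show "AE r in ?\<mu>. indicator {0..<\<tau>} r *\<^sub>R \<psi> r = indicator {0..\<tau>} r *\<^sub>R \<psi> r"
      by eventually_elim (auto simp: indicator_def)
  qed (auto intro!: borel_measurable_scaleR borel_measurable_lebesgue_on)
  also have "\<dots> = (LINT r|lebesgue. indicator {0..t} r *\<^sub>R indicator {0..\<tau>} r *\<^sub>R \<psi> r)"
    by (subst integral_restrict_space) auto
  also have "\<dots> = (LINT r|lebesgue. indicator {0..\<tau>} r *\<^sub>R \<psi> r)"
    by (rule Bochner_Integration.integral_cong) (use \<tau> in \<open>auto simp: indicator_def\<close>)
  also have "\<dots> = (LINT r|lebesgue_on {0..\<tau>}. \<psi> r)"
    by (subst integral_restrict_space) auto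
  also have "\<dots> = integral {0..\<tau>} \<psi>"
  proof (rule bounded_integrable_lebesgue_on(3)[where M=M])
    show "\<psi> \<in> borel_measurable (lebesgue_on {0..\<tau>})"
      by (rule measurable_restrict_mono[OF assms(5)]) (use \<tau> in auto)
    show "AE r in lebesgue_on {0..\<tau>}. norm (\<psi> r) \<le> M"
      using bd \<tau> by (auto simp: AE_restrict_space_iff elim!: eventually_mono)
  qed
  finally show ?thesis .
qed

text \<open>\<open>integrable_ccontinuous_explicit\<close> controls the averages to the right of
  almost every point; applied to the reflected function it controls those to the left. Extension by
  zero outside [0, t] makes it applicable on every box.\<close>

lemma AE_indefinite_integral_derivative:
  fixes \<psi> :: "real \<Rightarrow> 'a::euclidean_space"
  assumes int: "\<psi> integrable_on {0..t}"
  shows "AE \<tau> in lebesgue_on {0..t}. ((\<lambda>s. integral {0..s} \<psi>) has_vector_derivative \<psi> \<tau>) (at \<tau> within {0..t})"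
proof -
  define g where "g x = (if x \<in> {0..t} then \<psi> x else 0)" for x
  have "g integrable_on UNIV"
    unfolding g_def by (subst integrable_restrict_UNIV) (rule int)
  then have gi: "g integrable_on cbox a b" for a b
    by (rule integrable_on_subcbox) auto
  have gri: "(\<lambda>x. g (- x)) integrable_on cbox a b" for a b
    using gi[of "-b" "-a"] Henstock_Kurzweil_Integration.integrable_reflect_real[where f=g and a="-b" and b="-a"] by simp
  obtain N1 where N1: "negligible N1" "\<And>x e. \<lbrakk>x \<notin> N1; 0 < e\<rbrakk> \<Longrightarrow>
      \<exists>d>0. \<forall>h. 0 < h \<and> h < d \<longrightarrow> norm (integral {x..x + h} g /\<^sub>R h - g x) < e"
    using integrable_ccontinuous_explicit[of g, OF gi] by auto
  obtain N2 where N2: "negligible N2" "\<And>x e. \<lbrakk>x \<notin> N2; 0 < e\<rbrakk> \<Longrightarrow>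
      \<exists>d>0. \<forall>h. 0 < h \<and> h < d \<longrightarrow> norm (integral {x..x + h} (\<lambda>x. g (- x)) /\<^sub>R h - g (- x)) < e"
    using integrable_ccontinuous_explicit[of "\<lambda>x. g (- x)", OF gri] by auto
  have scale: "norm (J - h *\<^sub>R y) \<le> e * h" if "0 < h" "norm (J /\<^sub>R h - y) < e" for J y :: 'a and h e :: real
  proof -
    have "J - h *\<^sub>R y = h *\<^sub>R (J /\<^sub>R h - y)" using that by (simp add: algebra_simps)
    then show ?thesis using that by (simp add: mult.commute less_imp_le)
  qed
  have der: "((\<lambda>s. integral {0..s} \<psi>) has_vector_derivative \<psi> \<tau>) (at \<tau> within {0..t})"
    if \<tau>: "\<tau> \<in> {0..t}" "\<tau> \<notin> N1" "- \<tau> \<notin> N2" for \<tau>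
    unfolding has_vector_derivative_def has_derivative_within_alt2
  proof (intro conjI allI impI)
    fix e :: real assume "e > 0"
    obtain d1 where d1: "d1 > 0" "\<And>h. 0 < h \<Longrightarrow> h < d1 \<Longrightarrow> norm (integral {\<tau>..\<tau> + h} g /\<^sub>R h - g \<tau>) < e"
      using N1(2)[OF \<tau>(2) \<open>e > 0\<close>] by blast
    obtain d2 where d2: "d2 > 0" "\<And>h. 0 < h \<Longrightarrow> h < d2 \<Longrightarrow> norm (integral {- \<tau>..- \<tau> + h} (\<lambda>x. g (- x)) /\<^sub>R h - g \<tau>) < e"
      using N2(2)[OF \<tau>(3) \<open>e > 0\<close>] by auto
    have split: "integral {0..b} \<psi> - integral {0..a} \<psi> = integral {a..b} g"
      if "0 \<le> a" "a \<le> b" "b \<le> t" for a b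
    proof -
      have "integral {0..a} \<psi> + integral {a..b} \<psi> = integral {0..b} \<psi>"
        by (rule Henstock_Kurzweil_Integration.integral_combine)
          (use that in \<open>auto intro: integrable_on_subinterval[OF int]\<close>)
      moreover have "integral {a..b} \<psi> = integral {a..b} g"
        by (rule Henstock_Kurzweil_Integration.integral_cong) (use that in \<open>auto simp: g_def\<close>)
      ultimately show ?thesis by (simp add: algebra_simps)
    qed
    have main: "norm (integral {0..s} \<psi> - integral {0..\<tau>} \<psi> - (s - \<tau>) *\<^sub>R \<psi> \<tau>) \<le> e * norm (s - \<tau>)"
      if s: "s \<in> {0..t}" "s \<noteq> \<tau>" "dist s \<tau> < min d1 d2" for s
    proof (cases "\<tau> < s")
      case True
      have "norm (integral {\<tau>..\<tau> + (s - \<tau>)} g - (s - \<tau>) *\<^sub>R g \<tau>) \<le> e * (s - \<tau>)"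
        by (rule scale[OF _ d1(2)]) (use s True in \<open>auto simp: dist_real_def\<close>)
      then show ?thesis using split[of \<tau> s] s True \<tau> by (simp add: g_def)
    next
      case False
      have "integral {- \<tau>..- s} (\<lambda>x. g (- x)) = integral {s..\<tau>} g"
        by simp
      moreover have "norm (integral {- \<tau>..- \<tau> + (\<tau> - s)} (\<lambda>x. g (- x)) - (\<tau> - s) *\<^sub>R g \<tau>) \<le> e * (\<tau> - s)"
        by (rule scale[OF _ d2(2)]) (use s False in \<open>auto simp: dist_real_def\<close>)
      ultimately have "norm (integral {s..\<tau>} g - (\<tau> - s) *\<^sub>R g \<tau>) \<le> e * (\<tau> - s)"
        by simp
      moreover have "integral {0..s} \<psi> - integral {0..\<tau>} \<psi> - (s - \<tau>) *\<^sub>R \<psi> \<tau>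
          = - (integral {s..\<tau>} g - (\<tau> - s) *\<^sub>R g \<tau>)"
        using split[of s \<tau>] s False \<tau> by (simp add: g_def algebra_simps)
      ultimately show ?thesis using s False by (simp only: norm_minus_cancel) auto
    qed
    show "\<forall>\<^sub>F s in at \<tau> within {0..t}. norm (integral {0..s} \<psi> - integral {0..\<tau>} \<psi> - (s - \<tau>) *\<^sub>R \<psi> \<tau>) \<le> e * norm (s - \<tau>)"
      unfolding eventually_at using main d1(1) d2(1) by (intro exI[of _ "min d1 d2"]) auto
  qed (rule bounded_linear_scaleR_left)
  \<comment> \<open>Reflection carries the exceptional set of the left averages back to the original
    variable.\<close>
  have "negligible (N1 \<union> uminus ` N2)"
    using N1 N2 by (intro negligible_Un negligible_differentiable_image_negligible[of N2 uminus]) (auto intro!: derivative_intros)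
  then have "N1 \<union> uminus ` N2 \<in> null_sets lebesgue"
    by (simp add: negligible_iff_null_sets)
  from AE_not_in[OF this] have "AE \<tau> in lebesgue. \<tau> \<in> {0..t} \<longrightarrow>
      ((\<lambda>s. integral {0..s} \<psi>) has_vector_derivative \<psi> \<tau>) (at \<tau> within {0..t})"
  proof eventually_elim
    case (elim \<tau>)
    then have "- \<tau> \<notin> N2" by (metis UnI2 image_eqI minus_minus)
    with elim der show ?case by blast
  qed
  then show ?thesis
    by (subst AE_restrict_space_iff) auto
qed

section \<open>Volterra equations with a weakly singular kernel\<close>

lemma kern_exp_measurable [measurable]:
  "(\<lambda>r. kern \<beta> s r * exp (k * (r - s))) \<in> borel_measurable (lebesgue_on S)"
  by (rule borel_measurable_lebesgue_on) measurable

lemma kern_exp_integrable: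
  assumes "0 < \<beta>" "0 \<le> s" "s \<le> t" "0 \<le> k"
  shows "integrable (lebesgue_on {0..t}) (\<lambda>r. kern \<beta> s r * exp (k * (r - s)))"
proof (rule Bochner_Integration.integrable_bound[OF kern_integrable(1)[OF assms(1-3)]])
  have "kern \<beta> s r * exp (k * (r - s)) \<le> kern \<beta> s r" for r
    using kern_nonneg[OF assms(1)] assms by (cases "r \<le> s") (auto simp: mult_nonneg_nonpos mult_left_le kern_def)
  then show "AE r in lebesgue_on {0..t}. norm (kern \<beta> s r * exp (k * (r - s))) \<le> norm (kern \<beta> s r)"
    using kern_nonneg[OF assms(1)] by (intro AE_I2) (auto simp: abs_mult)
qed measurable

text \<open>Bielecki's trick: in the norm weighted by \<open>exp (- k * s)\<close> the fractional integral is a small operator.\<close>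

lemma kern_exp_small:
  assumes \<beta>: "0 < \<beta>" and t: "0 \<le> t" and q: "0 < q"
  obtains k where "0 \<le> k"
    "\<And>s. s \<in> {0..t} \<Longrightarrow> (LINT r|lebesgue_on {0..t}. kern \<beta> s r * exp (k * (r - s))) \<le> q"
proof -
  let ?\<mu> = "lebesgue_on {0..t}"
  have G: "Gamma (\<beta> + 1) > 0" using \<beta> by auto
  \<comment> \<open>With this \<delta> the kernel mass of the window [s - \<delta>, s] is at most q
    / 2.\<close>
  define \<delta> where "\<delta> = (q / 2 * Gamma (\<beta> + 1)) powr (1 / \<beta>)"
  have \<delta>: "\<delta> > 0" "\<delta> powr \<beta> / Gamma (\<beta> + 1) = q / 2"
    using G q \<beta> less_imp_neq[OF G] by (auto simp: \<delta>_def powr_powr)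
  define c where "c = t powr \<beta> / Gamma (\<beta> + 1)"
  have c: "c \<ge> 0" using G by (simp add: c_def)
  \<comment> \<open>c bounds the total kernel mass. Before the window the weight is at most exp (- k
    * \<delta>) = 1 / (1 + 2 * c / q), so that part contributes at most q / 2 as well.\<close>
  define k where "k = ln (1 + 2 * c / q) / \<delta>"
  have k: "k \<ge> 0" using c q \<delta> by (simp add: k_def ln_ge_zero)
  have ek: "exp (- k * \<delta>) = 1 / (1 + 2 * c / q)"
    using \<delta> c q by (simp add: k_def exp_minus exp_ln add_pos_nonneg inverse_eq_divide)
  have small: "c * exp (- k * \<delta>) \<le> q / 2"
    unfolding ek using c q by (simp add: field_simps)
  have "(LINT r|?\<mu>. kern \<beta> s r * exp (k * (r - s))) \<le> q" if s: "s \<in> {0..t}" for s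
  proof -
    define a where "a = max 0 (s - \<delta>)"
    let ?k = "\<lambda>r. if a \<le> r then kern \<beta> s r else 0"
    have a: "0 \<le> a" "a \<le> s" using s \<delta> by (auto simp: a_def)
    have tail: "integrable ?\<mu> ?k" "(LINT r|?\<mu>. ?k r) = (s - a) powr \<beta> / Gamma (\<beta> + 1)"
      by (rule lebesgue_on_of_has_integral[OF kern_tail_has_integral], use assms a s kern_nonneg in auto)+
    have full: "integrable ?\<mu> (kern \<beta> s)" "(LINT r|?\<mu>. kern \<beta> s r) = s powr \<beta> / Gamma (\<beta> + 1)"
      using s \<beta> by (auto intro!: kern_integrable)
    have "(LINT r|?\<mu>. kern \<beta> s r * exp (k * (r - s))) \<le> (LINT r|?\<mu>. ?k r + kern \<beta> s r * exp (- k * \<delta>))"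
    proof (rule integral_mono)
      show "integrable ?\<mu> (\<lambda>r. kern \<beta> s r * exp (k * (r - s)))"
        using s \<beta> k by (intro kern_exp_integrable) auto
      show "integrable ?\<mu> (\<lambda>r. ?k r + kern \<beta> s r * exp (- k * \<delta>))"
        using tail full by (intro Bochner_Integration.integrable_add integrable_mult_left) auto
      fix r assume r: "r \<in> space ?\<mu>"
      have p: "kern \<beta> s r \<ge> 0" using kern_nonneg \<beta> by auto
      show "kern \<beta> s r * exp (k * (r - s)) \<le> ?k r + kern \<beta> s r * exp (- k * \<delta>)"
      proof (cases "a \<le> r")
        case True
        have "kern \<beta> s r * exp (k * (r - s)) \<le> kern \<beta> s r"
          using p k by (cases "r \<le> s") (auto simp: mult_nonneg_nonpos mult_left_le kern_def)
        moreover have "0 \<le> kern \<beta> s r * exp (- k * \<delta>)" using p by simp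
        ultimately show ?thesis using True by simp
      next
        case False
        then have "k * (r - s) \<le> - k * \<delta>"
          using k r mult_left_mono[of "r - s" "- \<delta>" k] by (auto simp: a_def)
        then show ?thesis using False p by (auto intro!: mult_left_mono)
      qed
    qed
    also have "\<dots> = (s - a) powr \<beta> / Gamma (\<beta> + 1) + s powr \<beta> / Gamma (\<beta> + 1) * exp (- k * \<delta>)"
      using tail full by (subst Bochner_Integration.integral_add) auto
    also have "\<dots> \<le> \<delta> powr \<beta> / Gamma (\<beta> + 1) + c * exp (- k * \<delta>)"
      unfolding c_def using s a \<beta> G
      by (intro add_mono mult_right_mono divide_right_mono powr_mono2) (auto simp: a_def)
    also have "\<dots> \<le> q" using small \<delta> by simp
    finally show ?thesis .
  qed
  with k show ?thesis by (rule that)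
qed

section \<open>Gronwall estimate and existence for Volterra equations\<close>

lemma frac_gronwall:
  fixes v :: "real \<Rightarrow> real"
  assumes \<beta>: "0 < \<beta>" and AC: "0 \<le> A" "0 \<le> C" "0 \<le> k"
    and v: "continuous_on {0..t} v" "\<And>s. s \<in> {0..t} \<Longrightarrow> 0 \<le> v s"
    and le: "\<And>s. s \<in> {0..t} \<Longrightarrow> v s \<le> A + C * (LINT r|lebesgue_on {0..t}. kern \<beta> s r * v r)"
    and small: "\<And>s. s \<in> {0..t} \<Longrightarrow> C * (LINT r|lebesgue_on {0..t}. kern \<beta> s r * exp (k * (r - s))) \<le> 1 / 2"
    and s: "s \<in> {0..t}"
  shows "v s \<le> 2 * A * exp (k * s)"
proof -
  let ?\<mu> = "lebesgue_on {0..t}"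
  \<comment> \<open>The inequality is evaluated only where exp (- k * s) * v s is maximal: there the
    weighted integral term is at most half the maximum m, so m <= A + m / 2. This replaces iterating
    the weakly singular kernel.\<close>
  have "continuous_on {0..t} (\<lambda>s. exp (- k * s) * v s)"
    using v by (intro continuous_intros)
  then obtain s0 where s0: "s0 \<in> {0..t}" and max: "\<And>s. s \<in> {0..t} \<Longrightarrow> exp (- k * s) * v s \<le> exp (- k * s0) * v s0"
    using continuous_attains_sup[of "{0..t}" "\<lambda>s. exp (- k * s) * v s"] s by auto
  define m where "m = exp (- k * s0) * v s0"
  have vm: "v r \<le> m * exp (k * r)" if "r \<in> {0..t}" for r
    using max[OF that] by (simp add: m_def exp_minus field_simps)
  have m0: "m \<ge> 0" using v s0 by (simp add: m_def)
  have p: "kern \<beta> s r \<ge> 0" for s r using kern_nonneg \<beta> by auto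
  have bd: "norm (v r) \<le> m * exp (k * t)" if "r \<in> {0..t}" for r
  proof -
    have "m * exp (k * r) \<le> m * exp (k * t)"
      using m0 AC that by (intro mult_left_mono) (auto intro: mult_left_mono)
    then show ?thesis
      using vm[OF that] v(2)[OF that] by simp
  qed
  have vmeas: "v \<in> borel_measurable ?\<mu>"
    using v by (intro continuous_imp_measurable_on_sets_lebesgue) auto
  have "(LINT r|?\<mu>. kern \<beta> s0 r * v r) \<le> (LINT r|?\<mu>. (m * exp (k * s0)) * (kern \<beta> s0 r * exp (k * (r - s0))))"
  proof (rule integral_mono)
    show "integrable ?\<mu> (\<lambda>r. kern \<beta> s0 r * v r)"
      using kern_integrable_scaleR[OF \<beta> _ _ vmeas AE_I2, of s0 "m * exp (k * t)"] s0 bd by auto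
    show "integrable ?\<mu> (\<lambda>r. (m * exp (k * s0)) * (kern \<beta> s0 r * exp (k * (r - s0))))"
      using \<beta> s0 AC by (intro integrable_mult_right kern_exp_integrable) auto
    fix r assume "r \<in> space ?\<mu>"
    then have "kern \<beta> s0 r * v r \<le> kern \<beta> s0 r * (m * exp (k * r))"
      using vm p by (auto intro!: mult_left_mono)
    also have "exp (k * r) = exp (k * s0) * exp (k * (r - s0))"
      by (simp flip: exp_add add: algebra_simps)
    finally show "kern \<beta> s0 r * v r \<le> (m * exp (k * s0)) * (kern \<beta> s0 r * exp (k * (r - s0)))"
      by (simp add: mult_ac)
  qed
  also have "\<dots> = (m * exp (k * s0)) * (LINT r|?\<mu>. kern \<beta> s0 r * exp (k * (r - s0)))"
    by simp
  finally have "C * (LINT r|?\<mu>. kern \<beta> s0 r * v r) \<le> (m * exp (k * s0)) * (C * (LINT r|?\<mu>. kern \<beta> s0 r * exp (k * (r - s0))))"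
    using AC by (simp add: mult_left_mono mult.left_commute)
  also have "\<dots> \<le> (m * exp (k * s0)) * (1 / 2)"
    using small[OF s0] m0 by (intro mult_left_mono) auto
  finally have "v s0 \<le> A + m * exp (k * s0) / 2"
    using le[OF s0] by simp
  then have "m \<le> exp (- k * s0) * (A + m * exp (k * s0) / 2)"
    unfolding m_def by (intro mult_left_mono) auto
  also have "\<dots> = exp (- k * s0) * A + m / 2"
    by (simp add: algebra_simps exp_minus)
  also have "exp (- k * s0) * A \<le> A"
    using AC s0 by (intro mult_left_le_one_le) auto
  finally have "m \<le> 2 * A" by simp
  then show ?thesis using vm[OF s] by (auto intro: order_trans mult_right_mono)
qed

text \<open>Contraction principle with factor 1/2. The bound and the Lipschitz condition are global
  in the state, so a locally Lipschitz right-hand side has to be truncated before use.\<close>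

lemma volterra_solution:
  fixes a :: "real \<Rightarrow> real ^ 'n" and g :: "real \<Rightarrow> real ^ 'n \<Rightarrow> real ^ 'n"
  assumes \<beta>: "0 < \<beta>" "\<beta> \<le> 1" and t: "0 \<le> t" and a: "continuous_on {0..t} a"
    and meas: "\<And>x. continuous_on {0..t} x \<Longrightarrow> (\<lambda>r. g r (x r)) \<in> borel_measurable (lebesgue_on {0..t})"
    and bd: "\<And>r x. r \<in> {0..t} \<Longrightarrow> norm (g r x) \<le> M"
    and L: "0 < L" and lip: "\<And>r x y. r \<in> {0..t} \<Longrightarrow> norm (g r x - g r y) \<le> L * norm (x - y)"
  obtains x where "continuous_on {0..t} x" "\<And>s. s \<in> {0..t} \<Longrightarrow> x s = a s + frac_int \<beta> (\<lambda>r. g r (x r)) s"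
proof -
  let ?\<mu> = "lebesgue_on {0..t}"
  obtain k where k: "0 \<le> k" and small: "\<And>s. s \<in> {0..t} \<Longrightarrow> (LINT r|?\<mu>. kern \<beta> s r * exp (k * (r - s))) \<le> 1 / (2 * L)"
    using kern_exp_small[OF \<beta>(1) t, of "1 / (2 * L)"] L by auto
  \<comment> \<open>The unknown is y(s) = exp(-k s) x(s), so the weighted norm of x becomes the
    plain sup norm of y.\<close>
  define \<psi> where "\<psi> y r = g r (exp (k * r) *\<^sub>R apply_bcontfun y r)" for y r
  define h where "h y s = exp (- k * s) *\<^sub>R (a s + frac_int \<beta> (\<psi> y) s)" for y s
  have M: "0 \<le> M" using bd[of 0 undefined] t by (auto intro: order_trans[OF norm_ge_zero])
  have \<psi>m: "\<psi> y \<in> borel_measurable ?\<mu>" for y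
    unfolding \<psi>_def by (intro meas continuous_intros continuous_on_apply_bcontfun)
  have \<psi>b: "AE r in ?\<mu>. norm (\<psi> y r) \<le> M" for y
    by (rule AE_I2) (auto simp: \<psi>_def intro!: bd)
  have "continuous_on {0..t} (h y)" for y
    unfolding h_def by (intro continuous_intros a continuous_on_frac_int[OF \<beta> \<psi>m \<psi>b M])
  \<comment> \<open>The complete space \<open>bcontfun\<close> consists of functions on the whole
    line, so beyond [0, t] the boundary values are continued through \<open>clamp\<close>.\<close>
  then have "\<exists>z. \<forall>s. apply_bcontfun z s = h y (clamp 0 t s)" for y
    by (rule continuous_on_cbox_bcontfunE[of 0 t "h y", unfolded cbox_interval]) blast
  then obtain \<Phi> where \<Phi>: "\<And>y s. apply_bcontfun (\<Phi> y) s = h y (clamp 0 t s)"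
    by metis
  have "dist (\<Phi> y) (\<Phi> z) \<le> 1 / 2 * dist y z" for y z
  proof (rule dist_bound)
    fix s'
    define s where "s = clamp 0 t s'"
    have s: "s \<in> {0..t}" using clamp_in_interval[of 0 t s'] t by (simp add: s_def)
    have "norm (frac_int \<beta> (\<lambda>r. \<psi> y r - \<psi> z r) s) \<le> (LINT r|?\<mu>. kern \<beta> s r * (L * dist y z * exp (k * r)))"
    proof (rule norm_frac_int_le)
      show "AE r in ?\<mu>. norm (\<psi> y r - \<psi> z r) \<le> L * dist y z * exp (k * r)"
      proof (rule AE_I2)
        fix r assume "r \<in> space ?\<mu>"
        then have "norm (\<psi> y r - \<psi> z r) \<le> L * norm (exp (k * r) *\<^sub>R y r - exp (k * r) *\<^sub>R z r)"
          unfolding \<psi>_def by (intro lip) auto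
        also have "\<dots> = L * exp (k * r) * dist (y r) (z r)"
          by (simp add: dist_norm flip: scaleR_diff_right)
        also have "\<dots> \<le> L * exp (k * r) * dist y z"
          using L by (intro mult_left_mono dist_bounded) auto
        finally show "norm (\<psi> y r - \<psi> z r) \<le> L * dist y z * exp (k * r)" by (simp add: mult_ac)
      qed
      show "\<bar>L * dist y z * exp (k * r)\<bar> \<le> L * dist y z * exp (k * t)" if "r \<in> {0..t}" for r
        using that L k by (auto simp: abs_mult intro!: mult_left_mono)
      show "(\<lambda>r. L * dist y z * exp (k * r)) \<in> borel_measurable ?\<mu>"
        by (rule borel_measurable_lebesgue_on) measurable
    qed (use \<beta> s \<psi>m in auto)
    also have "\<dots> = (LINT r|?\<mu>. (L * dist y z * exp (k * s)) * (kern \<beta> s r * exp (k * (r - s))))"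
      by (rule Bochner_Integration.integral_cong) (auto simp: algebra_simps exp_diff)
    also have "\<dots> = (L * dist y z * exp (k * s)) * (LINT r|?\<mu>. kern \<beta> s r * exp (k * (r - s)))"
      by simp
    also have "\<dots> \<le> (L * dist y z * exp (k * s)) * (1 / (2 * L))"
      using L by (intro mult_left_mono small s) auto
    also have "\<dots> = exp (k * s) * (1 / 2 * dist y z)" using L by simp
    finally have *: "norm (frac_int \<beta> (\<psi> y) s - frac_int \<beta> (\<psi> z) s) \<le> exp (k * s) * (1 / 2 * dist y z)"
      using frac_int_diff[OF \<beta>(1) _ _ \<psi>m \<psi>b \<psi>m \<psi>b, of s] s by simp
    have "dist (h y s) (h z s) = exp (- k * s) * norm (frac_int \<beta> (\<psi> y) s - frac_int \<beta> (\<psi> z) s)"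
      by (simp add: h_def dist_norm flip: scaleR_diff_right)
    also have "\<dots> \<le> exp (- k * s) * (exp (k * s) * (1 / 2 * dist y z))"
      using * by (intro mult_left_mono) auto
    also have "\<dots> = 1 / 2 * dist y z" by (simp add: exp_minus)
    finally show "dist (\<Phi> y s') (\<Phi> z s') \<le> 1 / 2 * dist y z"
      by (simp add: \<Phi> s_def)
  qed
  then obtain y where y: "\<Phi> y = y"
    using banach_fix_type[of "1 / 2" \<Phi>] by auto
  have yh: "apply_bcontfun y s = h y s" if "s \<in> {0..t}" for s
    using \<Phi>[of y s] that clamp_cancel_cbox[of s 0 t] by (simp add: y cbox_interval)
  show ?thesis
  proof (rule that)
    show "continuous_on {0..t} (\<lambda>s. exp (k * s) *\<^sub>R apply_bcontfun y s)"
      by (intro continuous_intros continuous_on_apply_bcontfun)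
    show "exp (k * s) *\<^sub>R apply_bcontfun y s = a s + frac_int \<beta> (\<lambda>r. g r (exp (k * r) *\<^sub>R apply_bcontfun y r)) s"
      if "s \<in> {0..t}" for s
      unfolding yh[OF that] h_def by (simp add: exp_minus \<psi>_def[abs_def])
  qed
qed

section \<open>Densities of fractionally absolutely continuous functions\<close>

text \<open>Membership in \<open>Linf t\<close> with the bound made explicit: compactness needs one
  M shared by a whole family of trajectories.\<close>

definition frac_density :: "real \<Rightarrow> real \<Rightarrow> (real \<Rightarrow> real ^ 'n) \<Rightarrow> bool" where
  "frac_density t M \<psi> \<longleftrightarrow> 0 \<le> M \<and> \<psi> \<in> borel_measurable (lebesgue_on {0..t}) \<and>
     (AE r in lebesgue_on {0..t}. norm (\<psi> r) \<le> M)"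

lemma frac_densityD:
  assumes "frac_density t M \<psi>"
  shows "0 \<le> M" "\<psi> \<in> borel_measurable (lebesgue_on {0..t})" "AE r in lebesgue_on {0..t}. norm (\<psi> r) \<le> M"
  using assms by (auto simp: frac_density_def)

lemma AE_lebesgue_on_iff:
  "(AE x in lebesgue_on {a..b::real}. Q x) \<longleftrightarrow> (AE x in lebesgue. x \<in> {a..b} \<longrightarrow> Q x)"
  by (subst AE_restrict_space_iff) auto

lemma AE_lebesgue_neq: "AE x in lebesgue. x \<noteq> (a::real)"
  by (rule AE_completion) (rule AE_lborel_singleton)

lemma frac_density_subset:
  assumes "frac_density t M \<psi>" "s \<le> t"
  shows "frac_density s M \<psi>"
proof -
  have "AE r in lebesgue_on {0..s}. norm (\<psi> r) \<le> M"
    using frac_densityD(3)[OF assms(1)] unfolding AE_lebesgue_on_iff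
    by eventually_elim (use assms(2) in auto)
  moreover have "\<psi> \<in> borel_measurable (lebesgue_on {0..s})"
    by (rule measurable_restrict_mono[OF frac_densityD(2)[OF assms(1)]]) (use assms(2) in auto)
  ultimately show ?thesis using frac_densityD(1)[OF assms(1)] by (simp add: frac_density_def)
qed

lemma AC_iff_frac_density:
  "x \<in> AC \<alpha> t \<longleftrightarrow> x \<in> extensional {0..t} \<and>
    (\<exists>\<psi> M. frac_density t M \<psi> \<and> (\<forall>\<tau>\<in>{0..t}. x \<tau> = x 0 + frac_int \<alpha> \<psi> \<tau>))"
proof -
  have "\<psi> \<in> Linf t \<longleftrightarrow> (\<exists>M. frac_density t M \<psi>)" for \<psi> :: "real \<Rightarrow> real ^ 'n"
  proof
    assume "\<psi> \<in> Linf t"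
    then obtain M where M: "\<psi> \<in> borel_measurable (lebesgue_on {0..t})" "AE r in lebesgue_on {0..t}. norm (\<psi> r) \<le> M"
      by (auto simp: Linf_def)
    \<comment> \<open>\<open>Linf\<close> admits a negative bound when [0, t] is a null set.\<close>
    have "AE r in lebesgue_on {0..t}. norm (\<psi> r) \<le> \<bar>M\<bar>"
      using M(2) by eventually_elim auto
    then show "\<exists>M. frac_density t M \<psi>" using M(1) by (auto simp: frac_density_def intro!: exI[of _ "\<bar>M\<bar>"])
  qed (auto simp: Linf_def frac_density_def)
  then show ?thesis unfolding AC_def by blast
qed

lemma AC_frac_densityE:
  assumes "x \<in> AC \<alpha> t"
  obtains \<psi> M where "frac_density t M \<psi>" "\<And>\<tau>. \<tau> \<in> {0..t} \<Longrightarrow> x \<tau> = x 0 + frac_int \<alpha> \<psi> \<tau>"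
proof -
  obtain \<psi> M where "frac_density t M \<psi>" "\<forall>\<tau>\<in>{0..t}. x \<tau> = x 0 + frac_int \<alpha> \<psi> \<tau>"
    using assms unfolding AC_iff_frac_density by blast
  then show thesis using that by blast
qed

lemma continuous_on_frac_density:
  assumes \<alpha>: "0 < \<alpha>" "\<alpha> \<le> 1" and d: "frac_density t M \<psi>"
    and x: "\<And>\<tau>. \<tau> \<in> {0..t} \<Longrightarrow> x \<tau> = y + frac_int \<alpha> \<psi> \<tau>"
  shows "continuous_on {0..t} x"
proof (rule continuous_on_eq)
  show "continuous_on {0..t} (\<lambda>\<tau>. y + frac_int \<alpha> \<psi> \<tau>)"
    by (intro continuous_intros continuous_on_frac_int[OF \<alpha> frac_densityD(2,3,1)[OF d]])
qed (simp add: x)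

lemma AC_continuous_on:
  assumes "0 < \<alpha>" "\<alpha> \<le> 1" "x \<in> AC \<alpha> t"
  shows "continuous_on {0..t} x"
proof -
  obtain \<psi> M where d: "frac_density t M \<psi>" "\<And>\<tau>. \<tau> \<in> {0..t} \<Longrightarrow> x \<tau> = x 0 + frac_int \<alpha> \<psi> \<tau>"
    using assms(3) by (rule AC_frac_densityE) blast
  show ?thesis by (rule continuous_on_frac_density[OF assms(1,2) d])
qed

lemma AC_restrict:
  assumes "x \<in> AC \<alpha> t" "0 \<le> s" "s \<le> t"
  shows "restrict x {0..s} \<in> AC \<alpha> s"
proof -
  obtain \<psi> M where d: "frac_density t M \<psi>" "\<And>\<tau>. \<tau> \<in> {0..t} \<Longrightarrow> x \<tau> = x 0 + frac_int \<alpha> \<psi> \<tau>"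
    using assms(1) by (rule AC_frac_densityE) blast
  have "restrict x {0..s} \<tau> = restrict x {0..s} 0 + frac_int \<alpha> \<psi> \<tau>" if "\<tau> \<in> {0..s}" for \<tau>
    using d(2)[of \<tau>] that assms by simp
  then show ?thesis using frac_density_subset[OF d(1) assms(3)]
    unfolding AC_iff_frac_density by blast
qed

lemma frac_int_complement_density:
  assumes \<alpha>: "0 < \<alpha>" "\<alpha> < 1" and d: "frac_density t M \<psi>"
    and x: "\<And>\<tau>. \<tau> \<in> {0..t} \<Longrightarrow> x \<tau> = x 0 + frac_int \<alpha> \<psi> \<tau>" and s: "s \<in> {0..t}"
  shows "frac_int (1 - \<alpha>) (\<lambda>r. x r - x 0) s = integral {0..s} \<psi>"
proof -
  have "frac_int (1 - \<alpha>) (\<lambda>r. x r - x 0) s = frac_int (1 - \<alpha>) (frac_int \<alpha> \<psi>) s"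
  proof (rule frac_int_cong)
    fix r assume "r \<in> {0..s}"
    then have "x r = x 0 + frac_int \<alpha> \<psi> r" using s by (intro x) auto
    then show "x r - x 0 = frac_int \<alpha> \<psi> r" by simp
  qed
  also have "\<dots> = integral {0..s} \<psi>"
    using s by (intro frac_int_frac_int[OF \<alpha> _ _ frac_densityD(2,3)[OF d]]) auto
  finally show ?thesis .
qed

lemma frac_density_integrable_on:
  assumes "frac_density t M \<psi>" shows "\<psi> integrable_on {0..t}"
  using bounded_integrable_lebesgue_on(2) frac_densityD[OF assms] by blast

text \<open>The fractional integral of x - x 0 is the integral of \<psi>, which has derivative
  \<psi> almost everywhere. Both directions are used: existence of motions reads the derivative off
  the density, uniqueness reads the density off the equation.\<close>

lemma AE_has_caputo_deriv_iff:
  assumes \<alpha>: "0 < \<alpha>" "\<alpha> < 1" and d: "frac_density t M \<psi>"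
    and x: "\<And>\<tau>. \<tau> \<in> {0..t} \<Longrightarrow> x \<tau> = x 0 + frac_int \<alpha> \<psi> \<tau>"
  shows "AE \<tau> in lebesgue. \<tau> \<in> {0..t} \<longrightarrow> (\<forall>y. has_caputo_deriv \<alpha> t x y \<tau> \<longleftrightarrow> y = \<psi> \<tau>)"
  using AE_indefinite_integral_derivative[OF frac_density_integrable_on[OF d]] AE_lebesgue_neq[of 0]
  unfolding AE_lebesgue_on_iff
proof eventually_elim
  case (elim \<tau>)
  show ?case
  proof (intro impI allI)
    fix y assume \<tau>: "\<tau> \<in> {0..t}"
    \<comment> \<open>Uniqueness of derivatives within [0, t] requires a nondegenerate interval;
      discarding \<tau> = 0 provides it.\<close>
    then have t: "0 < t" using elim by auto
    have eq: "frac_int (1 - \<alpha>) (\<lambda>r. x r - x 0) s = integral {0..s} \<psi>" if "s \<in> {0..t}" for s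
      by (rule frac_int_complement_density[OF \<alpha> d x that])
    have *: "has_caputo_deriv \<alpha> t x z \<tau> \<longleftrightarrow> ((\<lambda>s. integral {0..s} \<psi>) has_vector_derivative z) (at \<tau> within {0..t})" for z
      unfolding has_caputo_deriv_def
      by (rule has_vector_derivative_cong_ev) (simp_all add: eq[OF \<tau>] eq)
    have "((\<lambda>s. integral {0..s} \<psi>) has_vector_derivative \<psi> \<tau>) (at \<tau> within {0..t})"
      using elim \<tau> by blast
    then show "has_caputo_deriv \<alpha> t x y \<tau> \<longleftrightarrow> y = \<psi> \<tau>"
      unfolding * using vector_derivative_unique_within_closed_interval[of 0 t \<tau>] t \<tau> by auto
  qed
qed

lemma has_caputo_deriv_cong:
  assumes "\<And>r. r \<in> {0..t} \<Longrightarrow> x r = y r" "\<tau> \<in> {0..t}"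
  shows "has_caputo_deriv \<alpha> t x d \<tau> \<longleftrightarrow> has_caputo_deriv \<alpha> t y d \<tau>"
proof -
  have "frac_int (1 - \<alpha>) (\<lambda>r. x r - x 0) s = frac_int (1 - \<alpha>) (\<lambda>r. y r - y 0) s" if "s \<in> {0..t}" for s
    by (rule frac_int_cong) (use assms(1) that in auto)
  then show ?thesis unfolding has_caputo_deriv_def
    by (intro has_vector_derivative_cong_ev) (use assms in auto)
qed

lemma has_caputo_deriv_subset:
  "has_caputo_deriv \<alpha> t x d \<tau> \<Longrightarrow> s \<le> t \<Longrightarrow> has_caputo_deriv \<alpha> s x d \<tau>"
  unfolding has_caputo_deriv_def by (rule has_vector_derivative_within_subset) auto

text \<open>Both densities are almost everywhere the Caputo derivative of the same function.\<close>

lemma frac_density_unique: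
  assumes \<alpha>: "0 < \<alpha>" "\<alpha> < 1" and d: "frac_density t M \<psi>" "frac_density t M' \<psi>'"
    and x: "\<And>\<tau>. \<tau> \<in> {0..t} \<Longrightarrow> x \<tau> = x 0 + frac_int \<alpha> \<psi> \<tau>"
    and x': "\<And>\<tau>. \<tau> \<in> {0..t} \<Longrightarrow> x' \<tau> = x' 0 + frac_int \<alpha> \<psi>' \<tau>"
    and eq: "\<And>\<tau>. \<tau> \<in> {0..t} \<Longrightarrow> x \<tau> = x' \<tau>"
  shows "AE \<tau> in lebesgue. \<tau> \<in> {0..t} \<longrightarrow> \<psi> \<tau> = \<psi>' \<tau>"
proof -
  have "AE \<tau> in lebesgue. \<tau> \<in> {0..t} \<longrightarrow> (\<forall>y. has_caputo_deriv \<alpha> t x y \<tau> \<longleftrightarrow> y = \<psi> \<tau>)"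
    by (rule AE_has_caputo_deriv_iff[OF \<alpha> d(1) x])
  moreover have "AE \<tau> in lebesgue. \<tau> \<in> {0..t} \<longrightarrow> (\<forall>y. has_caputo_deriv \<alpha> t x' y \<tau> \<longleftrightarrow> y = \<psi>' \<tau>)"
    by (rule AE_has_caputo_deriv_iff[OF \<alpha> d(2) x'])
  ultimately show ?thesis
    by eventually_elim (use has_caputo_deriv_cong[of t x x', OF eq] in blast)
qed

section \<open>Measurability along controlled trajectories and a priori bounds\<close>

lemma piecewise_measurable_lebesgue_on:
  fixes \<psi> :: "real \<Rightarrow> 'a::euclidean_space"
  assumes "\<psi> \<in> borel_measurable (lebesgue_on {a..t})" "\<psi>' \<in> borel_measurable (lebesgue_on {t..b})"
  shows "(\<lambda>r. if r \<le> t then \<psi> r else \<psi>' r) \<in> borel_measurable (lebesgue_on {a..b})"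
proof -
  define h h' where "h r = (if r \<in> {a..t} then \<psi> r else 0)"
    and "h' r = (if r \<in> {t..b} then \<psi>' r else 0)" for r
  have [measurable]: "h \<in> borel_measurable lebesgue" "h' \<in> borel_measurable lebesgue"
    unfolding h_def h'_def by (intro borel_measurable_if_I assms; simp)+
  have "{r. r \<le> t} \<in> sets lebesgue"
    by (simp flip: atMost_def)
  then have "(\<lambda>r. if r \<le> t then h r else h' r) \<in> borel_measurable lebesgue"
    by (intro measurable_If) auto
  then have "(\<lambda>r. if r \<le> t then h r else h' r) \<in> borel_measurable (lebesgue_on {a..b})"
    by (rule measurable_restrict_space1)
  then show ?thesis
    by (rule measurable_cong[THEN iffD1, rotated]) (auto simp: h_def h'_def)
qed

text \<open>Continuity of h is given only on the set with times in [0, T] and control values in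
  \<open>P\<close>, so the triple is mapped into the borel space restricted to that set before
  composing.\<close>

lemma controlled_measurable:
  fixes h :: "real \<Rightarrow> real ^ 'n \<Rightarrow> real ^ 'm \<Rightarrow> 'a::euclidean_space"
  assumes h: "continuous_on ({0..T} \<times> UNIV \<times> P) (\<lambda>(\<tau>, x, u). h \<tau> x u)"
    and ab: "0 \<le> a" "b \<le> T" and x: "continuous_on {a..b} x"
    and u: "u \<in> borel_measurable (lebesgue_on {a..b})" "\<And>\<tau>. \<tau> \<in> {a..b} \<Longrightarrow> u \<tau> \<in> P"
  shows "(\<lambda>\<tau>. h \<tau> (x \<tau>) (u \<tau>)) \<in> borel_measurable (lebesgue_on {a..b})"
proof -
  have [measurable]: "x \<in> borel_measurable (lebesgue_on {a..b})"
    using x by (intro continuous_imp_measurable_on_sets_lebesgue) auto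
  have [measurable]: "(\<lambda>\<tau>. \<tau>) \<in> borel_measurable (lebesgue_on {a..b})"
    by (rule borel_measurable_lebesgue_on) measurable
  note [measurable] = u(1)
  have "(\<lambda>\<tau>. (\<tau>, x \<tau>, u \<tau>)) \<in> lebesgue_on {a..b} \<rightarrow>\<^sub>M restrict_space borel ({0..T} \<times> UNIV \<times> P)"
    by (rule measurable_restrict_space2) (use ab u(2) in \<open>auto intro!: borel_measurable_Pair\<close>)
  from measurable_compose[OF this borel_measurable_continuous_on_restrict[OF h]]
  show ?thesis by simp
qed

text \<open>Gronwall applied to 1 + |x|, with B + (1 + |x|) c <= (B + c) (1 + |x|). The radius is
  quantified before x, \<psi>, M and y because it must serve all motions at once and, in the
  existence proof, is fixed before the equation is truncated. The summand B leaves room for the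
  density of the prescribed history.\<close>

lemma frac_density_a_priori_bound:
  assumes \<alpha>: "0 < \<alpha>" "\<alpha> < 1" and t: "0 \<le> t" and B: "0 \<le> B" "0 < c"
  shows "\<exists>R>0. \<forall>(x :: real \<Rightarrow> real ^ 'n) \<psi> M y. frac_density t M \<psi> \<longrightarrow> (\<forall>\<tau>\<in>{0..t}. x \<tau> = y + frac_int \<alpha> \<psi> \<tau>) \<longrightarrow>
      norm y \<le> B \<longrightarrow> (AE r in lebesgue_on {0..t}. norm (\<psi> r) \<le> B + (1 + norm (x r)) * c) \<longrightarrow>
      (\<forall>\<tau>\<in>{0..t}. norm (x \<tau>) \<le> R)"
proof -
  let ?\<mu> = "lebesgue_on {0..t}"
  obtain k where k: "0 \<le> k" and small: "\<And>\<tau>. \<tau> \<in> {0..t} \<Longrightarrow> (LINT r|?\<mu>. kern \<alpha> \<tau> r * exp (k * (r - \<tau>))) \<le> 1 / (2 * (B + c))"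
    using kern_exp_small[OF \<alpha>(1) t, of "1 / (2 * (B + c))"] B by auto
  show ?thesis
  proof (intro exI[of _ "2 * (1 + B) * exp (k * t)"] conjI allI impI ballI)
    show "0 < 2 * (1 + B) * exp (k * t)" using B by simp
    fix x :: "real \<Rightarrow> real ^ 'n" and \<psi> M y \<tau>
    assume d: "frac_density t M \<psi>" and x': "\<forall>\<tau>\<in>{0..t}. x \<tau> = y + frac_int \<alpha> \<psi> \<tau>"
      and y: "norm y \<le> B" and bd: "AE r in ?\<mu>. norm (\<psi> r) \<le> B + (1 + norm (x r)) * c" and \<tau>: "\<tau> \<in> {0..t}"
    note x = bspec[OF x']
    have cx: "continuous_on {0..t} x"
      by (rule continuous_on_frac_density[OF _ _ d x]) (use \<alpha> in auto)
    have cv: "continuous_on {0..t} (\<lambda>\<tau>. 1 + norm (x \<tau>))"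
      by (intro continuous_intros cx)
    have "bounded (x ` {0..t})"
      by (intro compact_imp_bounded compact_continuous_image cx compact_Icc)
    then obtain D where D: "\<And>\<tau>. \<tau> \<in> {0..t} \<Longrightarrow> norm (x \<tau>) \<le> D"
      unfolding bounded_iff by blast
    have le: "1 + norm (x \<tau>) \<le> (1 + B) + (B + c) * (LINT r|?\<mu>. kern \<alpha> \<tau> r * (1 + norm (x r)))"
      if \<tau>: "\<tau> \<in> {0..t}" for \<tau>
    proof -
      have "norm (frac_int \<alpha> \<psi> \<tau>) \<le> (LINT r|?\<mu>. kern \<alpha> \<tau> r * ((B + c) * (1 + norm (x r))))"
      proof (rule norm_frac_int_le)
        show "(\<lambda>r. (B + c) * (1 + norm (x r))) \<in> borel_measurable ?\<mu>"
          by (intro continuous_imp_measurable_on_sets_lebesgue continuous_intros cx) auto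
        show "\<bar>(B + c) * (1 + norm (x r))\<bar> \<le> (B + c) * (1 + D)" if "r \<in> {0..t}" for r
          using D[OF that] B by (auto simp: abs_mult intro!: mult_left_mono)
        show "AE r in ?\<mu>. norm (\<psi> r) \<le> (B + c) * (1 + norm (x r))"
          using bd
        proof eventually_elim
          case (elim r)
          have "B * 1 \<le> B * (1 + norm (x r))" using B by (intro mult_left_mono) auto
          with elim show ?case by (simp add: algebra_simps)
        qed
      qed (use \<alpha> \<tau> frac_densityD[OF d] in auto)
      also have "\<dots> = (B + c) * (LINT r|?\<mu>. kern \<alpha> \<tau> r * (1 + norm (x r)))"
        by (simp add: mult.left_commute)
      finally show ?thesis
        using x[OF \<tau>] y norm_triangle_ineq[of y "frac_int \<alpha> \<psi> \<tau>"] by simp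
    qed
    have "1 + norm (x \<tau>) \<le> 2 * (1 + B) * exp (k * \<tau>)"
    proof (rule frac_gronwall[OF \<alpha>(1) _ _ k cv _ le _ \<tau>])
      show "(B + c) * (LINT r|?\<mu>. kern \<alpha> \<tau> r * exp (k * (r - \<tau>))) \<le> 1 / 2" if "\<tau> \<in> {0..t}" for \<tau>
      proof -
        have "(B + c) * (LINT r|?\<mu>. kern \<alpha> \<tau> r * exp (k * (r - \<tau>))) \<le> (B + c) * (1 / (2 * (B + c)))"
          using B by (intro mult_left_mono small that) auto
        also have "\<dots> = 1 / 2" using B by (simp add: field_simps)
        finally show ?thesis .
      qed
    qed (use B in auto)
    also have "\<dots> \<le> 2 * (1 + B) * exp (k * t)"
      using B k \<tau> by (intro mult_left_mono) (auto intro: mult_left_mono)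
    finally show "norm (x \<tau>) \<le> 2 * (1 + B) * exp (k * t)" by simp
  qed
qed

section \<open>Motions\<close>

lemma continuous_on_Icc_norm_bound:
  fixes x :: "real \<Rightarrow> 'a::real_normed_vector"
  assumes "continuous_on {a..b} x"
  obtains D where "0 \<le> D" "\<And>s. s \<in> {a..b} \<Longrightarrow> norm (x s) \<le> D"
proof -
  have "bounded (x ` {a..b})"
    by (intro compact_imp_bounded compact_continuous_image assms compact_Icc)
  then obtain D where D: "\<forall>z\<in>x ` {a..b}. norm z \<le> D"
    unfolding bounded_iff by blast
  show thesis
  proof (rule that)
    show "norm (x s) \<le> \<bar>D\<bar>" if "s \<in> {a..b}" for s
      using D that by force
  qed simp
qed

locale control_system =
  fixes \<alpha> T :: real
    and P :: "(real ^ 'm) set"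
    and f :: "real \<Rightarrow> real ^ 'n::finite \<Rightarrow> real ^ 'm \<Rightarrow> real ^ 'n"
  assumes T_pos: "0 < T" and alpha: "0 < \<alpha>" "\<alpha> < 1" and compact_P: "compact P"
    and f_cont: "continuous_on ({0..T} \<times> UNIV \<times> P) (\<lambda>(s, x, u). f s x u)"
    and f_lip: "\<forall>R > 0. \<exists>L > 0. \<forall>s \<in> {0..T}. \<forall>x x'. norm x \<le> R \<and> norm x' \<le> R \<longrightarrow>
           (\<forall>u \<in> P. norm (f s x u - f s x' u) \<le> L * norm (x - x'))"
    and f_growth: "\<exists>c > 0. \<forall>s \<in> {0..T}. \<forall>x. \<forall>u \<in> P. norm (f s x u) \<le> (1 + norm x) * c"
begin

lemma alpha_le: "\<alpha> \<le> 1" using alpha by simp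

definition is_motion where
  "is_motion t w \<theta> u x \<longleftrightarrow> x \<in> AC \<alpha> \<theta> \<and> (\<forall>s\<in>{0..t}. x s = w s) \<and>
     (AE s in lebesgue_on {t..\<theta>}. has_caputo_deriv \<alpha> \<theta> x (f s (x s) (u s)) s)"

lemma motion_eq_The: "motion \<alpha> f t w \<theta> u = (THE x. is_motion t w \<theta> u x)"
  by (simp add: motion_def is_motion_def)

lemma is_motionD:
  assumes "is_motion t w \<theta> u x"
  shows "x \<in> AC \<alpha> \<theta>" "\<And>s. s \<in> {0..t} \<Longrightarrow> x s = w s"
    "AE s in lebesgue. s \<in> {t..\<theta>} \<longrightarrow> has_caputo_deriv \<alpha> \<theta> x (f s (x s) (u s)) s"
  using assms by (auto simp: is_motion_def AE_lebesgue_on_iff)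

lemma is_motion_density:
  assumes t: "0 \<le> t" and x: "is_motion t w \<theta> u x" and d: "frac_density \<theta> M \<psi>"
    and eq: "\<And>s. s \<in> {0..\<theta>} \<Longrightarrow> x s = x 0 + frac_int \<alpha> \<psi> s"
  shows "AE s in lebesgue. s \<in> {t..\<theta>} \<longrightarrow> \<psi> s = f s (x s) (u s)"
proof -
  have "AE s in lebesgue. s \<in> {0..\<theta>} \<longrightarrow> (\<forall>y. has_caputo_deriv \<alpha> \<theta> x y s \<longleftrightarrow> y = \<psi> s)"
    by (rule AE_has_caputo_deriv_iff[OF alpha d eq])
  then show ?thesis using is_motionD(3)[OF x]
    by eventually_elim (use t in \<open>auto\<close>)
qed

text \<open>The equation is imposed only after t. This fixes the density on the past, which enters
  every later value of the fractional integral.\<close>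

lemma agree_imp_densities_agree:
  assumes x: "frac_density \<theta> M \<psi>" "\<And>s. s \<in> {0..\<theta>} \<Longrightarrow> x s = x 0 + frac_int \<alpha> \<psi> s"
    and w: "frac_density t M' \<psi>'" "\<And>s. s \<in> {0..t} \<Longrightarrow> w s = w 0 + frac_int \<alpha> \<psi>' s"
    and le: "t \<le> \<theta>" and eq: "\<And>s. s \<in> {0..t} \<Longrightarrow> x s = w s"
  shows "AE s in lebesgue. s \<in> {0..t} \<longrightarrow> \<psi> s = \<psi>' s"
  by (rule frac_density_unique[OF alpha frac_density_subset[OF x(1) le] w(1) _ w(2) eq])
    (use le in \<open>auto intro!: x(2)\<close>)

text \<open>On [0, t] the density is that of w, afterwards it is f along the motion, which the a
  priori radius R bounds. As R and M do not depend on the control, the common M yields both the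
  equicontinuity of all motions and the regularity of their uniform limits.\<close>

lemma motion_bounds:
  assumes t: "0 \<le> t" "t \<le> \<theta>" "\<theta> \<le> T" and w: "w \<in> AC \<alpha> t"
  obtains R M where "0 < R" "\<And>u x s. u \<in> controls P t \<theta> \<Longrightarrow> is_motion t w \<theta> u x \<Longrightarrow> s \<in> {0..\<theta>} \<Longrightarrow> norm (x s) \<le> R"
    "\<And>u x. u \<in> controls P t \<theta> \<Longrightarrow> is_motion t w \<theta> u x \<Longrightarrow>
      \<exists>\<psi>. frac_density \<theta> M \<psi> \<and> (\<forall>s\<in>{0..\<theta>}. x s = w 0 + frac_int \<alpha> \<psi> s)"
proof -
  obtain c where c: "0 < c" "\<And>s x u. s \<in> {0..T} \<Longrightarrow> u \<in> P \<Longrightarrow> norm (f s x u) \<le> (1 + norm x) * c"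
    using f_growth by blast
  obtain \<psi>w Mw where \<psi>w: "frac_density t Mw \<psi>w" "\<And>s. s \<in> {0..t} \<Longrightarrow> w s = w 0 + frac_int \<alpha> \<psi>w s"
    using w by (rule AC_frac_densityE) blast
  define B where "B = max (norm (w 0)) Mw"
  have B: "0 \<le> B" "norm (w 0) \<le> B" "Mw \<le> B" using frac_densityD(1)[OF \<psi>w(1)] by (auto simp: B_def max_def)
  from frac_density_a_priori_bound[OF alpha order_trans[OF t(1,2)] B(1) c(1)]
  obtain R where R: "0 < R" and R': "\<forall>(x :: real \<Rightarrow> real ^ 'n) \<psi> M y. frac_density \<theta> M \<psi> \<longrightarrow> (\<forall>s\<in>{0..\<theta>}. x s = y + frac_int \<alpha> \<psi> s) \<longrightarrow>
      norm y \<le> B \<longrightarrow> (AE r in lebesgue_on {0..\<theta>}. norm (\<psi> r) \<le> B + (1 + norm (x r)) * c) \<longrightarrow>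
      (\<forall>s\<in>{0..\<theta>}. norm (x s) \<le> R)"
    by (elim exE conjE)
  have main: "(\<forall>s\<in>{0..\<theta>}. norm (x s) \<le> R) \<and> (\<exists>\<psi>. frac_density \<theta> (B + (1 + R) * c) \<psi> \<and> (\<forall>s\<in>{0..\<theta>}. x s = w 0 + frac_int \<alpha> \<psi> s))"
    if u: "u \<in> controls P t \<theta>" and x: "is_motion t w \<theta> u x" for u x
  proof -
    obtain \<psi> M where \<psi>: "frac_density \<theta> M \<psi>" "\<And>s. s \<in> {0..\<theta>} \<Longrightarrow> x s = x 0 + frac_int \<alpha> \<psi> s"
      using is_motionD(1)[OF x] by (rule AC_frac_densityE) blast
    have x0: "x 0 = w 0" using is_motionD(2)[OF x] t by auto
    have "AE s in lebesgue. s \<in> {0..t} \<longrightarrow> \<psi> s = \<psi>w s"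
      by (rule agree_imp_densities_agree[OF \<psi> \<psi>w t(2) is_motionD(2)[OF x]])
    moreover have "AE s in lebesgue. s \<in> {0..t} \<longrightarrow> norm (\<psi>w s) \<le> Mw"
      using frac_densityD(3)[OF \<psi>w(1)] by (simp only: AE_lebesgue_on_iff)
    moreover have "AE s in lebesgue. s \<in> {t..\<theta>} \<longrightarrow> \<psi> s = f s (x s) (u s)"
      by (rule is_motion_density[OF t(1) x \<psi>])
    ultimately have bd: "AE r in lebesgue. r \<in> {0..\<theta>} \<longrightarrow> norm (\<psi> r) \<le> B + (1 + norm (x r)) * c"
    proof eventually_elim
      case (elim r)
      show ?case
      proof
        assume r: "r \<in> {0..\<theta>}"
        have p: "0 \<le> (1 + norm (x r)) * c" using c by simp
        show "norm (\<psi> r) \<le> B + (1 + norm (x r)) * c"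
        proof (cases "r \<le> t")
          case True
          then have "norm (\<psi> r) \<le> Mw" using elim r by auto
          then show ?thesis using p B by linarith
        next
          case False
          then have "\<psi> r = f r (x r) (u r)" using elim r by auto
          moreover have "u r \<in> P" using u False r by (auto simp: controls_def)
          ultimately have "norm (\<psi> r) \<le> (1 + norm (x r)) * c" using c(2) r t by auto
          then show ?thesis using B by linarith
        qed
      qed
    qed
    have eq: "\<forall>s\<in>{0..\<theta>}. x s = w 0 + frac_int \<alpha> \<psi> s"
      using \<psi>(2) x0 by metis
    have xR: "norm (x s) \<le> R" if "s \<in> {0..\<theta>}" for s
      using R'[rule_format, OF \<psi>(1) eq[rule_format] B(2) _ that] bd by (simp only: AE_lebesgue_on_iff)
    have "AE r in lebesgue. r \<in> {0..\<theta>} \<longrightarrow> norm (\<psi> r) \<le> B + (1 + R) * c"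
      using bd
    proof eventually_elim
      case (elim r)
      have "(1 + norm (x r)) * c \<le> (1 + R) * c" if "r \<in> {0..\<theta>}"
        using xR[OF that] c by (intro mult_right_mono) auto
      then show ?case using elim by force
    qed
    then have "frac_density \<theta> (B + (1 + R) * c) \<psi>"
      using frac_densityD[OF \<psi>(1)] B R c(1) by (simp add: frac_density_def AE_lebesgue_on_iff)
    then show ?thesis using xR eq by blast
  qed
  show thesis
    by (rule that[OF R]) (use main in blast)+
qed

section \<open>Uniqueness and existence of motions\<close>

lemma is_motion_unique:
  assumes t: "0 \<le> t" "t \<le> \<theta>" "\<theta> \<le> T" and u: "\<And>s. s \<in> {t<..<\<theta>} \<Longrightarrow> u s \<in> P"
    and x: "is_motion t w \<theta> u x" and y: "is_motion t w \<theta> u y"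
  shows "x = y"
proof -
  let ?\<mu> = "lebesgue_on {0..\<theta>}"
  obtain \<psi>x Mx where \<psi>x: "frac_density \<theta> Mx \<psi>x" "\<And>s. s \<in> {0..\<theta>} \<Longrightarrow> x s = x 0 + frac_int \<alpha> \<psi>x s"
    using is_motionD(1)[OF x] by (rule AC_frac_densityE) blast
  obtain \<psi>y My where \<psi>y: "frac_density \<theta> My \<psi>y" "\<And>s. s \<in> {0..\<theta>} \<Longrightarrow> y s = y 0 + frac_int \<alpha> \<psi>y s"
    using is_motionD(1)[OF y] by (rule AC_frac_densityE) blast
  have cx: "continuous_on {0..\<theta>} x" and cy: "continuous_on {0..\<theta>} y"
    using AC_continuous_on[OF alpha(1) alpha_le] is_motionD(1) x y by blast+
  obtain Dx where Dx: "0 \<le> Dx" "\<And>s. s \<in> {0..\<theta>} \<Longrightarrow> norm (x s) \<le> Dx"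
    using continuous_on_Icc_norm_bound[OF cx] by blast
  obtain Dy where Dy: "0 \<le> Dy" "\<And>s. s \<in> {0..\<theta>} \<Longrightarrow> norm (y s) \<le> Dy"
    using continuous_on_Icc_norm_bound[OF cy] by blast
  have eqt: "x s = y s" if "s \<in> {0..t}" for s
    using is_motionD(2)[OF x that] is_motionD(2)[OF y that] by simp
  \<comment> \<open>The summand 1 keeps the radius positive when both motions vanish
    identically.\<close>
  have "0 < 1 + Dx + Dy" using Dx Dy by simp
  from f_lip[rule_format, OF this]
  obtain L where L: "0 < L" and lip': "\<forall>s \<in> {0..T}. \<forall>z z'. norm z \<le> 1 + Dx + Dy \<and> norm z' \<le> 1 + Dx + Dy \<longrightarrow>
           (\<forall>v \<in> P. norm (f s z v - f s z' v) \<le> L * norm (z - z'))"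
    by (elim exE conjE)
  have lip: "norm (f s z v - f s z' v) \<le> L * norm (z - z')"
    if "s \<in> {0..T}" "norm z \<le> 1 + Dx + Dy" "norm z' \<le> 1 + Dx + Dy" "v \<in> P" for s z z' v
    using lip' that by blast
  have "AE s in lebesgue. s \<in> {0..t} \<longrightarrow> \<psi>x s = \<psi>y s"
    by (rule agree_imp_densities_agree[OF \<psi>x frac_density_subset[OF \<psi>y(1) t(2)] _ t(2) eqt])
      (use t in \<open>auto intro!: \<psi>y(2)\<close>)
  moreover have "AE s in lebesgue. s \<in> {t..\<theta>} \<longrightarrow> \<psi>x s = f s (x s) (u s)"
    by (rule is_motion_density[OF t(1) x \<psi>x])
  moreover have "AE s in lebesgue. s \<in> {t..\<theta>} \<longrightarrow> \<psi>y s = f s (y s) (u s)"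
    by (rule is_motion_density[OF t(1) y \<psi>y])
  ultimately have bd: "AE r in lebesgue. r \<in> {0..\<theta>} \<longrightarrow> norm (\<psi>x r - \<psi>y r) \<le> L * norm (x r - y r)"
    using AE_lebesgue_neq[of \<theta>]
  proof eventually_elim
    case (elim r)
    show ?case
    proof
      assume r: "r \<in> {0..\<theta>}"
      show "norm (\<psi>x r - \<psi>y r) \<le> L * norm (x r - y r)"
      proof (cases "r \<le> t")
        case True
        then show ?thesis using elim r L by auto
      next
        case False
        then have "u r \<in> P" "\<psi>x r = f r (x r) (u r)" "\<psi>y r = f r (y r) (u r)"
          using elim r u by auto
        moreover have "r \<in> {0..T}" "norm (x r) \<le> 1 + Dx + Dy" "norm (y r) \<le> 1 + Dx + Dy"
          using r t Dx(1) Dy(1) Dx(2)[OF r] Dy(2)[OF r] by auto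
        ultimately show ?thesis using lip by simp
      qed
    qed
  qed
  obtain k where k: "0 \<le> k" and small: "\<And>s. s \<in> {0..\<theta>} \<Longrightarrow> (LINT r|?\<mu>. kern \<alpha> s r * exp (k * (r - s))) \<le> 1 / (2 * L)"
    using kern_exp_small[OF alpha(1), of \<theta> "1 / (2 * L)"] L t by auto
  \<comment> \<open>Gronwall with A = 0: the densities agree up to t and differ by at most L |x - y|
    beyond it.\<close>
  have zero: "norm (x s - y s) \<le> 2 * 0 * exp (k * s)" if s: "s \<in> {0..\<theta>}" for s
  proof (rule frac_gronwall[OF alpha(1) _ _ k _ _ _ _ s])
    show "continuous_on {0..\<theta>} (\<lambda>s. norm (x s - y s))"
      by (intro continuous_intros cx cy)
    fix s assume s: "s \<in> {0..\<theta>}"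
    show "L * (LINT r|?\<mu>. kern \<alpha> s r * exp (k * (r - s))) \<le> 1 / 2"
      using small[OF s] L by (simp add: field_simps)
    have "norm (frac_int \<alpha> (\<lambda>r. \<psi>x r - \<psi>y r) s) \<le> (LINT r|?\<mu>. kern \<alpha> s r * (L * norm (x r - y r)))"
    proof (rule norm_frac_int_le)
      show "(\<lambda>r. \<psi>x r - \<psi>y r) \<in> borel_measurable ?\<mu>"
        using frac_densityD(2)[OF \<psi>x(1)] frac_densityD(2)[OF \<psi>y(1)] by measurable
      show "(\<lambda>r. L * norm (x r - y r)) \<in> borel_measurable ?\<mu>"
        by (intro continuous_imp_measurable_on_sets_lebesgue continuous_intros cx cy) auto
      show "\<bar>L * norm (x r - y r)\<bar> \<le> L * (Dx + Dy)" if "r \<in> {0..\<theta>}" for r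
        using Dx(2)[OF that] Dy(2)[OF that] L norm_triangle_ineq4[of "x r" "y r"]
        by (auto simp: abs_mult intro!: mult_left_mono)
    qed (use alpha s bd in \<open>auto simp: AE_lebesgue_on_iff\<close>)
    also have "\<dots> = L * (LINT r|?\<mu>. kern \<alpha> s r * norm (x r - y r))"
      by (simp add: mult.left_commute)
    finally show "norm (x s - y s) \<le> 0 + L * (LINT r|?\<mu>. kern \<alpha> s r * norm (x r - y r))"
      using frac_int_diff[OF alpha(1) _ _ frac_densityD(2,3)[OF \<psi>x(1)] frac_densityD(2,3)[OF \<psi>y(1)], of s]
        \<psi>x(2)[OF s] \<psi>y(2)[OF s] s eqt[of 0] t by simp
  qed (use L in auto)
  show ?thesis
  proof (rule extensionalityI)
    show "x \<in> extensional {0..\<theta>}" "y \<in> extensional {0..\<theta>}"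
      using is_motionD(1) x y by (auto simp: AC_def)
  qed (use zero in auto)
qed

text \<open>f is only locally Lipschitz, so it is composed with the projection onto the ball of the
  a priori radius R. The projection is nonexpansive and fixes 0, so the growth bound survives; the
  truncated solution therefore stays in the ball, where the projection is the identity.\<close>

lemma is_motion_exists:
  assumes t: "0 \<le> t" "t \<le> \<theta>" "\<theta> \<le> T" and w: "w \<in> AC \<alpha> t" and u: "u \<in> controls P t \<theta>"
  shows "\<exists>x. is_motion t w \<theta> u x"
proof -
  let ?\<mu> = "lebesgue_on {0..\<theta>}"
  have uP: "u r \<in> P" if "r \<in> {t..\<theta>}" for r using u that by (auto simp: controls_def)
  have um: "u \<in> borel_measurable (lebesgue_on {t..\<theta>})" using u by (simp add: controls_def)
  obtain c where c: "0 < c" "\<And>s x u. s \<in> {0..T} \<Longrightarrow> u \<in> P \<Longrightarrow> norm (f s x u) \<le> (1 + norm x) * c"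
    using f_growth by blast
  obtain \<psi>w Mw where \<psi>w: "frac_density t Mw \<psi>w" "\<And>s. s \<in> {0..t} \<Longrightarrow> w s = w 0 + frac_int \<alpha> \<psi>w s"
    using w by (rule AC_frac_densityE) blast
  define B where "B = max (norm (w 0)) Mw"
  have B: "0 \<le> B" "norm (w 0) \<le> B" "Mw \<le> B" using frac_densityD(1)[OF \<psi>w(1)] by (auto simp: B_def max_def)
  from frac_density_a_priori_bound[OF alpha order_trans[OF t(1,2)] B(1) c(1)]
  obtain R where R: "0 < R" and R': "\<forall>(x :: real \<Rightarrow> real ^ 'n) \<psi> M y. frac_density \<theta> M \<psi> \<longrightarrow> (\<forall>s\<in>{0..\<theta>}. x s = y + frac_int \<alpha> \<psi> s) \<longrightarrow>
      norm y \<le> B \<longrightarrow> (AE r in lebesgue_on {0..\<theta>}. norm (\<psi> r) \<le> B + (1 + norm (x r)) * c) \<longrightarrow>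
      (\<forall>s\<in>{0..\<theta>}. norm (x s) \<le> R)"
    by (elim exE conjE)
  from f_lip[rule_format, OF R]
  obtain L where L: "0 < L" and lip: "\<forall>s \<in> {0..T}. \<forall>z z'. norm z \<le> R \<and> norm z' \<le> R \<longrightarrow>
           (\<forall>v \<in> P. norm (f s z v - f s z' v) \<le> L * norm (z - z'))"
    by (elim exE conjE)
  define proj :: "real ^ 'n \<Rightarrow> real ^ 'n" where "proj = closest_point (cball 0 R)"
  have ball: "convex (cball (0 :: real ^ 'n) R)" "closed (cball (0 :: real ^ 'n) R)" "cball (0 :: real ^ 'n) R \<noteq> {}"
    using R by auto
  have proj_R: "norm (proj z) \<le> R" for z
    using closest_point_in_set[OF ball(2,3), of z] by (simp add: proj_def)
  have proj_id: "proj z = z" if "norm z \<le> R" for z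
    unfolding proj_def by (rule closest_point_self) (use that in simp)
  have proj_lip: "norm (proj z - proj z') \<le> norm (z - z')" for z z'
    using closest_point_lipschitz[OF ball] by (simp add: proj_def dist_norm)
  have proj_le: "norm (proj z) \<le> norm z" for z
    using proj_lip[of z 0] proj_id[of 0] R by simp
  have proj_cont: "continuous_on S proj" for S
    unfolding proj_def by (rule continuous_on_closest_point[OF ball])
  \<comment> \<open>Past and dynamics are separated: \<open>g\<close> vanishes up to t, and the
    history enters only through \<open>\<psi>0\<close>, the density of w continued by zero. So the
    solution coincides with w on [0, t].\<close>
  define g where "g r z = (if r \<le> t then 0 else f r (proj z) (u r))" for r z
  have g_meas: "(\<lambda>r. g r (x r)) \<in> borel_measurable ?\<mu>" if x: "continuous_on {0..\<theta>} x" for x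
  proof -
    have "continuous_on {t..\<theta>} (\<lambda>r. proj (x r))"
      by (rule continuous_on_compose2[OF proj_cont, of _ _ UNIV])
        (use t in \<open>auto intro: continuous_on_subset[OF x]\<close>)
    then show ?thesis
      unfolding g_def using t
      by (intro piecewise_measurable_lebesgue_on controlled_measurable[OF f_cont] um uP) auto
  qed
  have g_growth: "norm (g r z) \<le> (1 + norm (proj z)) * c" if "r \<in> {0..\<theta>}" for r z
    using c(2)[OF _ uP] that t c(1) by (auto simp: g_def)
  have g_bd: "norm (g r z) \<le> (1 + R) * c" if "r \<in> {0..\<theta>}" for r z
  proof -
    have "(1 + norm (proj z)) * c \<le> (1 + R) * c"
      using proj_R c(1) by (intro mult_right_mono) auto
    with g_growth[OF that, of z] show ?thesis by linarith
  qed
  have g_lip: "norm (g r z - g r z') \<le> L * norm (z - z')" if r: "r \<in> {0..\<theta>}" for r z z'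
  proof (cases "r \<le> t")
    case False
    then have "norm (f r (proj z) (u r) - f r (proj z') (u r)) \<le> L * norm (proj z - proj z')"
      using lip r t uP[of r] proj_R by auto
    also have "\<dots> \<le> L * norm (z - z')"
      using L proj_lip by (intro mult_left_mono) auto
    finally show ?thesis using False by (simp add: g_def)
  qed (use L in \<open>simp add: g_def\<close>)
  define \<psi>0 where "\<psi>0 r = (if r \<le> t then \<psi>w r else 0)" for r
  have AEw: "AE r in lebesgue. r \<in> {0..t} \<longrightarrow> norm (\<psi>w r) \<le> Mw"
    using frac_densityD(3)[OF \<psi>w(1)] by (simp only: AE_lebesgue_on_iff)
  have \<psi>0m: "\<psi>0 \<in> borel_measurable ?\<mu>"
    unfolding \<psi>0_def by (intro piecewise_measurable_lebesgue_on frac_densityD(2)[OF \<psi>w(1)]) auto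
  have \<psi>0: "frac_density \<theta> Mw \<psi>0"
    unfolding frac_density_def AE_lebesgue_on_iff
  proof (intro conjI)
    show "AE r in lebesgue. r \<in> {0..\<theta>} \<longrightarrow> norm (\<psi>0 r) \<le> Mw"
      using AEw by eventually_elim (use frac_densityD(1)[OF \<psi>w(1)] in \<open>auto simp: \<psi>0_def\<close>)
  qed (use frac_densityD[OF \<psi>w(1)] \<psi>0m in auto)
  have "continuous_on {0..\<theta>} (\<lambda>s. w 0 + frac_int \<alpha> \<psi>0 s)"
    by (rule continuous_on_frac_density[OF alpha(1) alpha_le \<psi>0]) simp
  from volterra_solution[OF alpha(1) alpha_le order_trans[OF t(1,2)] this g_meas g_bd L g_lip]
  obtain x where x: "continuous_on {0..\<theta>} x"
    "\<And>s. s \<in> {0..\<theta>} \<Longrightarrow> x s = w 0 + frac_int \<alpha> \<psi>0 s + frac_int \<alpha> (\<lambda>r. g r (x r)) s"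
    by blast
  define \<psi> where "\<psi> r = \<psi>0 r + g r (x r)" for r
  have \<psi>m: "\<psi> \<in> borel_measurable ?\<mu>"
    unfolding \<psi>_def using \<psi>0m g_meas[OF x(1)] by (rule borel_measurable_add)
  \<comment> \<open>The first bound makes \<psi> a density, the second is the hypothesis of the a
    priori estimate.\<close>
  have \<psi>b: "AE r in lebesgue. r \<in> {0..\<theta>} \<longrightarrow> norm (\<psi> r) \<le> Mw + (1 + R) * c \<and> norm (\<psi> r) \<le> B + (1 + norm (x r)) * c"
    using AEw
  proof eventually_elim
    case (elim r)
    show ?case
    proof
      assume r: "r \<in> {0..\<theta>}"
      have "norm (\<psi>0 r) \<le> Mw"
        using elim r frac_densityD(1)[OF \<psi>w(1)] by (auto simp: \<psi>0_def)
      moreover have "norm (\<psi> r) \<le> norm (\<psi>0 r) + norm (g r (x r))"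
        unfolding \<psi>_def by (rule norm_triangle_ineq)
      moreover have "(1 + norm (proj (x r))) * c \<le> (1 + norm (x r)) * c"
        using proj_le c(1) by (intro mult_right_mono) auto
      ultimately show "norm (\<psi> r) \<le> Mw + (1 + R) * c \<and> norm (\<psi> r) \<le> B + (1 + norm (x r)) * c"
        using g_bd[OF r, of "x r"] g_growth[OF r, of "x r"] B by linarith
    qed
  qed
  have \<psi>: "frac_density \<theta> (Mw + (1 + R) * c) \<psi>"
    unfolding frac_density_def AE_lebesgue_on_iff
  proof (intro conjI \<psi>m)
    show "0 \<le> Mw + (1 + R) * c" using frac_densityD(1)[OF \<psi>w(1)] R c(1) by simp
    show "AE r in lebesgue. r \<in> {0..\<theta>} \<longrightarrow> norm (\<psi> r) \<le> Mw + (1 + R) * c"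
      using \<psi>b by eventually_elim blast
  qed
  have x\<psi>: "x s = w 0 + frac_int \<alpha> \<psi> s" if s: "s \<in> {0..\<theta>}" for s
  proof -
    have "frac_int \<alpha> \<psi> s - frac_int \<alpha> \<psi>0 s = frac_int \<alpha> (\<lambda>r. \<psi> r - \<psi>0 r) s"
      using s by (intro frac_int_diff[OF alpha(1) _ _ frac_densityD(2,3)[OF \<psi>] frac_densityD(2,3)[OF \<psi>0]]) auto
    also have "(\<lambda>r. \<psi> r - \<psi>0 r) = (\<lambda>r. g r (x r))" by (simp add: \<psi>_def)
    finally show ?thesis unfolding x(2)[OF s] by (simp add: algebra_simps)
  qed
  have "AE r in lebesgue_on {0..\<theta>}. norm (\<psi> r) \<le> B + (1 + norm (x r)) * c"
    unfolding AE_lebesgue_on_iff using \<psi>b by eventually_elim blast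
  then have xR: "norm (x s) \<le> R" if "s \<in> {0..\<theta>}" for s
    using R'[rule_format, OF \<psi> x\<psi> B(2) _ that] by blast
  have xw: "x s = w s" if s: "s \<in> {0..t}" for s
  proof -
    have "frac_int \<alpha> (\<lambda>r. g r (x r)) s = frac_int \<alpha> (\<lambda>r. 0) s"
      by (rule frac_int_cong) (use s in \<open>auto simp: g_def\<close>)
    also have "\<dots> = 0" by (simp add: frac_int_def)
    finally have "frac_int \<alpha> (\<lambda>r. g r (x r)) s = 0" .
    moreover have "frac_int \<alpha> \<psi>0 s = frac_int \<alpha> \<psi>w s"
      by (rule frac_int_cong) (use s in \<open>auto simp: \<psi>0_def\<close>)
    moreover have "s \<in> {0..\<theta>}" using s t by auto
    ultimately show ?thesis using x(2)[of s] \<psi>w(2)[OF s] by simp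
  qed
  define X where "X = restrict x {0..\<theta>}"
  have 0: "0 \<in> {0..t}" "0 \<in> {0..\<theta>}" using t by auto
  have X\<psi>: "X s = X 0 + frac_int \<alpha> \<psi> s" if s: "s \<in> {0..\<theta>}" for s
    using x\<psi>[OF s] xw[OF 0(1)] s t by (simp add: X_def)
  have XAC: "X \<in> AC \<alpha> \<theta>"
    unfolding AC_iff_frac_density
  proof (intro conjI exI ballI)
    show "X \<in> extensional {0..\<theta>}" by (simp add: X_def)
  qed (fact \<psi>, rule X\<psi>)
  have "AE s in lebesgue. s \<in> {0..\<theta>} \<longrightarrow> (\<forall>y. has_caputo_deriv \<alpha> \<theta> X y s \<longleftrightarrow> y = \<psi> s)"
    by (rule AE_has_caputo_deriv_iff[OF alpha \<psi> X\<psi>])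
  then have "AE s in lebesgue. s \<in> {t..\<theta>} \<longrightarrow> has_caputo_deriv \<alpha> \<theta> X (f s (X s) (u s)) s"
    using AE_lebesgue_neq[of t]
  proof eventually_elim
    case (elim s)
    show ?case
    proof
      assume s: "s \<in> {t..\<theta>}"
      then have s': "s \<in> {0..\<theta>}" "\<not> s \<le> t" using t elim by auto
      have "\<psi> s = f s (X s) (u s)"
        using s' proj_id[OF xR[OF s'(1)]] by (simp add: \<psi>_def \<psi>0_def g_def X_def)
      then show "has_caputo_deriv \<alpha> \<theta> X (f s (X s) (u s)) s"
        using elim s' by simp
    qed
  qed
  moreover have "\<forall>s\<in>{0..t}. X s = w s" using xw t by (auto simp: X_def)
  ultimately show ?thesis
    using XAC by (auto simp: is_motion_def AE_lebesgue_on_iff)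
qed

lemma controlsD:
  assumes "u \<in> controls P t \<theta>"
  shows "\<And>s. s \<in> {t..\<theta>} \<Longrightarrow> u s \<in> P" "u \<in> borel_measurable (lebesgue_on {t..\<theta>})"
  using assms by (auto simp: controls_def)

lemma motion_eqI:
  assumes t: "0 \<le> t" "t \<le> \<theta>" "\<theta> \<le> T" and u: "\<And>s. s \<in> {t<..<\<theta>} \<Longrightarrow> u s \<in> P" and x: "is_motion t w \<theta> u x"
  shows "motion \<alpha> f t w \<theta> u = x"
  unfolding motion_eq_The
  by (rule the_equality[where P="is_motion t w \<theta> u", OF x]) (rule is_motion_unique[OF t u _ x])

lemma is_motion_motion:
  assumes t: "0 \<le> t" "t \<le> \<theta>" "\<theta> \<le> T" and w: "w \<in> AC \<alpha> t" and u: "u \<in> controls P t \<theta>"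
  shows "is_motion t w \<theta> u (motion \<alpha> f t w \<theta> u)"
proof -
  obtain x where x: "is_motion t w \<theta> u x" using is_motion_exists[OF assms] by blast
  have "motion \<alpha> f t w \<theta> u = x"
    by (rule motion_eqI[OF t _ x]) (use controlsD(1)[OF u] in auto)
  with x show ?thesis by simp
qed

text \<open>A motion can be restarted from its own full history. Agreement of the controls is asked
  on [a, b) only: at a partition point the control law has already switched, while the piece ending
  there keeps its old value.\<close>

lemma is_motion_restrict:
  assumes x: "is_motion t w \<theta> u x" and ab: "0 \<le> t" "t \<le> a" "a \<le> b" "b \<le> \<theta>"
    and v: "\<And>s. s \<in> {a..<b} \<Longrightarrow> v s = u s"
  shows "is_motion a (restrict x {0..a}) b v (restrict x {0..b})"
  unfolding is_motion_def AE_lebesgue_on_iff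
proof (intro conjI)
  show "restrict x {0..b} \<in> AC \<alpha> b"
    by (rule AC_restrict[OF is_motionD(1)[OF x]]) (use ab in auto)
  show "\<forall>s\<in>{0..a}. restrict x {0..b} s = restrict x {0..a} s"
    using ab by auto
  show "AE s in lebesgue. s \<in> {a..b} \<longrightarrow> has_caputo_deriv \<alpha> b (restrict x {0..b}) (f s (restrict x {0..b} s) (v s)) s"
    using is_motionD(3)[OF x] AE_lebesgue_neq[of b]
  proof eventually_elim
    case (elim s)
    show ?case
    proof
      assume s: "s \<in> {a..b}"
      then have "has_caputo_deriv \<alpha> b x (f s (x s) (u s)) s"
        using elim ab by (auto intro!: has_caputo_deriv_subset[OF _ ab(4)])
      moreover have "v s = u s" "restrict x {0..b} s = x s" "s \<in> {0..b}"
        using v s elim ab by auto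
      ultimately show "has_caputo_deriv \<alpha> b (restrict x {0..b}) (f s (restrict x {0..b} s) (v s)) s"
        using has_caputo_deriv_cong[of b "restrict x {0..b}" x s \<alpha>] by simp
    qed
  qed
qed

end

section \<open>Closedness under uniform limits\<close>

lemma frac_density_norm_power2_integrable:
  assumes "frac_density t M g" "frac_density t M h"
  shows "integrable (lebesgue_on {0..t}) (\<lambda>s. (norm (a *\<^sub>R g s + b *\<^sub>R h s))\<^sup>2)"
proof -
  interpret finite_measure "lebesgue_on {0..t}"
    by (rule finite_measure_lebesgue_on) auto
  note [measurable] = frac_densityD(2)[OF assms(1)] frac_densityD(2)[OF assms(2)]
  show ?thesis
  proof (rule integrable_const_bound[of _ "(\<bar>a\<bar> * M + \<bar>b\<bar> * M)\<^sup>2"])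
    show "AE s in lebesgue_on {0..t}. norm ((norm (a *\<^sub>R g s + b *\<^sub>R h s))\<^sup>2) \<le> (\<bar>a\<bar> * M + \<bar>b\<bar> * M)\<^sup>2"
      using frac_densityD(3)[OF assms(1)] frac_densityD(3)[OF assms(2)]
    proof eventually_elim
      case (elim s)
      have "norm (a *\<^sub>R g s + b *\<^sub>R h s) \<le> norm (a *\<^sub>R g s) + norm (b *\<^sub>R h s)"
        by (rule norm_triangle_ineq)
      also have "\<dots> \<le> \<bar>a\<bar> * M + \<bar>b\<bar> * M"
        using elim by (auto intro!: add_mono mult_left_mono)
      finally show ?case by (simp add: power_mono)
    qed
  qed measurable
qed

text \<open>The densities nearly minimising the \<open>L\<^sup>2\<close> norm among those that approximate \<open>x\<close>
  well form a Cauchy sequence by the parallelogram law; this replaces weak compactness of the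
  ball of \<open>L\<^sup>\<infinity>\<close>.\<close>

lemma frac_density_closed:
  fixes x :: "real \<Rightarrow> real ^ 'n"
  assumes \<alpha>: "0 < \<alpha>" "\<alpha> < 1" and t: "0 \<le> t" and M: "0 \<le> M"
    and approx: "\<And>e. e > 0 \<Longrightarrow> \<exists>g. frac_density t M g \<and> (\<forall>\<tau>\<in>{0..t}. norm (x \<tau> - (y + frac_int \<alpha> g \<tau>)) \<le> e)"
  shows "\<exists>\<psi>. frac_density t M \<psi> \<and> (\<forall>\<tau>\<in>{0..t}. x \<tau> = y + frac_int \<alpha> \<psi> \<tau>)"
proof -
  let ?\<mu> = "lebesgue_on {0..t}"
  interpret finite_measure ?\<mu>
    by (rule finite_measure_lebesgue_on) auto
  define C where "C e = {g. frac_density t M g \<and> (\<forall>\<tau>\<in>{0..t}. norm (x \<tau> - (y + frac_int \<alpha> g \<tau>)) \<le> e)}" for e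
  define S where "S g = (LINT s|?\<mu>. (norm (g s))\<^sup>2)" for g :: "real \<Rightarrow> real ^ 'n"
  define r where "r n = 1 / real (Suc n)" for n
  \<comment> \<open>The sets C (r n) shrink, so d increases; it is bounded by M^2 times the length
    of the interval, hence Cauchy.\<close>
  define d where "d n = Inf (S ` C (r n))" for n
  have r_pos: "0 < r n" for n by (simp add: r_def)
  have C_ne: "C (r n) \<noteq> {}" for n using approx[OF r_pos] by (auto simp: C_def)
  have r_mono: "r m \<le> r n" if "n \<le> m" for n m
    using that by (simp add: r_def frac_le)
  have C_mono: "C (r m) \<subseteq> C (r n)" if "n \<le> m" for n m
    using r_mono[OF that] by (auto simp: C_def intro: order_trans)
  have S_nonneg: "0 \<le> S g" for g by (simp add: S_def)
  have bdd: "bdd_below (S ` A)" for A by (rule bdd_belowI2[of _ 0]) (rule S_nonneg)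
  have S_le: "S g \<le> M\<^sup>2 * measure ?\<mu> (space ?\<mu>)" if "g \<in> C e" for g e
  proof -
    have g: "frac_density t M g" using that by (simp add: C_def)
    have "S g \<le> (LINT s|?\<mu>. M\<^sup>2)" unfolding S_def
    proof (rule integral_mono_AE)
      show "integrable ?\<mu> (\<lambda>s. (norm (g s))\<^sup>2)"
        using frac_density_norm_power2_integrable[OF g g, of 1 0] by simp
      show "AE s in ?\<mu>. (norm (g s))\<^sup>2 \<le> M\<^sup>2"
        using frac_densityD(3)[OF g] by eventually_elim (simp add: power_mono)
    qed simp
    then show ?thesis by (simp add: mult.commute)
  qed
  have d_le: "d n \<le> S g" if "g \<in> C (r n)" for n g
    unfolding d_def by (rule cINF_lower[OF bdd that])
  have "incseq d"
    unfolding incseq_def d_def by (intro allI impI cINF_superset_mono C_ne bdd C_mono) auto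
  moreover have "d n \<le> M\<^sup>2 * measure ?\<mu> (space ?\<mu>)" for n
    using C_ne[of n] d_le S_le by (meson ex_in_conv order_trans)
  ultimately have "Cauchy d"
    by (metis incseq_convergent convergentI convergent_Cauchy)
  have "\<exists>g. g \<in> C (r n) \<and> S g < d n + r n" for n
  proof -
    have "Inf (S ` C (r n)) < d n + r n" using r_pos[of n] by (simp add: d_def)
    then show ?thesis
      using cInf_less_iff[OF _ bdd, of "C (r n)" "d n + r n"] C_ne by auto
  qed
  then obtain g where g: "\<And>n. g n \<in> C (r n)" "\<And>n. S (g n) < d n + r n" by metis
  have gd: "frac_density t M (g n)" for n using g(1)[of n] by (simp add: C_def)
  note gm [measurable] = frac_densityD(2)[OF gd]
  have gi: "integrable ?\<mu> (g n)" for n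
    by (rule bounded_integrable_lebesgue_on(1)[OF gm frac_densityD(3)[OF gd]])
  \<comment> \<open>By convexity the midpoint competes in the minimisation over C (r n), so its
    energy is at least d n.\<close>
  have mid: "(\<lambda>s. (1 / 2) *\<^sub>R g n s + (1 / 2) *\<^sub>R g m s) \<in> C (r n)" (is "?mid \<in> _") if "n \<le> m" for n m
    unfolding C_def
  proof (intro CollectI conjI ballI)
    have gC: "g n \<in> C (r n)" "g m \<in> C (r n)" using g(1) C_mono[OF that] by auto
    show "frac_density t M ?mid" unfolding frac_density_def
    proof (intro conjI M)
      show "AE s in ?\<mu>. norm (?mid s) \<le> M"
        using frac_densityD(3)[OF gd[of n]] frac_densityD(3)[OF gd[of m]]
      proof eventually_elim
        case (elim s)
        have "norm (?mid s) \<le> norm ((1 / 2) *\<^sub>R g n s) + norm ((1 / 2) *\<^sub>R g m s)"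
          by (rule norm_triangle_ineq)
        also have "\<dots> \<le> M" using elim by simp
        finally show ?case .
      qed
    qed measurable
    fix \<tau> assume \<tau>: "\<tau> \<in> {0..t}"
    have ki: "integrable ?\<mu> (\<lambda>s. kern \<alpha> \<tau> s *\<^sub>R g k s)" for k
      using \<alpha> \<tau> by (intro kern_integrable_scaleR[OF _ _ _ gm frac_densityD(3)[OF gd]]) auto
    have \<tau>': "0 \<le> \<tau>" "\<tau> \<le> t" using \<tau> by auto
    have "frac_int \<alpha> ?mid \<tau> = (LINT s|?\<mu>. (1 / 2) *\<^sub>R (kern \<alpha> \<tau> s *\<^sub>R g n s) + (1 / 2) *\<^sub>R (kern \<alpha> \<tau> s *\<^sub>R g m s))"
      unfolding frac_int_kern[OF \<tau>'] by (simp add: scaleR_add_right mult.commute)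
    also have "\<dots> = (1 / 2) *\<^sub>R frac_int \<alpha> (g n) \<tau> + (1 / 2) *\<^sub>R frac_int \<alpha> (g m) \<tau>"
    proof -
      have "integrable ?\<mu> (\<lambda>s. (1 / 2) *\<^sub>R (kern \<alpha> \<tau> s *\<^sub>R g k s))" for k
        by (rule integrable_scaleR_right) (rule ki)
      then show ?thesis
        unfolding frac_int_kern[OF \<tau>'] by (simp only: Bochner_Integration.integral_add integral_scaleR_right)
    qed
    finally have I: "frac_int \<alpha> ?mid \<tau> = (1 / 2) *\<^sub>R frac_int \<alpha> (g n) \<tau> + (1 / 2) *\<^sub>R frac_int \<alpha> (g m) \<tau>" .
    have half: "(1 / 2) *\<^sub>R z + (1 / 2) *\<^sub>R z = z" for z :: "real ^ 'n"
      by (simp flip: scaleR_add_left)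
    have "x \<tau> - (y + frac_int \<alpha> ?mid \<tau>)
        = (1 / 2) *\<^sub>R (x \<tau> - (y + frac_int \<alpha> (g n) \<tau>)) + (1 / 2) *\<^sub>R (x \<tau> - (y + frac_int \<alpha> (g m) \<tau>))"
      unfolding I using half[of "x \<tau>"] half[of y] by (simp add: algebra_simps)
    also have "norm \<dots> \<le> norm ((1 / 2) *\<^sub>R (x \<tau> - (y + frac_int \<alpha> (g n) \<tau>))) + norm ((1 / 2) *\<^sub>R (x \<tau> - (y + frac_int \<alpha> (g m) \<tau>)))"
      by (rule norm_triangle_ineq)
    also have "\<dots> = (1 / 2) * norm (x \<tau> - (y + frac_int \<alpha> (g n) \<tau>)) + (1 / 2) * norm (x \<tau> - (y + frac_int \<alpha> (g m) \<tau>))"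
      by (simp only: norm_scaleR)
    also have "\<dots> \<le> r n"
    proof -
      have "norm (x \<tau> - (y + frac_int \<alpha> (g n) \<tau>)) \<le> r n" "norm (x \<tau> - (y + frac_int \<alpha> (g m) \<tau>)) \<le> r n"
        using gC \<tau> unfolding C_def by blast+
      then show ?thesis by simp
    qed
    finally show "norm (x \<tau> - (y + frac_int \<alpha> ?mid \<tau>)) \<le> r n" .
  qed
  \<comment> \<open>Parallelogram law: the energies of g n and g m are below d n + r n and d m + r
    m, that of the midpoint is at least d n.\<close>
  have para: "S (\<lambda>s. g n s - g m s) \<le> 2 * (d m - d n) + 4 * r n" if nm: "n \<le> m" for n m
  proof -
    have "(norm (g n s - g m s))\<^sup>2 = 2 * (norm (g n s))\<^sup>2 + 2 * (norm (g m s))\<^sup>2 - 4 * (norm ((1 / 2) *\<^sub>R g n s + (1 / 2) *\<^sub>R g m s))\<^sup>2" for s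
      unfolding power2_norm_eq_inner by (simp add: inner_left_distrib inner_right_distrib inner_diff_left inner_diff_right inner_commute)
    then have "S (\<lambda>s. g n s - g m s) = (LINT s|?\<mu>. 2 * (norm (g n s))\<^sup>2 + 2 * (norm (g m s))\<^sup>2 - 4 * (norm ((1 / 2) *\<^sub>R g n s + (1 / 2) *\<^sub>R g m s))\<^sup>2)"
      by (simp add: S_def)
    also have "\<dots> = 2 * S (g n) + 2 * S (g m) - 4 * S (\<lambda>s. (1 / 2) *\<^sub>R g n s + (1 / 2) *\<^sub>R g m s)"
    proof -
      have i: "integrable ?\<mu> (\<lambda>s. (norm (g k s))\<^sup>2)" for k
        using frac_density_norm_power2_integrable[OF gd[of k] gd[of k], of 1 0] by simp
      have i': "integrable ?\<mu> (\<lambda>s. (norm ((1 / 2) *\<^sub>R g n s + (1 / 2) *\<^sub>R g m s))\<^sup>2)"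
        by (rule frac_density_norm_power2_integrable[OF gd gd])
      show ?thesis unfolding S_def using i i' by simp
    qed
    also have "\<dots> \<le> 2 * (d n + r n) + 2 * (d m + r m) - 4 * d n"
    proof -
      define Q where "Q = S (\<lambda>s. (1 / 2) *\<^sub>R g n s + (1 / 2) *\<^sub>R g m s)"
      have "d n \<le> Q" unfolding Q_def by (rule d_le[OF mid[OF nm]])
      then show ?thesis
        unfolding Q_def[symmetric] using less_imp_le[OF g(2)[of n]] less_imp_le[OF g(2)[of m]]
        by (intro diff_mono add_mono mult_left_mono) auto
    qed
    also have "\<dots> \<le> 2 * (d m - d n) + 4 * r n" using r_mono[OF nm] by simp
    finally show ?thesis .
  qed
  \<comment> \<open>\<open>cauchy_L1_AE_cauchy_subseq\<close> asks for L1 distances; integrating a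
    <= \<eta> + a^2 / \<eta>, valid for a >= 0, obtains them from L2 distances.\<close>
  have L1: "(LINT s|?\<mu>. norm (g n s - g m s)) \<le> \<eta> * t + (2 * (d m - d n) + 4 * r n) / \<eta>"
    if nm: "n \<le> m" and \<eta>: "0 < \<eta>" for n m \<eta>
  proof -
    have i: "integrable ?\<mu> (\<lambda>s. (norm (g n s - g m s))\<^sup>2)"
      using frac_density_norm_power2_integrable[OF gd[of n] gd[of m], of 1 "-1"] by simp
    have "(LINT s|?\<mu>. norm (g n s - g m s)) \<le> (LINT s|?\<mu>. \<eta> + (norm (g n s - g m s))\<^sup>2 / \<eta>)"
    proof (rule integral_mono)
      show "norm (g n s - g m s) \<le> \<eta> + (norm (g n s - g m s))\<^sup>2 / \<eta>" for s
      proof (cases "norm (g n s - g m s) \<le> \<eta>")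
        case False
        then have "norm (g n s - g m s) * \<eta> \<le> (norm (g n s - g m s))\<^sup>2"
          unfolding power2_eq_square by (intro mult_left_mono) auto
        then have "norm (g n s - g m s) \<le> (norm (g n s - g m s))\<^sup>2 / \<eta>"
          using \<eta> by (simp add: pos_le_divide_eq)
        then show ?thesis using \<eta> by linarith
      qed (use \<eta> in \<open>auto intro: add_increasing2\<close>)
    qed (use i gi in auto)
    also have "\<dots> = \<eta> * t + S (\<lambda>s. g n s - g m s) / \<eta>"
      using i t by (subst Bochner_Integration.integral_add) (auto simp: S_def measure_restrict_space mult.commute)
    also have "\<dots> \<le> \<eta> * t + (2 * (d m - d n) + 4 * r n) / \<eta>"
      using para[OF nm] \<eta> by (intro add_left_mono divide_right_mono) auto
    finally show ?thesis .
  qed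
  have L1_Cauchy: "\<exists>N. \<forall>i\<ge>N. \<forall>j\<ge>N. (LINT s|?\<mu>. norm (g i s - g j s)) < e" if e: "e > 0" for e
  proof -
    \<comment> \<open>This \<eta> makes the first term of \<open>L1\<close> smaller than 3e/4; the
      tolerances e * \<eta> / 32 below make the second one smaller than e/4.\<close>
    define \<eta> where "\<eta> = e / (2 * (t + 1))"
    have \<eta>: "0 < \<eta>" "\<eta> * t < e / 2 + e / 4"
      using e t by (auto simp: \<eta>_def field_simps add_pos_nonneg)
    have "0 < e * \<eta> / 32" using e \<eta> by simp
    obtain N1 where N1: "\<And>m n. m \<ge> N1 \<Longrightarrow> n \<ge> N1 \<Longrightarrow> dist (d m) (d n) < e * \<eta> / 32"
      using \<open>Cauchy d\<close> \<open>0 < e * \<eta> / 32\<close> unfolding Cauchy_def by meson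
    have "r \<longlonglongrightarrow> 0" unfolding r_def using LIMSEQ_inverse_real_of_nat by (simp add: inverse_eq_divide)
    then obtain N2 where N2: "\<And>n. n \<ge> N2 \<Longrightarrow> \<bar>r n\<bar> < e * \<eta> / 32"
      using \<open>0 < e * \<eta> / 32\<close> unfolding LIMSEQ_def by (metis dist_real_def diff_zero)
    have main: "(LINT s|?\<mu>. norm (g i s - g j s)) < e" if "N1 \<le> i" "N2 \<le> i" "i \<le> j" for i j
    proof -
      have "2 * (d j - d i) + 4 * r i < e * \<eta> / 4"
      proof -
        have "d j - d i < e * \<eta> / 32" "r i < e * \<eta> / 32"
          using order_le_less_trans[OF abs_ge_self N1[of j i, unfolded dist_real_def]]
            order_le_less_trans[OF abs_ge_self N2[of i]] that by auto
        then have "2 * (d j - d i) + 4 * r i < 2 * (e * \<eta> / 32) + 4 * (e * \<eta> / 32)"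
          by (intro add_strict_mono mult_strict_left_mono) auto
        also have "2 * (e * \<eta> / 32) + 4 * (e * \<eta> / 32) = 6 * (e * \<eta> / 32)" by simp
        also have "\<dots> \<le> 8 * (e * \<eta> / 32)"
          using \<open>0 < e * \<eta> / 32\<close> by (intro mult_right_mono) auto
        also have "\<dots> = e * \<eta> / 4" by simp
        finally show ?thesis .
      qed
      then have "(2 * (d j - d i) + 4 * r i) / \<eta> < e / 4"
        using \<eta> by (simp add: pos_divide_less_eq)
      then show ?thesis using L1[OF that(3) \<eta>(1)] \<eta>(2) by linarith
    qed
    have "(LINT s|?\<mu>. norm (g i s - g j s)) < e" if "i \<ge> max N1 N2" "j \<ge> max N1 N2" for i j
      using main[of i j] main[of j i] that by (cases "i \<le> j") (auto simp: norm_minus_commute)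
    then show ?thesis by blast
  qed
  obtain \<rho> where \<rho>: "strict_mono \<rho>" "AE s in ?\<mu>. Cauchy (\<lambda>i. g (\<rho> i) s)"
    using cauchy_L1_AE_cauchy_subseq[OF gi L1_Cauchy] by blast
  define \<psi> where "\<psi> s = lim (\<lambda>i. g (\<rho> i) s)" for s
  have \<psi>m [measurable]: "\<psi> \<in> borel_measurable ?\<mu>"
    unfolding \<psi>_def by measurable
  have conv: "AE s in ?\<mu>. (\<lambda>i. g (\<rho> i) s) \<longlonglongrightarrow> \<psi> s"
    using \<rho>(2) by eventually_elim (simp add: \<psi>_def Cauchy_convergent_iff convergent_LIMSEQ_iff)
  have AEM: "AE s in ?\<mu>. \<forall>i. norm (g i s) \<le> M"
    using frac_densityD(3)[OF gd] by (simp add: AE_all_countable)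
  have \<psi>d: "frac_density t M \<psi>" unfolding frac_density_def
  proof (intro conjI M \<psi>m)
    show "AE s in ?\<mu>. norm (\<psi> s) \<le> M"
      using conv AEM
    proof eventually_elim
      case (elim s)
      show ?case by (rule LIMSEQ_le_const2[OF tendsto_norm[OF elim(1)]]) (use elim(2) in auto)
    qed
  qed
  \<comment> \<open>The limit passes under the kernel by domination, while membership in the
    shrinking sets C forces the approximation error to 0.\<close>
  have "x \<tau> = y + frac_int \<alpha> \<psi> \<tau>" if \<tau>: "\<tau> \<in> {0..t}" for \<tau>
  proof -
    have \<tau>': "0 \<le> \<tau>" "\<tau> \<le> t" using \<tau> by auto
    have "(\<lambda>i. frac_int \<alpha> (g (\<rho> i)) \<tau>) \<longlonglongrightarrow> frac_int \<alpha> \<psi> \<tau>"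
      unfolding frac_int_kern[OF \<tau>']
    proof (rule integral_dominated_convergence[where w="\<lambda>s. kern \<alpha> \<tau> s * M"])
      show "integrable ?\<mu> (\<lambda>s. kern \<alpha> \<tau> s * M)"
        using \<alpha> \<tau> by (intro integrable_mult_left kern_integrable) auto
      show "AE s in ?\<mu>. (\<lambda>i. kern \<alpha> \<tau> s *\<^sub>R g (\<rho> i) s) \<longlonglongrightarrow> kern \<alpha> \<tau> s *\<^sub>R \<psi> s"
        using conv by eventually_elim (intro tendsto_intros)
      show "AE s in ?\<mu>. norm (kern \<alpha> \<tau> s *\<^sub>R g (\<rho> i) s) \<le> kern \<alpha> \<tau> s * M" for i
        using AEM by eventually_elim (use kern_nonneg[OF \<alpha>(1)] in \<open>auto intro!: mult_left_mono\<close>)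
    qed measurable
    then have "(\<lambda>i. x \<tau> - (y + frac_int \<alpha> (g (\<rho> i)) \<tau>)) \<longlonglongrightarrow> x \<tau> - (y + frac_int \<alpha> \<psi> \<tau>)"
      by (intro tendsto_intros)
    moreover have "(\<lambda>i. x \<tau> - (y + frac_int \<alpha> (g (\<rho> i)) \<tau>)) \<longlonglongrightarrow> 0"
    proof (rule Lim_null_comparison)
      show "\<forall>\<^sub>F i in sequentially. norm (x \<tau> - (y + frac_int \<alpha> (g (\<rho> i)) \<tau>)) \<le> r (\<rho> i)"
        using g(1) \<tau> unfolding C_def by (intro always_eventually) blast
      have "r \<longlonglongrightarrow> 0" unfolding r_def using LIMSEQ_inverse_real_of_nat by (simp add: inverse_eq_divide)
      then show "(\<lambda>i. r (\<rho> i)) \<longlonglongrightarrow> 0"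
        using LIMSEQ_subseq_LIMSEQ[OF _ \<rho>(1)] by (auto simp: o_def)
    qed
    ultimately have "x \<tau> - (y + frac_int \<alpha> \<psi> \<tau>) = 0" by (rule LIMSEQ_unique)
    then show ?thesis by simp
  qed
  with \<psi>d show ?thesis by blast
qed

section \<open>Change of a smooth functional along a trajectory\<close>

text \<open>The time min \<tau> t' is admissible in the inner minimum and lies within |t - t'| of
  \<tau>.\<close>

lemma pos_dist_star_le:
  assumes t: "0 \<le> t" "0 \<le> t'"
    and e: "\<And>\<tau>. \<tau> \<in> {0..t} \<Longrightarrow> norm (x \<tau> - y (min \<tau> t')) \<le> e"
  shows "pos_dist_star (t, x) (t', y) \<le> \<bar>t - t'\<bar> + e"
  unfolding pos_dist_star_def prod.case
proof (rule cSUP_least)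
  show "{0..t} \<noteq> {}" using t by simp
  fix \<tau> assume \<tau>: "\<tau> \<in> {0..t}"
  have "(INF \<tau>'\<in>{0..t'}. sqrt (\<bar>\<tau> - \<tau>'\<bar>\<^sup>2 + (norm (x \<tau> - y \<tau>'))\<^sup>2))
      \<le> sqrt (\<bar>\<tau> - min \<tau> t'\<bar>\<^sup>2 + (norm (x \<tau> - y (min \<tau> t')))\<^sup>2)"
    by (rule cINF_lower) (use \<tau> t in \<open>auto intro!: bdd_belowI2[of _ 0]\<close>)
  also have "\<dots> \<le> \<bar>\<bar>\<tau> - min \<tau> t'\<bar>\<bar> + \<bar>norm (x \<tau> - y (min \<tau> t'))\<bar>"
    by (rule sqrt_sum_squares_le_sum_abs)
  also have "\<dots> \<le> \<bar>t - t'\<bar> + e"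
    using e[OF \<tau>] \<tau> by (intro add_mono) (auto simp: min_def)
  finally show "(INF \<tau>'\<in>{0..t'}. sqrt (\<bar>\<tau> - \<tau>'\<bar>\<^sup>2 + (norm (x \<tau> - y \<tau>'))\<^sup>2)) \<le> \<bar>t - t'\<bar> + e" .
qed

text \<open>The modulus of continuity is asked of x alone, so x can be a fixed limit and y any term
  of a sequence that converges to it uniformly.\<close>

lemma pos_dist_restrict_le:
  assumes t: "t \<in> {0..T}" "t' \<in> {0..T}"
    and xy: "\<And>\<tau>. \<tau> \<in> {0..T} \<Longrightarrow> norm (y \<tau> - x \<tau>) \<le> e"
    and x: "\<And>\<tau> \<tau>'. \<tau> \<in> {0..T} \<Longrightarrow> \<tau>' \<in> {0..T} \<Longrightarrow> \<bar>\<tau> - \<tau>'\<bar> \<le> \<bar>t - t'\<bar> \<Longrightarrow> norm (x \<tau> - x \<tau>') \<le> e"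
  shows "pos_dist (t, restrict x {0..t}) (t', restrict y {0..t'}) \<le> \<bar>t - t'\<bar> + 2 * e"
  unfolding pos_dist_def
proof (rule max.boundedI)
  show "pos_dist_star (t, restrict x {0..t}) (t', restrict y {0..t'}) \<le> \<bar>t - t'\<bar> + 2 * e"
  proof (rule pos_dist_star_le)
    fix \<tau> assume \<tau>: "\<tau> \<in> {0..t}"
    define s where "s = min \<tau> t'"
    have s: "s \<in> {0..T}" "\<tau> \<in> {0..T}" "\<bar>\<tau> - s\<bar> \<le> \<bar>t - t'\<bar>" "s \<in> {0..t'}" using \<tau> t by (auto simp: s_def)
    have "norm (x \<tau> - y s) \<le> norm (x \<tau> - x s) + norm (y s - x s)"
      using norm_triangle_ineq4[of "x \<tau> - x s" "y s - x s"] by simp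
    also have "\<dots> \<le> 2 * e"
      using x[OF s(2,1,3)] xy[OF s(1)] by simp
    finally show "norm (restrict x {0..t} \<tau> - restrict y {0..t'} (min \<tau> t')) \<le> 2 * e"
      using \<tau> s unfolding s_def[symmetric] by simp
  qed (use t in auto)
  have "pos_dist_star (t', restrict y {0..t'}) (t, restrict x {0..t}) \<le> \<bar>t' - t\<bar> + 2 * e"
  proof (rule pos_dist_star_le)
    fix \<tau> assume \<tau>: "\<tau> \<in> {0..t'}"
    define s where "s = min \<tau> t"
    have s: "s \<in> {0..T}" "\<tau> \<in> {0..T}" "\<bar>\<tau> - s\<bar> \<le> \<bar>t - t'\<bar>" "s \<in> {0..t}" using \<tau> t by (auto simp: s_def)
    have "norm (y \<tau> - x s) \<le> norm (y \<tau> - x \<tau>) + norm (x \<tau> - x s)"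
      using norm_triangle_ineq[of "y \<tau> - x \<tau>" "x \<tau> - x s"] by simp
    also have "\<dots> \<le> 2 * e"
      using x[OF s(2,1,3)] xy[OF s(2)] by simp
    finally show "norm (restrict y {0..t'} \<tau> - restrict x {0..t} (min \<tau> t)) \<le> 2 * e"
      using \<tau> s unfolding s_def[symmetric] by simp
  qed (use t in auto)
  then show "pos_dist_star (t', restrict y {0..t'}) (t, restrict x {0..t}) \<le> \<bar>t - t'\<bar> + 2 * e"
    by (simp add: abs_minus_commute)
qed

text \<open>The gateway through which continuity in \<open>pos_dist\<close> is used: constant y
  gives continuity along a trajectory, varying y gives stability under uniform limits.\<close>

lemma pos_continuous_on_sequence:
  assumes \<phi>: "pos_continuous_on S \<phi>"
    and x: "continuous_on {0..T} x"
    and lim: "\<And>e. e > 0 \<Longrightarrow> \<forall>\<^sub>F n in sequentially. \<forall>\<tau>\<in>{0..T}. norm (y n \<tau> - x \<tau>) \<le> e"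
    and s: "\<And>n. s n \<in> {0..T}" "s \<longlonglongrightarrow> t"
    and S: "(t, restrict x {0..t}) \<in> S" "\<And>n. (s n, restrict (y n) {0..s n}) \<in> S"
  shows "(\<lambda>n. \<phi> (s n, restrict (y n) {0..s n})) \<longlonglongrightarrow> \<phi> (t, restrict x {0..t})"
proof (rule tendstoI)
  fix \<epsilon> :: real assume "\<epsilon> > 0"
  then obtain \<delta> where \<delta>: "\<delta> > 0" "\<And>q. q \<in> S \<Longrightarrow> pos_dist (t, restrict x {0..t}) q < \<delta> \<Longrightarrow> dist (\<phi> (t, restrict x {0..t})) (\<phi> q) < \<epsilon>"
    using \<phi> S(1) unfolding pos_continuous_on_def by meson
  have t: "t \<in> {0..T}"
    by (rule Lim_in_closed_set[OF closed_atLeastAtMost _ _ s(2)]) (use s(1) in auto)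
  have "uniformly_continuous_on {0..T} x"
    using x by (intro compact_uniformly_continuous) auto
  then obtain d where d: "d > 0" "\<And>\<tau> \<tau>'. \<tau> \<in> {0..T} \<Longrightarrow> \<tau>' \<in> {0..T} \<Longrightarrow> dist \<tau>' \<tau> < d \<Longrightarrow> dist (x \<tau>') (x \<tau>) < \<delta> / 4"
    unfolding uniformly_continuous_on_def using \<delta>(1) by (metis zero_less_divide_iff zero_less_numeral)
  have "\<forall>\<^sub>F n in sequentially. dist (s n) t < min d (\<delta> / 4)"
    using s(2) d(1) \<delta>(1) by (intro tendstoD) auto
  moreover have "\<forall>\<^sub>F n in sequentially. \<forall>\<tau>\<in>{0..T}. norm (y n \<tau> - x \<tau>) \<le> \<delta> / 4"
    using \<delta>(1) by (intro lim) simp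
  ultimately show "\<forall>\<^sub>F n in sequentially. dist (\<phi> (s n, restrict (y n) {0..s n})) (\<phi> (t, restrict x {0..t})) < \<epsilon>"
  proof eventually_elim
    case (elim n)
    have "pos_dist (t, restrict x {0..t}) (s n, restrict (y n) {0..s n}) \<le> \<bar>t - s n\<bar> + 2 * (\<delta> / 4)"
    proof (rule pos_dist_restrict_le[OF t s(1)])
      show "norm (y n \<tau> - x \<tau>) \<le> \<delta> / 4" if "\<tau> \<in> {0..T}" for \<tau> using elim that by blast
      show "norm (x \<tau> - x \<tau>') \<le> \<delta> / 4" if "\<tau> \<in> {0..T}" "\<tau>' \<in> {0..T}" "\<bar>\<tau> - \<tau>'\<bar> \<le> \<bar>t - s n\<bar>" for \<tau> \<tau>'
        using d(2)[OF that(2,1)] that(3) elim(1) by (simp add: dist_norm abs_minus_commute)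
    qed
    also have "\<dots> < \<delta> / 4 + 2 * (\<delta> / 4)"
      using elim(1) by (simp add: dist_real_def abs_minus_commute)
    also have "\<dots> \<le> \<delta>" using \<delta>(1) by simp
    finally have "pos_dist (t, restrict x {0..t}) (s n, restrict (y n) {0..s n}) < \<delta>" .
    from \<delta>(2)[OF S(2) this] show ?case by (simp add: dist_commute)
  qed
qed

text \<open>Coinvariant differentiability speaks of right-hand limits only, so the mean value
  theorem is out of reach. For each slope e > 0 the inequality |h - h a| <= e (\<sigma> - a) holds
  on a largest interval from a, which is closed by continuity and could be prolonged if it ended
  before b.\<close>

lemma right_derivative_zero_imp_const:
  fixes h :: "real \<Rightarrow> real"
  assumes h: "continuous_on {a..b} h" and ab: "a \<le> b"
    and der: "\<And>\<tau>. \<tau> \<in> {a..<b} \<Longrightarrow> (\<lambda>s. h s - h \<tau>) \<in> o[at_right \<tau>](\<lambda>s. s - \<tau>)"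
  shows "h b = h a"
proof -
  have le: "\<bar>h b - h a\<bar> \<le> e * (b - a)" if e: "e > 0" for e
  proof -
    define A where "A = {\<sigma> \<in> {a..b}. \<bar>h \<sigma> - h a\<bar> \<le> e * (\<sigma> - a)}"
    have A_closed: "closed A" unfolding A_def
      by (intro continuous_on_closed_Collect_le continuous_intros h closed_atLeastAtMost)
    define S where "S = {\<tau> \<in> {a..b}. {a..\<tau>} \<subseteq> A}"
    have aS: "a \<in> S" using ab by (auto simp: S_def A_def)
    have bdd: "bdd_above S" by (auto simp: S_def intro!: bdd_aboveI[of _ b])
    define c where "c = Sup S"
    have c: "a \<le> c" "c \<le> b"
      unfolding c_def by (rule cSup_upper[OF aS bdd], rule cSup_least) (use aS in \<open>auto simp: S_def\<close>)
    have "{a..<c} \<subseteq> A"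
    proof
      fix \<sigma> assume \<sigma>: "\<sigma> \<in> {a..<c}"
      then obtain \<tau> where "\<tau> \<in> S" "\<sigma> < \<tau>" unfolding c_def using less_cSup_iff[OF _ bdd] aS by auto
      then show "\<sigma> \<in> A" using \<sigma> by (auto simp: S_def)
    qed
    then have "closure {a..<c} \<subseteq> A" using A_closed by (rule closure_minimal)
    then have "{a..c} \<subseteq> A"
      using aS c closure_atLeastLessThan[of a c] by (cases "a < c") (auto simp: S_def)
    then have cS: "c \<in> S" using c by (auto simp: S_def)
    have "c = b"
    proof (rule ccontr)
      assume "c \<noteq> b"
      then have cb: "c < b" using c by simp
      \<comment> \<open>The right derivative at c, tested with the same slope e, carries the
        inequality past c.\<close>
      have "eventually (\<lambda>s. norm (h s - h c) \<le> e * norm (s - c)) (at_right c)"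
        by (rule landau_o.smallD[OF der e]) (use c cb in auto)
      then obtain d where d: "d > c" "\<And>s. c < s \<Longrightarrow> s < d \<Longrightarrow> \<bar>h s - h c\<bar> \<le> e * \<bar>s - c\<bar>"
        unfolding eventually_at_right_field by auto
      define s where "s = (c + min d b) / 2"
      have s: "c < s" "s < d" "s < b" using d cb by (auto simp: s_def min_def field_simps)
      have "{a..s} \<subseteq> A"
      proof
        fix \<sigma> assume \<sigma>: "\<sigma> \<in> {a..s}"
        show "\<sigma> \<in> A"
        proof (cases "\<sigma> \<le> c")
          case True
          then show ?thesis using cS \<sigma> by (auto simp: S_def)
        next
          case False
          have "\<bar>h \<sigma> - h c\<bar> \<le> e * (\<sigma> - c)" using d(2)[of \<sigma>] False \<sigma> s by auto
          moreover have "\<bar>h c - h a\<bar> \<le> e * (c - a)" using cS c by (auto simp: S_def A_def)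
          ultimately have "\<bar>h \<sigma> - h a\<bar> \<le> e * (\<sigma> - c) + e * (c - a)" by linarith
          also have "\<dots> = e * (\<sigma> - a)" by (simp add: algebra_simps)
          finally show ?thesis using \<sigma> s by (auto simp: A_def)
        qed
      qed
      then have "s \<in> S" using s c by (auto simp: S_def)
      then have "s \<le> c" unfolding c_def by (rule cSup_upper[OF _ bdd])
      with s show False by simp
    qed
    then show ?thesis using cS by (auto simp: S_def A_def)
  qed
  show ?thesis
  proof (rule ccontr)
    assume "h b \<noteq> h a"
    then have pos: "0 < \<bar>h b - h a\<bar>" by simp
    define k where "k = b - a + 1"
    have k: "0 < k" using ab by (simp add: k_def)
    \<comment> \<open>This slope would give |h b - h a| <= |h b - h a| / 2.\<close>
    define e where "e = \<bar>h b - h a\<bar> / (2 * k)"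
    have "0 < e" using pos k by (simp add: e_def)
    then have "\<bar>h b - h a\<bar> \<le> e * (b - a)" by (rule le)
    also have "\<dots> \<le> e * k" using \<open>0 < e\<close> by (intro mult_left_mono) (auto simp: k_def)
    also have "\<dots> = \<bar>h b - h a\<bar> / 2" using k by (simp add: e_def)
    finally show False using pos by simp
  qed
qed

text \<open>Values of norm above M are reset to 0, which inside [0, t] changes a null set. The bound
  then holds at every point, as pointwise estimates of gauge integrals require.\<close>

lemma AC_bounded_densityE:
  assumes "frac_density t M \<psi>"
  obtains \<psi>' where "frac_density t M \<psi>'" "\<And>\<xi>. norm (\<psi>' \<xi>) \<le> M"
    "\<And>\<tau>. \<tau> \<in> {0..t} \<Longrightarrow> frac_int \<alpha> \<psi>' \<tau> = frac_int \<alpha> \<psi> \<tau>"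
proof -
  note d = frac_densityD[OF assms]
  note [measurable] = d(2)
  define \<psi>' where "\<psi>' \<xi> = (if norm (\<psi> \<xi>) \<le> M then \<psi> \<xi> else 0)" for \<xi>
  have m: "\<psi>' \<in> borel_measurable (lebesgue_on {0..t})" unfolding \<psi>'_def by measurable
  have b: "norm (\<psi>' \<xi>) \<le> M" for \<xi> using d(1) by (simp add: \<psi>'_def)
  show ?thesis
  proof (rule that[OF _ b])
    show "frac_density t M \<psi>'" using m b d(1) by (simp add: frac_density_def)
    show "frac_int \<alpha> \<psi>' \<tau> = frac_int \<alpha> \<psi> \<tau>" if "\<tau> \<in> {0..t}" for \<tau>
    proof (rule frac_int_cong_AE[OF _ _ m d(2)])
      show "AE \<xi> in lebesgue_on {0..t}. \<xi> \<le> \<tau> \<longrightarrow> \<psi>' \<xi> = \<psi> \<xi>"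
        using d(3) by eventually_elim (simp add: \<psi>'_def)
    qed (use that in auto)
  qed
qed

section \<open>Functionals along the history of a trajectory\<close>

abbreviation hist :: "(real \<Rightarrow> real ^ 'n) \<Rightarrow> real \<Rightarrow> 'n::finite position" where
  "hist x \<tau> \<equiv> (\<tau>, restrict x {0..\<tau>})"

lemma hist_in_G:
  assumes "x \<in> AC \<alpha> T" "\<tau> \<in> {0..T}"
  shows "hist x \<tau> \<in> G \<alpha> T"
  using assms AC_restrict[of x \<alpha> T \<tau>] by (auto simp: G_def)

lemma hist_in_G0:
  assumes "x \<in> AC \<alpha> T" "\<tau> \<in> {0..<T}"
  shows "hist x \<tau> \<in> G0 \<alpha> T"
  using assms hist_in_G[of x \<alpha> T \<tau>] by (auto simp: G0_def)

lemma pos_continuous_on_hist: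
  assumes \<alpha>: "0 < \<alpha>" "\<alpha> \<le> 1" and \<phi>: "pos_continuous_on S \<phi>" and x: "x \<in> AC \<alpha> T"
    and I: "I \<subseteq> {0..T}" "\<And>\<tau>. \<tau> \<in> I \<Longrightarrow> hist x \<tau> \<in> S"
  shows "continuous_on I (\<lambda>\<tau>. \<phi> (hist x \<tau>))"
  unfolding continuous_on_sequentially
proof (intro allI ballI impI)
  fix s a assume a: "a \<in> I" and s: "(\<forall>n. s n \<in> I) \<and> s \<longlonglongrightarrow> a"
  show "((\<lambda>\<tau>. \<phi> (hist x \<tau>)) \<circ> s) \<longlonglongrightarrow> \<phi> (hist x a)"
    unfolding o_def
    by (rule pos_continuous_on_sequence[OF \<phi> AC_continuous_on[OF \<alpha> x], where y="\<lambda>_. x"])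
      (use s a I in auto)
qed

lemma ci_differentiable_has_ci_derivs:
  assumes "ci_differentiable \<alpha> T \<phi> z"
  shows "has_ci_derivs \<alpha> T \<phi> z (ci_dt \<alpha> T \<phi> z) (ci_grad \<alpha> T \<phi> z)"
proof -
  have "\<exists>r. (case r of (p, s) \<Rightarrow> has_ci_derivs \<alpha> T \<phi> z p s)"
    using assms by (auto simp: ci_differentiable_def)
  from someI_ex[OF this] show ?thesis
    unfolding ci_dt_def ci_grad_def ci_derivs_def case_prod_beta' .
qed

text \<open>Subtracting the candidate integral leaves a continuous function whose right derivative is
  zero at every point; thus neither absolute continuity of \<open>\<phi>\<close> along \<open>x\<close> nor an almost everywhere
  chain rule is needed.\<close>

lemma ci_smooth_integral_formula:
  fixes \<phi> :: "'n::finite position \<Rightarrow> real"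
  assumes \<alpha>: "0 < \<alpha>" "\<alpha> < 1" and \<phi>: "ci_smooth \<alpha> T \<phi>" and x: "x \<in> AC \<alpha> T"
    and d: "frac_density T M \<psi>" and bd: "\<And>\<xi>. norm (\<psi> \<xi>) \<le> M"
    and eq: "\<And>\<tau>. \<tau> \<in> {0..T} \<Longrightarrow> x \<tau> = x 0 + frac_int \<alpha> \<psi> \<tau>"
    and ts: "0 \<le> t" "t \<le> s" "s < T"
  defines "k \<equiv> (\<lambda>\<xi>. ci_dt \<alpha> T \<phi> (hist x \<xi>) + ci_grad \<alpha> T \<phi> (hist x \<xi>) \<bullet> \<psi> \<xi>)"
  shows "k integrable_on {t..s}" "\<phi> (hist x s) - \<phi> (hist x t) = integral {t..s} k"
proof -
  define p q \<Phi> where "p \<xi> = ci_dt \<alpha> T \<phi> (hist x \<xi>)" and "q \<xi> = ci_grad \<alpha> T \<phi> (hist x \<xi>)"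
    and "\<Phi> \<xi> = \<phi> (hist x \<xi>)" for \<xi>
  have \<alpha>': "\<alpha> \<le> 1" using \<alpha> by simp
  have M: "0 \<le> M" by (rule frac_densityD(1)[OF d])
  have sub: "{t..s} \<subseteq> {0..T}" "\<And>\<tau>. \<tau> \<in> {t..s} \<Longrightarrow> hist x \<tau> \<in> G0 \<alpha> T" "\<And>\<tau>. \<tau> \<in> {t..s} \<Longrightarrow> hist x \<tau> \<in> G \<alpha> T"
    using ts hist_in_G0[OF x] hist_in_G[OF x] by auto
  have cont: "continuous_on {t..s} p" "continuous_on {t..s} q" "continuous_on {t..s} \<Phi>"
    unfolding p_def q_def \<Phi>_def using \<phi> sub
    by (auto simp: ci_smooth_def intro!: pos_continuous_on_hist[OF \<alpha>(1) \<alpha>' _ x])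
  have \<psi>m: "\<psi> \<in> borel_measurable (lebesgue_on {t..s})"
    by (rule measurable_restrict_mono[OF frac_densityD(2)[OF d]]) (use ts in auto)
  have pm: "p \<in> borel_measurable (lebesgue_on {t..s})" "q \<in> borel_measurable (lebesgue_on {t..s})"
    using cont by (auto intro!: continuous_imp_measurable_on_sets_lebesgue)
  obtain Dp Dq where D: "0 \<le> Dp" "\<And>\<xi>. \<xi> \<in> {t..s} \<Longrightarrow> norm (p \<xi>) \<le> Dp" "0 \<le> Dq" "\<And>\<xi>. \<xi> \<in> {t..s} \<Longrightarrow> norm (q \<xi>) \<le> Dq"
    using continuous_on_Icc_norm_bound[OF cont(1)] continuous_on_Icc_norm_bound[OF cont(2)] by metis
  have k: "k = (\<lambda>\<xi>. p \<xi> + q \<xi> \<bullet> \<psi> \<xi>)" by (simp add: k_def p_def q_def)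
  show ki: "k integrable_on {t..s}"
  proof (rule bounded_integrable_lebesgue_on(2)[OF _ AE_I2])
    show "k \<in> borel_measurable (lebesgue_on {t..s})"
      unfolding k using pm \<psi>m by measurable
    fix \<xi> assume "\<xi> \<in> space (lebesgue_on {t..s})"
    then have \<xi>: "\<xi> \<in> {t..s}" by simp
    have "\<bar>q \<xi> \<bullet> \<psi> \<xi>\<bar> \<le> norm (q \<xi>) * norm (\<psi> \<xi>)" by (rule Cauchy_Schwarz_ineq2)
    also have "\<dots> \<le> Dq * M" using D(4)[OF \<xi>] bd D(3) by (intro mult_mono) auto
    finally show "norm (k \<xi>) \<le> Dp + Dq * M"
      using D(2)[OF \<xi>] abs_triangle_ineq[of "p \<xi>" "q \<xi> \<bullet> \<psi> \<xi>"] by (simp add: k)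
  qed
  define h where "h \<tau> = \<Phi> \<tau> - integral {t..\<tau>} k" for \<tau>
  have "h s = h t"
  proof (rule right_derivative_zero_imp_const[of t s h])
    show "continuous_on {t..s} h"
      unfolding h_def by (intro continuous_intros cont indefinite_integral_continuous_1 ki)
    show "t \<le> s" by fact
    fix \<tau> assume \<tau>: "\<tau> \<in> {t..<s}"
    then have \<tau>T: "\<tau> \<in> {0..<T}" "\<tau> \<in> {t..s}" using ts by auto
    have int\<psi>: "\<psi> integrable_on {a..b}" if "0 \<le> a" "b \<le> T" for a b
      by (rule integrable_on_subinterval[OF frac_density_integrable_on[OF d]]) (use that in auto)
    have "ci_differentiable \<alpha> T \<phi> (hist x \<tau>)"
      using \<phi> hist_in_G0[OF x \<tau>T(1)] by (auto simp: ci_smooth_def)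
    then have "has_ci_derivs \<alpha> T \<phi> (hist x \<tau>) (p \<tau>) (q \<tau>)"
      unfolding p_def q_def by (rule ci_differentiable_has_ci_derivs)
    moreover have "x \<in> extensions \<alpha> T (hist x \<tau>)"
      using x by (auto simp: extensions_def)
    ultimately have 1: "(\<lambda>\<sigma>. \<phi> (hist x \<sigma>) - \<phi> (hist x \<tau>) - p \<tau> * (\<sigma> - \<tau>) -
        q \<tau> \<bullet> (frac_int (1 - \<alpha>) (\<lambda>\<xi>. x \<xi> - x 0) \<sigma> -
          frac_int (1 - \<alpha>) (\<lambda>\<xi>. restrict x {0..\<tau>} \<xi> - restrict x {0..\<tau>} 0) \<tau>)) \<in> o[at_right \<tau>](\<lambda>\<sigma>. \<sigma> - \<tau>)"
      unfolding has_ci_derivs_def prod.case by blast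
    define A where "A \<sigma> = \<phi> (hist x \<sigma>) - \<phi> (hist x \<tau>) - p \<tau> * (\<sigma> - \<tau>) -
        q \<tau> \<bullet> (frac_int (1 - \<alpha>) (\<lambda>\<xi>. x \<xi> - x 0) \<sigma> -
          frac_int (1 - \<alpha>) (\<lambda>\<xi>. restrict x {0..\<tau>} \<xi> - restrict x {0..\<tau>} 0) \<tau>)" for \<sigma>
    \<comment> \<open>Both fractional integrals become ordinary integrals of \<psi>, so A is the
      increment of \<Phi> less its first order part with p and q frozen at \<tau>.\<close>
    have A: "A \<sigma> = \<Phi> \<sigma> - \<Phi> \<tau> - (p \<tau> * (\<sigma> - \<tau>) + q \<tau> \<bullet> integral {\<tau>..\<sigma>} \<psi>)" if \<sigma>: "\<tau> \<le> \<sigma>" "\<sigma> \<le> T" for \<sigma>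
    proof -
      have "frac_int (1 - \<alpha>) (\<lambda>\<xi>. restrict x {0..\<tau>} \<xi> - restrict x {0..\<tau>} 0) \<tau> = frac_int (1 - \<alpha>) (\<lambda>\<xi>. x \<xi> - x 0) \<tau>"
        by (rule frac_int_cong) (use \<tau>T in auto)
      also have "\<dots> = integral {0..\<tau>} \<psi>"
        by (rule frac_int_complement_density[OF \<alpha> d eq]) (use \<tau>T in auto)
      finally have 1: "frac_int (1 - \<alpha>) (\<lambda>\<xi>. restrict x {0..\<tau>} \<xi> - restrict x {0..\<tau>} 0) \<tau> = integral {0..\<tau>} \<psi>" .
      have 2: "frac_int (1 - \<alpha>) (\<lambda>\<xi>. x \<xi> - x 0) \<sigma> = integral {0..\<sigma>} \<psi>"
        by (rule frac_int_complement_density[OF \<alpha> d eq]) (use \<tau>T \<sigma> in auto)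
      have 3: "integral {0..\<tau>} \<psi> + integral {\<tau>..\<sigma>} \<psi> = integral {0..\<sigma>} \<psi>"
        by (rule Henstock_Kurzweil_Integration.integral_combine) (use \<tau>T \<sigma> int\<psi> in auto)
      show ?thesis unfolding A_def 1 2 3[symmetric] by (simp add: \<Phi>_def)
    qed
    show "(\<lambda>\<sigma>. h \<sigma> - h \<tau>) \<in> o[at_right \<tau>](\<lambda>\<sigma>. \<sigma> - \<tau>)"
    proof (rule landau_o.smallI)
      fix c :: real assume c: "c > 0"
      have ev1: "\<forall>\<^sub>F \<sigma> in at_right \<tau>. norm (A \<sigma>) \<le> c / 2 * norm (\<sigma> - \<tau>)"
        using landau_o.smallD[OF 1, of "c / 2"] c unfolding A_def by simp
      \<comment> \<open>Half of the tolerance c goes to the remainder A, half to freezing p and q at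
        \<tau>, which costs at most \<eta> + \<eta> M = c/2 per unit of time. The density \<psi> may
        have no limit at \<tau>; it stays unfrozen on both sides and is only bounded by M.\<close>
      define K where "K = 1 + M"
      have K: "K > 0" using M by (simp add: K_def)
      define \<eta> where "\<eta> = c / (2 * K)"
      have \<eta>: "\<eta> > 0" "\<eta> * K = c / 2"
        using c K by (simp_all add: \<eta>_def)
      have \<eta>M: "\<eta> + \<eta> * M = c / 2"
        using \<eta>(2) by (simp add: K_def distrib_left)
      obtain d1 where d1: "d1 > 0" "\<And>\<xi>. \<xi> \<in> {t..s} \<Longrightarrow> dist \<xi> \<tau> < d1 \<Longrightarrow> dist (p \<xi>) (p \<tau>) < \<eta>"
        using cont(1) \<eta>(1) \<tau>T(2) unfolding continuous_on_iff by meson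
      obtain d2 where d2: "d2 > 0" "\<And>\<xi>. \<xi> \<in> {t..s} \<Longrightarrow> dist \<xi> \<tau> < d2 \<Longrightarrow> dist (q \<xi>) (q \<tau>) < \<eta>"
        using cont(2) \<eta>(1) \<tau>T(2) unfolding continuous_on_iff by meson
      have "\<forall>\<^sub>F \<sigma> in at_right \<tau>. \<sigma> \<in> {\<tau><..<min s (\<tau> + min d1 d2)}"
        by (rule eventually_at_right_real) (use \<tau> d1 d2 in auto)
      with ev1 show "\<forall>\<^sub>F \<sigma> in at_right \<tau>. norm (h \<sigma> - h \<tau>) \<le> c * norm (\<sigma> - \<tau>)"
      proof eventually_elim
        case (elim \<sigma>)
        then have \<sigma>: "\<tau> < \<sigma>" "\<sigma> < s" "\<sigma> < \<tau> + d1" "\<sigma> < \<tau> + d2" by auto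
        have k\<sigma>: "(k has_integral integral {\<tau>..\<sigma>} k) {\<tau>..\<sigma>}"
          by (rule integrable_integral, rule integrable_on_subinterval[OF ki]) (use \<sigma> \<tau> in auto)
        have "(\<psi> has_integral integral {\<tau>..\<sigma>} \<psi>) {\<tau>..\<sigma>}"
          by (rule integrable_integral, rule int\<psi>) (use \<sigma> ts \<tau>T in auto)
        from has_integral_linear[OF this bounded_linear_inner_right[of "q \<tau>"]]
        have "((\<lambda>\<xi>. q \<tau> \<bullet> \<psi> \<xi>) has_integral q \<tau> \<bullet> integral {\<tau>..\<sigma>} \<psi>) {\<tau>..\<sigma>}"
          by (simp add: o_def)
        from has_integral_add[OF has_integral_const_real[of "p \<tau>" \<tau> \<sigma>] this]
        have "((\<lambda>\<xi>. p \<tau> + q \<tau> \<bullet> \<psi> \<xi>) has_integral p \<tau> * (\<sigma> - \<tau>) + q \<tau> \<bullet> integral {\<tau>..\<sigma>} \<psi>) {\<tau>..\<sigma>}"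
          using \<sigma> by (simp add: mult.commute)
        from has_integral_diff[OF this k\<sigma>]
        have I: "((\<lambda>\<xi>. p \<tau> + q \<tau> \<bullet> \<psi> \<xi> - k \<xi>) has_integral p \<tau> * (\<sigma> - \<tau>) + q \<tau> \<bullet> integral {\<tau>..\<sigma>} \<psi> - integral {\<tau>..\<sigma>} k) {\<tau>..\<sigma>}" .
        have "norm (p \<tau> * (\<sigma> - \<tau>) + q \<tau> \<bullet> integral {\<tau>..\<sigma>} \<psi> - integral {\<tau>..\<sigma>} k) \<le> c / 2 * measure lborel {\<tau>..\<sigma>}"
        proof (rule has_integral_bound_real[OF _ finite.emptyI I])
          show "0 \<le> c / 2" using c by simp
          fix \<xi> assume \<xi>: "\<xi> \<in> {\<tau>..\<sigma>} - {}"
          then have \<xi>': "\<xi> \<in> {t..s}" "dist \<xi> \<tau> < d1" "dist \<xi> \<tau> < d2"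
            using \<sigma> \<tau> by (auto simp: dist_real_def)
          have "\<bar>(q \<tau> - q \<xi>) \<bullet> \<psi> \<xi>\<bar> \<le> norm (q \<tau> - q \<xi>) * norm (\<psi> \<xi>)" by (rule Cauchy_Schwarz_ineq2)
          also have "\<dots> \<le> \<eta> * M"
            using d2(2)[OF \<xi>'(1,3)] bd[of \<xi>] \<eta>(1) by (intro mult_mono) (auto simp: dist_norm norm_minus_commute)
          finally have "\<bar>(p \<tau> - p \<xi>) + (q \<tau> - q \<xi>) \<bullet> \<psi> \<xi>\<bar> \<le> \<eta> + \<eta> * M"
            using d1(2)[OF \<xi>'(1,2)] abs_triangle_ineq[of "p \<tau> - p \<xi>" "(q \<tau> - q \<xi>) \<bullet> \<psi> \<xi>"]
            by (simp add: dist_real_def abs_minus_commute)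
          also have "(p \<tau> - p \<xi>) + (q \<tau> - q \<xi>) \<bullet> \<psi> \<xi> = p \<tau> + q \<tau> \<bullet> \<psi> \<xi> - k \<xi>"
            by (simp add: k inner_diff_left)
          finally show "norm (p \<tau> + q \<tau> \<bullet> \<psi> \<xi> - k \<xi>) \<le> c / 2"
            using \<eta>M by simp
        qed
        then have B: "\<bar>p \<tau> * (\<sigma> - \<tau>) + q \<tau> \<bullet> integral {\<tau>..\<sigma>} \<psi> - integral {\<tau>..\<sigma>} k\<bar> \<le> c / 2 * (\<sigma> - \<tau>)"
          using \<sigma> by simp
        have "integral {t..\<tau>} k + integral {\<tau>..\<sigma>} k = integral {t..\<sigma>} k"
          by (rule Henstock_Kurzweil_Integration.integral_combine)
            (use \<sigma> \<tau> in \<open>auto intro!: integrable_on_subinterval[OF ki]\<close>)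
        then have "h \<sigma> - h \<tau> = A \<sigma> + (p \<tau> * (\<sigma> - \<tau>) + q \<tau> \<bullet> integral {\<tau>..\<sigma>} \<psi> - integral {\<tau>..\<sigma>} k)"
          using A[of \<sigma>] \<sigma> ts by (simp add: h_def)
        also have "\<bar>\<dots>\<bar> \<le> c / 2 * (\<sigma> - \<tau>) + c / 2 * (\<sigma> - \<tau>)"
          using elim(1) B \<sigma> by (intro order_trans[OF abs_triangle_ineq] add_mono) auto
        finally show ?case using \<sigma> by (simp add: field_simps)
      qed
    qed
  qed
  then show "\<phi> (hist x s) - \<phi> (hist x t) = integral {t..s} k"
    by (simp add: h_def \<Phi>_def)
qed

section \<open>Control laws\<close>

lemma partition_less:
  assumes "is_partition t T k \<Delta>" "i < j" "j \<le> k"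
  shows "\<Delta> i < \<Delta> j"
  using assms(2,3)
proof (induction j)
  case (Suc j)
  have "\<Delta> j < \<Delta> (Suc j)" using assms(1) Suc.prems by (auto simp: is_partition_def)
  then show ?case using Suc by (cases "i = j") auto
qed simp

lemma partition_bounds:
  assumes p: "is_partition t T k \<Delta>" and j: "j \<le> k"
  shows "t \<le> \<Delta> j" "\<Delta> j \<le> T" "j < k \<Longrightarrow> \<Delta> j < T"
  using partition_less[OF p, of 0 j] partition_less[OF p, of j k] p j
  by (cases "j = 0"; cases "j = k"; auto simp: is_partition_def)+

lemma partition_interval:
  assumes p: "is_partition t T k \<Delta>" and \<tau>: "\<tau> \<in> {t..<T}"
  shows "\<exists>j<k. \<tau> \<in> {\<Delta> j..<\<Delta> (Suc j)}"
proof -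
  have "\<not> \<tau> < \<Delta> 0" "\<tau> < \<Delta> k" using p \<tau> by (auto simp: is_partition_def)
  then have "\<exists>j<k. (\<forall>i\<le>j. \<not> \<tau> < \<Delta> i) \<and> \<tau> < \<Delta> (Suc j)"
    by (intro ex_least_nat_less[of "\<lambda>i. \<tau> < \<Delta> i"])
  then show ?thesis by force
qed

lemma partition_interval_unique:
  assumes p: "is_partition t T k \<Delta>" and "i < k" "\<tau> \<in> {\<Delta> i..<\<Delta> (Suc i)}" "j < k" "\<tau> \<in> {\<Delta> j..<\<Delta> (Suc j)}"
  shows "i = j"
proof -
  have le: "\<Delta> a \<le> \<Delta> b" if "a \<le> b" "b \<le> k" for a b
    using partition_less[OF p, of a b] that by (cases "a = b") auto
  show ?thesis
    using le[of "Suc i" j] le[of "Suc j" i] assms(2-) by (cases i j rule: linorder_cases) auto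
qed

lemma diam_ge:
  assumes "j < k" shows "\<Delta> (Suc j) - \<Delta> j \<le> diam k \<Delta>"
  unfolding diam_def by (rule Max_ge) (use assms in auto)

lemma const_control:
  assumes "v \<in> P" shows "(\<lambda>\<tau>\<in>{a..b}. v) \<in> controls P a b"
proof -
  have "(\<lambda>\<tau>\<in>{a..b}. v) \<in> borel_measurable (lebesgue_on {a..b})"
    by (rule measurable_cong[THEN iffD1, of _ "\<lambda>_. v"]) auto
  with assms show ?thesis by (auto simp: controls_def)
qed

context control_system
begin

context
  fixes U :: "'n position \<Rightarrow> real ^ 'm" and t :: real and w :: "real \<Rightarrow> real ^ 'n" and k \<Delta> u_end
  assumes U: "U \<in> G0 \<alpha> T \<rightarrow> P" and tw: "(t, w) \<in> G0 \<alpha> T" and part: "is_partition t T k \<Delta>"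
    and u_end: "u_end \<in> P"
begin

lemma t_bounds: "0 \<le> t" "t < T" "w \<in> AC \<alpha> t"
  using tw by (auto simp: G0_def G_def)

text \<open>U is known to map into P only on \<open>G0\<close>, so admissibility of each piece of
  the control rests on the regularity of the motion built so far.\<close>

lemma law_motion_AC:
  "j \<le> k \<Longrightarrow> law_motion \<alpha> f w U \<Delta> j \<in> AC \<alpha> (\<Delta> j)"
proof (induction j)
  case 0
  then show ?case using t_bounds part by (simp add: is_partition_def)
next
  case (Suc j)
  then have IH: "law_motion \<alpha> f w U \<Delta> j \<in> AC \<alpha> (\<Delta> j)" by simp
  have b: "0 \<le> \<Delta> j" "\<Delta> j < T" "\<Delta> j \<le> \<Delta> (Suc j)" "\<Delta> (Suc j) \<le> T"
    using partition_bounds[OF part] partition_less[OF part, of j "Suc j"] Suc.prems t_bounds(1)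
    by (auto intro: order_trans)
  then have "(\<Delta> j, law_motion \<alpha> f w U \<Delta> j) \<in> G0 \<alpha> T" using IH by (auto simp: G0_def G_def)
  then have "U (\<Delta> j, law_motion \<alpha> f w U \<Delta> j) \<in> P" using U by auto
  from is_motionD(1)[OF is_motion_motion[OF b(1,3,4) IH const_control[OF this]]]
  show ?case by simp
qed

lemma law_value_in_P:
  assumes "j < k" shows "U (\<Delta> j, law_motion \<alpha> f w U \<Delta> j) \<in> P"
proof -
  have "0 \<le> \<Delta> j" "\<Delta> j < T"
    using partition_bounds[OF part, of j] assms t_bounds(1) by auto
  then have "(\<Delta> j, law_motion \<alpha> f w U \<Delta> j) \<in> G0 \<alpha> T"
    using law_motion_AC[of j] assms by (auto simp: G0_def G_def)
  then show ?thesis using U by auto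
qed

lemma law_control_eq:
  assumes j: "j < k" and \<tau>: "\<tau> \<in> {\<Delta> j..<\<Delta> (Suc j)}"
  shows "law_control \<alpha> f w U u_end k \<Delta> \<tau> = U (\<Delta> j, law_motion \<alpha> f w U \<Delta> j)"
proof -
  have "(THE i. i < k \<and> \<tau> \<in> {\<Delta> i..<\<Delta> (Suc i)}) = j"
    by (rule the_equality) (use j \<tau> partition_interval_unique[OF part] in blast)+
  moreover have "\<tau> \<in> {\<Delta> 0..\<Delta> k}" "\<tau> \<noteq> \<Delta> k"
    using partition_bounds[OF part, of j] partition_bounds[OF part, of "Suc j"] j \<tau> part
    by (auto simp: is_partition_def)
  ultimately show ?thesis by (simp add: law_control_def)
qed

lemma law_control_in_controls: "law_control \<alpha> f w U u_end k \<Delta> \<in> controls P t T"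
proof -
  let ?u = "law_control \<alpha> f w U u_end k \<Delta>"
  have \<Delta>: "\<Delta> 0 = t" "\<Delta> k = T" using part by (auto simp: is_partition_def)
  have T: "?u T = u_end" using \<Delta> t_bounds by (simp add: law_control_def)
  have ext: "?u \<in> extensional {t..T}" using \<Delta> by (simp add: law_control_def)
  have val: "?u \<tau> \<in> P" if "\<tau> \<in> {t..T}" for \<tau>
  proof (cases "\<tau> = T")
    case False
    then obtain j where "j < k" "\<tau> \<in> {\<Delta> j..<\<Delta> (Suc j)}" using partition_interval[OF part, of \<tau>] \<open>\<tau> \<in> {t..T}\<close> by auto
    then show ?thesis using law_control_eq law_value_in_P by simp
  qed (use T u_end in simp)
  \<comment> \<open>A finite step function, borel on the whole line, that equals the control on
    [t, T]; the last term carries the separate value at T.\<close>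
  define g where "g \<tau> = (\<Sum>j<k. indicator {\<Delta> j..<\<Delta> (Suc j)} \<tau> *\<^sub>R U (\<Delta> j, law_motion \<alpha> f w U \<Delta> j))
    + indicator {T} \<tau> *\<^sub>R u_end" for \<tau>
  have "g \<in> borel_measurable borel" unfolding g_def by measurable
  then have "g \<in> borel_measurable (lebesgue_on {t..T})" by (rule borel_measurable_lebesgue_on)
  moreover have "g \<tau> = ?u \<tau>" if \<tau>: "\<tau> \<in> {t..T}" for \<tau>
  proof (cases "\<tau> = T")
    case True
    have "indicator {\<Delta> j..<\<Delta> (Suc j)} T = (0 :: real)" if "j < k" for j
      using partition_bounds(2)[OF part, of "Suc j"] that by (auto simp: indicator_def)
    then show ?thesis using True T by (simp add: g_def)
  next
    case False
    then obtain j where j: "j < k" "\<tau> \<in> {\<Delta> j..<\<Delta> (Suc j)}" using partition_interval[OF part, of \<tau>] \<tau> by auto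
    let ?v = "U (\<Delta> j, law_motion \<alpha> f w U \<Delta> j)"
    have "(\<Sum>i<k. indicator {\<Delta> i..<\<Delta> (Suc i)} \<tau> *\<^sub>R U (\<Delta> i, law_motion \<alpha> f w U \<Delta> i))
        = (\<Sum>i<k. if i = j then ?v else 0)"
    proof (rule sum.cong[OF refl])
      fix i assume "i \<in> {..<k}"
      then have i: "i < k" by simp
      show "indicator {\<Delta> i..<\<Delta> (Suc i)} \<tau> *\<^sub>R U (\<Delta> i, law_motion \<alpha> f w U \<Delta> i) = (if i = j then ?v else 0)"
      proof (cases "i = j")
        case True
        then show ?thesis using j(2) by (simp only: indicator_simps simp_thms if_True scaleR_one)
      next
        case False
        then have "\<tau> \<notin> {\<Delta> i..<\<Delta> (Suc i)}"
          using partition_interval_unique[OF part i _ j] by blast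
        then have "indicat_real {\<Delta> i..<\<Delta> (Suc i)} \<tau> = 0"
          by (rule indicator_simps(2))
        then show ?thesis using False by (simp only: if_False scaleR_zero_left)
      qed
    qed
    also have "\<dots> = ?v" using j(1) by (subst sum.delta) auto
    finally show ?thesis
      unfolding g_def law_control_eq[OF j] using False by simp
  qed
  ultimately have "?u \<in> borel_measurable (lebesgue_on {t..T})"
    by (subst measurable_cong[of _ ?u g]) auto
  then show ?thesis unfolding controls_def PiE_def using val ext by blast
qed

abbreviation law_trajectory where
  "law_trajectory \<equiv> motion \<alpha> f t w T (law_control \<alpha> f w U u_end k \<Delta>)"

lemma law_trajectory_is_motion: "is_motion t w T (law_control \<alpha> f w U u_end k \<Delta>) law_trajectory"
  by (rule is_motion_motion) (use t_bounds law_control_in_controls in auto)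

text \<open>\<open>law_motion\<close> is glued from motions on successive pieces; uniqueness of
  motions identifies each stage with a restriction of the single motion under
  \<open>law_control\<close>.\<close>

lemma law_motion_eq_restrict:
  "j \<le> k \<Longrightarrow> law_motion \<alpha> f w U \<Delta> j = restrict law_trajectory {0..\<Delta> j}"
proof (induction j)
  case 0
  have "w = restrict law_trajectory {0..t}"
    by (rule extensionalityI[of _ "{0..t}"])
      (use t_bounds is_motionD(2)[OF law_trajectory_is_motion] in \<open>auto simp: AC_def\<close>)
  then show ?case using part by (simp add: is_partition_def)
next
  case (Suc j)
  then have IH: "law_motion \<alpha> f w U \<Delta> j = restrict law_trajectory {0..\<Delta> j}" and j: "j < k" by auto
  have b: "t \<le> \<Delta> j" "\<Delta> j \<le> \<Delta> (Suc j)" "\<Delta> (Suc j) \<le> T"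
    using partition_bounds[OF part] partition_less[OF part, of j "Suc j"] Suc.prems by auto
  let ?v = "\<lambda>\<tau>\<in>{\<Delta> j..\<Delta> (Suc j)}. U (\<Delta> j, law_motion \<alpha> f w U \<Delta> j)"
  have "is_motion (\<Delta> j) (restrict law_trajectory {0..\<Delta> j}) (\<Delta> (Suc j)) ?v (restrict law_trajectory {0..\<Delta> (Suc j)})"
    by (rule is_motion_restrict[OF law_trajectory_is_motion t_bounds(1) b])
      (use law_control_eq[OF j] in auto)
  then have "motion \<alpha> f (\<Delta> j) (restrict law_trajectory {0..\<Delta> j}) (\<Delta> (Suc j)) ?v = restrict law_trajectory {0..\<Delta> (Suc j)}"
    by (intro motion_eqI) (use b t_bounds law_value_in_P[OF j] in auto)
  then show ?case by (simp add: IH)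
qed

text \<open>Partition indices disappear here: besides admissibility, the optimality proof uses only
  that the control at \<tau> is the value of U at a history older by at most the diameter.\<close>

lemma law_control_feedback:
  assumes \<tau>: "\<tau> \<in> {t..<T}"
  shows "\<exists>s\<in>{t..\<tau>}. \<tau> - s \<le> diam k \<Delta> \<and> law_control \<alpha> f w U u_end k \<Delta> \<tau> = U (hist law_trajectory s)"
proof -
  obtain j where j: "j < k" "\<tau> \<in> {\<Delta> j..<\<Delta> (Suc j)}" using partition_interval[OF part \<tau>] by auto
  show ?thesis
  proof (intro bexI conjI)
    show "\<tau> - \<Delta> j \<le> diam k \<Delta>" using diam_ge[OF j(1), of \<Delta>] j(2) by auto
    show "law_control \<alpha> f w U u_end k \<Delta> \<tau> = U (hist law_trajectory (\<Delta> j))"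
      using law_control_eq[OF j] law_motion_eq_restrict[of j] j(1) by simp
    show "\<Delta> j \<in> {t..\<tau>}" using partition_bounds(1)[OF part, of j] j by auto
  qed
qed

end

end

section \<open>The Hamilton--Jacobi--Bellman equation\<close>

lemma integral_cong_AE_lebesgue:
  fixes g :: "real \<Rightarrow> 'a::euclidean_space"
  assumes ae: "AE x in lebesgue. x \<in> {a..b} \<longrightarrow> g x = h x"
  shows "integral {a..b} g = integral {a..b} h" "g integrable_on {a..b} \<Longrightarrow> h integrable_on {a..b}"
proof -
  obtain N where N: "\<And>x. x \<in> space lebesgue - N \<Longrightarrow> x \<in> {a..b} \<longrightarrow> g x = h x" "N \<in> null_sets lebesgue"
    using ae by (rule AE_E3) blast
  then have neg: "negligible N" by (simp add: negligible_iff_null_sets)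
  have eq: "g x = h x" if "x \<in> {a..b} - N" for x using N(1)[of x] that by simp
  show "integral {a..b} g = integral {a..b} h"
    by (rule integral_spike[OF neg]) (use eq in auto)
  show "h integrable_on {a..b}" if "g integrable_on {a..b}"
    by (rule integrable_spike[OF that neg]) (use eq in auto)
qed

lemma set_lebesgue_integral_Icc:
  fixes g :: "real \<Rightarrow> 'a::euclidean_space"
  assumes "g \<in> borel_measurable (lebesgue_on {a..b})" "\<And>x. x \<in> {a..b} \<Longrightarrow> norm (g x) \<le> M"
  shows "(LINT x:{a..b}|lebesgue. g x) = integral {a..b} g"
proof -
  have "(LINT x:{a..b}|lebesgue. g x) = (LINT x|lebesgue_on {a..b}. g x)"
    unfolding set_lebesgue_integral_def by (subst integral_restrict_space) auto
  also have "\<dots> = integral {a..b} g"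
    using assms by (intro bounded_integrable_lebesgue_on(3)[OF _ AE_I2, where M=M]) auto
  finally show ?thesis .
qed

locale hjb_system = control_system \<alpha> T P f
  for \<alpha> T P and f :: "real \<Rightarrow> real ^ 'n::finite \<Rightarrow> real ^ 'm \<Rightarrow> real ^ 'n" +
  fixes \<sigma> :: "real ^ 'n \<Rightarrow> real" and chi :: "real \<Rightarrow> real ^ 'n \<Rightarrow> real ^ 'm \<Rightarrow> real"
    and u_end :: "real ^ 'm" and \<phi> :: "'n position \<Rightarrow> real"
  assumes u_end: "u_end \<in> P"
    and chi_cont: "continuous_on ({0..T} \<times> UNIV \<times> P) (\<lambda>(\<tau>, x, u). chi \<tau> x u)"
    and smooth: "ci_smooth \<alpha> T \<phi>"
    and hjb: "\<forall>(t, w) \<in> G0 \<alpha> T.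
           ci_dt \<alpha> T \<phi> (t, w) + hamiltonian P f chi t (w t) (ci_grad \<alpha> T \<phi> (t, w)) = 0"
    and terminal: "\<forall>w \<in> AC \<alpha> T. \<phi> (T, w) = \<sigma> (w T)"
begin

text \<open>The Hamilton-Jacobi-Bellman expression before minimisation in v: along any x in
  \<open>AC \<alpha> T\<close> the equation says that its minimum over \<open>P\<close> is 0 for 0
  <= r < T.\<close>

definition defect where
  "defect x r v = ci_dt \<alpha> T \<phi> (hist x r) + ci_grad \<alpha> T \<phi> (hist x r) \<bullet> f r (x r) v + chi r (x r) v"

definition optimal_feedback where
  "optimal_feedback U \<longleftrightarrow> (\<forall>(t, w) \<in> G0 \<alpha> T.
     is_arg_min (\<lambda>u. ci_grad \<alpha> T \<phi> (t, w) \<bullet> f t (w t) u + chi t (w t) u) (\<lambda>u. u \<in> P) (U (t, w)))"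

lemma hamiltonian_integrand_continuous:
  assumes "t \<in> {0..T}"
  shows "continuous_on P (\<lambda>u. s \<bullet> f t y u + chi t y u)"
proof -
  have "continuous_on P (\<lambda>u. (\<lambda>(\<tau>, x, u). f \<tau> x u) (t, y, u))"
    by (rule continuous_on_compose2[OF f_cont]) (use assms in \<open>auto intro!: continuous_intros\<close>)
  moreover have "continuous_on P (\<lambda>u. (\<lambda>(\<tau>, x, u). chi \<tau> x u) (t, y, u))"
    by (rule continuous_on_compose2[OF chi_cont]) (use assms in \<open>auto intro!: continuous_intros\<close>)
  ultimately show ?thesis by (auto intro!: continuous_intros)
qed

lemma hamiltonian_attained:
  assumes "t \<in> {0..T}"
  obtains v where "v \<in> P" "\<And>u. u \<in> P \<Longrightarrow> s \<bullet> f t y v + chi t y v \<le> s \<bullet> f t y u + chi t y u"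
    "hamiltonian P f chi t y s = s \<bullet> f t y v + chi t y v"
proof -
  obtain v where v: "v \<in> P" "\<And>u. u \<in> P \<Longrightarrow> s \<bullet> f t y v + chi t y v \<le> s \<bullet> f t y u + chi t y u"
    using continuous_attains_inf[OF compact_P _ hamiltonian_integrand_continuous[OF assms, of s y]] u_end by blast
  have "hamiltonian P f chi t y s = s \<bullet> f t y v + chi t y v"
    unfolding hamiltonian_def by (rule cInf_eq_minimum) (use v in auto)
  with v show ?thesis by (rule that)
qed

lemma defect_nonneg:
  assumes x: "x \<in> AC \<alpha> T" and r: "r \<in> {0..<T}" and v: "v \<in> P"
  shows "0 \<le> defect x r v"
proof -
  have "r \<in> {0..T}" using r by auto
  then obtain v' where v': "\<And>u. u \<in> P \<Longrightarrow> ci_grad \<alpha> T \<phi> (hist x r) \<bullet> f r (x r) v' + chi r (x r) v' \<le> ci_grad \<alpha> T \<phi> (hist x r) \<bullet> f r (x r) u + chi r (x r) u"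
    "hamiltonian P f chi r (x r) (ci_grad \<alpha> T \<phi> (hist x r)) = ci_grad \<alpha> T \<phi> (hist x r) \<bullet> f r (x r) v' + chi r (x r) v'"
    by (rule hamiltonian_attained[of r "ci_grad \<alpha> T \<phi> (hist x r)" "x r"]) blast
  have "ci_dt \<alpha> T \<phi> (hist x r) + hamiltonian P f chi r (restrict x {0..r} r) (ci_grad \<alpha> T \<phi> (hist x r)) = 0"
    using hjb hist_in_G0[OF x r] by blast
  then show ?thesis using v'(1)[OF v] v'(2) r by (simp add: defect_def)
qed

lemma defect_feedback_zero:
  assumes U: "optimal_feedback U" and x: "x \<in> AC \<alpha> T" and r: "r \<in> {0..<T}"
  shows "defect x r (U (hist x r)) = 0"
proof -
  let ?s = "ci_grad \<alpha> T \<phi> (hist x r)" and ?v = "U (hist x r)"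
  have r': "r \<in> {0..T}" using r by auto
  have h: "ci_dt \<alpha> T \<phi> (hist x r) + hamiltonian P f chi r (restrict x {0..r} r) ?s = 0"
    using hjb hist_in_G0[OF x r] by blast
  have "is_arg_min (\<lambda>u. ?s \<bullet> f r (restrict x {0..r} r) u + chi r (restrict x {0..r} r) u) (\<lambda>u. u \<in> P) ?v"
    using U hist_in_G0[OF x r] unfolding optimal_feedback_def by blast
  then have v: "?v \<in> P" "\<And>u. u \<in> P \<Longrightarrow> ?s \<bullet> f r (x r) ?v + chi r (x r) ?v \<le> ?s \<bullet> f r (x r) u + chi r (x r) u"
    using r by (auto simp: is_arg_min_def not_less)
  have "hamiltonian P f chi r (x r) ?s = ?s \<bullet> f r (x r) ?v + chi r (x r) ?v"
    unfolding hamiltonian_def by (rule cInf_eq_minimum) (use v in auto)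
  then show ?thesis using h r by (simp add: defect_def)
qed

text \<open>Strategies are arbitrary maps and control laws are piecewise constant, so a minimiser
  may be chosen at each position independently and the resulting controls are still
  measurable.\<close>

lemma optimal_feedback_exists: "\<exists>U. U \<in> G0 \<alpha> T \<rightarrow> P \<and> optimal_feedback U"
proof -
  have "\<exists>v. is_arg_min (\<lambda>u. ci_grad \<alpha> T \<phi> z \<bullet> f (fst z) (snd z (fst z)) u + chi (fst z) (snd z (fst z)) u) (\<lambda>u. u \<in> P) v"
    if "z \<in> G0 \<alpha> T" for z
  proof -
    have "fst z \<in> {0..T}" using that by (auto simp: G0_def G_def)
    then obtain v where "v \<in> P" "\<And>u. u \<in> P \<Longrightarrow> ci_grad \<alpha> T \<phi> z \<bullet> f (fst z) (snd z (fst z)) v + chi (fst z) (snd z (fst z)) v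
        \<le> ci_grad \<alpha> T \<phi> z \<bullet> f (fst z) (snd z (fst z)) u + chi (fst z) (snd z (fst z)) u"
      by (rule hamiltonian_attained[of "fst z" "ci_grad \<alpha> T \<phi> z" "snd z (fst z)"]) blast
    then show ?thesis by (auto simp: is_arg_min_def not_less)
  qed
  note ex = this
  define U where "U z = (SOME v. is_arg_min (\<lambda>u. ci_grad \<alpha> T \<phi> z \<bullet> f (fst z) (snd z (fst z)) u + chi (fst z) (snd z (fst z)) u) (\<lambda>u. u \<in> P) v)" for z
  have U: "is_arg_min (\<lambda>u. ci_grad \<alpha> T \<phi> z \<bullet> f (fst z) (snd z (fst z)) u + chi (fst z) (snd z (fst z)) u) (\<lambda>u. u \<in> P) (U z)"
    if "z \<in> G0 \<alpha> T" for z
    unfolding U_def by (rule someI_ex[OF ex[OF that]])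
  then have "optimal_feedback U" unfolding optimal_feedback_def by fastforce
  moreover have "U \<in> G0 \<alpha> T \<rightarrow> P" using U by (auto simp: is_arg_min_def)
  ultimately show ?thesis by blast
qed

text \<open>The limit time lies below T because the coinvariant derivatives are continuous on
  \<open>G0\<close> only. Trajectory, time and control value vary independently, so one control
  value can later be tested at two different times.\<close>

lemma defect_tendsto:
  assumes Y: "\<And>n. Y n \<in> AC \<alpha> T" and x: "x \<in> AC \<alpha> T"
    and lim: "\<And>e. e > 0 \<Longrightarrow> \<forall>\<^sub>F n in sequentially. \<forall>\<tau>\<in>{0..T}. norm (Y n \<tau> - x \<tau>) \<le> e"
    and s: "\<And>n. s n \<in> {0..<T}" "s \<longlonglongrightarrow> r" "r < T"
    and v: "\<And>n. v n \<in> P" "v \<longlonglongrightarrow> v'"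
  shows "(\<lambda>n. defect (Y n) (s n) (v n)) \<longlonglongrightarrow> defect x r v'"
proof -
  have s': "s n \<in> {0..T}" for n using s(1)[of n] by auto
  have "r \<in> {0..T}"
    by (rule Lim_in_closed_set[OF closed_atLeastAtMost _ _ s(2)]) (use s' in auto)
  then have r: "r \<in> {0..T}" "r \<in> {0..<T}" using s(3) by auto
  have v': "v' \<in> P"
    by (rule Lim_in_closed_set[OF compact_imp_closed[OF compact_P] _ _ v(2)]) (use v(1) in auto)
  note cx = AC_continuous_on[OF alpha(1) alpha_le x]
  have G0: "hist x r \<in> G0 \<alpha> T" "\<And>n. hist (Y n) (s n) \<in> G0 \<alpha> T"
    using hist_in_G0[OF x r(2)] hist_in_G0[OF Y s(1)] by auto
  have p: "(\<lambda>n. ci_dt \<alpha> T \<phi> (hist (Y n) (s n))) \<longlonglongrightarrow> ci_dt \<alpha> T \<phi> (hist x r)"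
    using smooth unfolding ci_smooth_def by (intro pos_continuous_on_sequence[OF _ cx lim s' s(2) G0]) auto
  have q: "(\<lambda>n. ci_grad \<alpha> T \<phi> (hist (Y n) (s n))) \<longlonglongrightarrow> ci_grad \<alpha> T \<phi> (hist x r)"
    using smooth unfolding ci_smooth_def by (intro pos_continuous_on_sequence[OF _ cx lim s' s(2) G0]) auto
  have "(\<lambda>n. x (s n)) \<longlonglongrightarrow> x r"
    using cx r(1) s' s(2) unfolding continuous_on_sequentially o_def by blast
  moreover have "(\<lambda>n. Y n (s n) - x (s n)) \<longlonglongrightarrow> 0"
  proof (rule tendstoI)
    fix e :: real assume "e > 0"
    then have "\<forall>\<^sub>F n in sequentially. \<forall>\<tau>\<in>{0..T}. norm (Y n \<tau> - x \<tau>) \<le> e / 2" by (intro lim) simp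
    then show "\<forall>\<^sub>F n in sequentially. dist (Y n (s n) - x (s n)) 0 < e"
    proof eventually_elim
      case (elim n)
      then have "norm (Y n (s n) - x (s n)) \<le> e / 2" using s' by blast
      then show ?case using \<open>e > 0\<close> by simp
    qed
  qed
  ultimately have Ys: "(\<lambda>n. Y n (s n)) \<longlonglongrightarrow> x r"
    using tendsto_add by fastforce
  have tr: "(\<lambda>n. (s n, Y n (s n), v n)) \<longlonglongrightarrow> (r, x r, v')"
    by (intro tendsto_Pair s(2) Ys v(2))
  have F: "(\<lambda>n. F (s n, Y n (s n), v n)) \<longlonglongrightarrow> F (r, x r, v')"
    if "continuous_on ({0..T} \<times> UNIV \<times> P) F" for F :: "_ \<Rightarrow> 'c::topological_space"
    by (rule continuous_on_tendsto_compose[OF that tr]) (use r v' s' v(1) in auto)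
  show ?thesis
    unfolding defect_def using F[OF f_cont] F[OF chi_cont] by (intro tendsto_intros p q) auto
qed

section \<open>Costs as integrals of the defect\<close>

lemma chi_bounded:
  obtains C where "0 \<le> C" "\<And>\<tau> y v. \<tau> \<in> {0..T} \<Longrightarrow> norm y \<le> R \<Longrightarrow> v \<in> P \<Longrightarrow> \<bar>chi \<tau> y v\<bar> \<le> C"
proof -
  define Z where "Z = (\<lambda>(\<tau>, x, u). chi \<tau> x u) ` ({0..T} \<times> cball 0 R \<times> P)"
  have "bounded Z" unfolding Z_def
    by (intro compact_imp_bounded compact_continuous_image continuous_on_subset[OF chi_cont] compact_Times compact_P) auto
  then obtain C where C: "\<forall>z\<in>Z. norm z \<le> C"
    unfolding bounded_iff by blast
  show thesis
  proof (rule that)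
    show "\<bar>chi \<tau> y v\<bar> \<le> \<bar>C\<bar>" if "\<tau> \<in> {0..T}" "norm y \<le> R" "v \<in> P" for \<tau> y v
    proof -
      have "chi \<tau> y v \<in> Z"
        unfolding Z_def using that by (intro image_eqI[of _ _ "(\<tau>, y, v)"]) auto
      then have "norm (chi \<tau> y v) \<le> C" using C by blast
      then show ?thesis by simp
    qed
  qed simp
qed

text \<open>s stays below T because the coinvariant derivatives need not remain bounded up to T. The
  two boundary terms, the increment of \<phi> and the running cost on [s, T], vanish as s tends to
  T.\<close>

lemma cost_identity:
  assumes tw: "(t, w) \<in> G0 \<alpha> T" and u: "u \<in> controls P t T" and s: "s \<in> {t..<T}"
  defines "x \<equiv> motion \<alpha> f t w T u"
  defines "c \<equiv> (\<lambda>\<tau>. chi \<tau> (x \<tau>) (u \<tau>))"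
  shows "(\<lambda>\<xi>. defect x \<xi> (u \<xi>)) integrable_on {t..s}" "c integrable_on {s..T}"
    "cost \<alpha> T f \<sigma> chi (t, w) u - \<phi> (t, w) =
      (\<phi> (hist x T) - \<phi> (hist x s)) + integral {t..s} (\<lambda>\<xi>. defect x \<xi> (u \<xi>)) + integral {s..T} c"
proof -
  have t: "0 \<le> t" "t < T" "w \<in> AC \<alpha> t" using tw by (auto simp: G0_def G_def)
  have s': "t \<le> s" "s < T" using s by auto
  have x: "is_motion t w T u x"
    unfolding x_def by (rule is_motion_motion) (use t u in auto)
  note xAC = is_motionD(1)[OF x]
  obtain \<psi>0 M where \<psi>0: "frac_density T M \<psi>0" "\<And>\<tau>. \<tau> \<in> {0..T} \<Longrightarrow> x \<tau> = x 0 + frac_int \<alpha> \<psi>0 \<tau>"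
    using xAC by (rule AC_frac_densityE) blast
  obtain \<psi> where \<psi>: "frac_density T M \<psi>" "\<And>\<xi>. norm (\<psi> \<xi>) \<le> M" "\<And>\<tau>. \<tau> \<in> {0..T} \<Longrightarrow> frac_int \<alpha> \<psi> \<tau> = frac_int \<alpha> \<psi>0 \<tau>"
    using AC_bounded_densityE[OF \<psi>0(1), of \<alpha>] by blast
  have eq: "x \<tau> = x 0 + frac_int \<alpha> \<psi> \<tau>" if "\<tau> \<in> {0..T}" for \<tau>
    unfolding \<psi>(3)[OF that] by (rule \<psi>0(2)[OF that])
  define k where "k \<xi> = ci_dt \<alpha> T \<phi> (hist x \<xi>) + ci_grad \<alpha> T \<phi> (hist x \<xi>) \<bullet> \<psi> \<xi>" for \<xi>
  have k: "k integrable_on {t..s}" "\<phi> (hist x s) - \<phi> (hist x t) = integral {t..s} k"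
    using ci_smooth_integral_formula[OF alpha smooth xAC \<psi>(1,2) eq t(1) s'] unfolding k_def by blast+
  have wx: "hist x t = (t, w)"
  proof -
    have "restrict x {0..t} = w"
      by (rule extensionalityI[of _ "{0..t}"]) (use is_motionD(2)[OF x] t(3) in \<open>auto simp: AC_def\<close>)
    then show ?thesis by simp
  qed
  have xT: "hist x T = (T, x)"
    using xAC by (simp add: AC_def extensional_restrict)
  have cx: "continuous_on {0..T} x" by (rule AC_continuous_on[OF alpha(1) alpha_le xAC])
  have cm: "c \<in> borel_measurable (lebesgue_on {t..T})"
    unfolding c_def by (rule controlled_measurable[OF chi_cont])
      (use t controlsD[OF u] in \<open>auto intro: continuous_on_subset[OF cx]\<close>)
  obtain R where R: "\<And>\<tau>. \<tau> \<in> {0..T} \<Longrightarrow> norm (x \<tau>) \<le> R"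
    using continuous_on_Icc_norm_bound[OF cx] by blast
  obtain C where C: "\<And>\<tau> y v. \<tau> \<in> {0..T} \<Longrightarrow> norm y \<le> R \<Longrightarrow> v \<in> P \<Longrightarrow> \<bar>chi \<tau> y v\<bar> \<le> C"
    by (rule chi_bounded[of R]) blast
  have cb: "norm (c \<tau>) \<le> C" if "\<tau> \<in> {t..T}" for \<tau>
  proof -
    have "\<tau> \<in> {0..T}" using that t by auto
    then show ?thesis
      using C[OF _ R controlsD(1)[OF u that]] unfolding c_def by simp
  qed
  have ci: "c integrable_on {t..T}"
    by (rule bounded_integrable_lebesgue_on(2)[OF cm AE_I2]) (use cb in auto)
  have cis: "c integrable_on {t..s}" by (rule integrable_on_subinterval[OF ci]) (use s' in auto)
  show csT: "c integrable_on {s..T}" by (rule integrable_on_subinterval[OF ci]) (use s' in auto)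
  have "AE \<tau> in lebesgue. \<tau> \<in> {t..T} \<longrightarrow> \<psi> \<tau> = f \<tau> (x \<tau>) (u \<tau>)"
    by (rule is_motion_density[OF t(1) x \<psi>(1) eq])
  \<comment> \<open>Almost everywhere \<psi> is f along the motion, which turns k + c into the
    defect.\<close>
  then have ae: "AE \<xi> in lebesgue. \<xi> \<in> {t..s} \<longrightarrow> k \<xi> + c \<xi> = defect x \<xi> (u \<xi>)"
    by eventually_elim (use s' in \<open>auto simp: k_def c_def defect_def\<close>)
  show "(\<lambda>\<xi>. defect x \<xi> (u \<xi>)) integrable_on {t..s}"
    by (rule integral_cong_AE_lebesgue(2)[OF ae]) (intro integrable_add k(1) cis)
  have "integral {t..s} (\<lambda>\<xi>. defect x \<xi> (u \<xi>)) = integral {t..s} (\<lambda>\<xi>. k \<xi> + c \<xi>)"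
    by (rule integral_cong_AE_lebesgue(1)[OF ae, symmetric])
  also have "\<dots> = integral {t..s} k + integral {t..s} c"
    by (rule Henstock_Kurzweil_Integration.integral_add[OF k(1) cis])
  finally have D: "integral {t..s} (\<lambda>\<xi>. defect x \<xi> (u \<xi>)) = \<phi> (hist x s) - \<phi> (t, w) + integral {t..s} c"
    using k(2) wx by simp
  have "cost \<alpha> T f \<sigma> chi (t, w) u = \<sigma> (x T) + (LINT \<tau>:{t..T}|lebesgue. c \<tau>)"
    by (simp add: cost_def Let_def x_def c_def)
  also have "\<sigma> (x T) = \<phi> (hist x T)" using terminal xAC xT by simp
  also have "(LINT \<tau>:{t..T}|lebesgue. c \<tau>) = integral {t..T} c"
    by (rule set_lebesgue_integral_Icc[OF cm cb])
  also have "\<dots> = integral {t..s} c + integral {s..T} c"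
    by (rule Henstock_Kurzweil_Integration.integral_combine[symmetric]) (use s' ci in auto)
  finally show "cost \<alpha> T f \<sigma> chi (t, w) u - \<phi> (t, w) =
      (\<phi> (hist x T) - \<phi> (hist x s)) + integral {t..s} (\<lambda>\<xi>. defect x \<xi> (u \<xi>)) + integral {s..T} c"
    using D by linarith
qed

text \<open>The boundary terms of \<open>cost_identity\<close> with chi replaced by a constant: a
  negative one for the lower bound on costs, a positive one for the upper bound.\<close>

lemma phi_hist_tendsto:
  assumes x: "x \<in> AC \<alpha> T" and t: "0 \<le> t" "t < T"
  obtains s where "\<And>n. s n \<in> {t..<T}" "(\<lambda>n. \<phi> (hist x T) - \<phi> (hist x (s n)) + C * (T - s n)) \<longlonglongrightarrow> 0"
proof -
  define s where "s n = T - (T - t) / real (Suc n)" for n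
  have s: "s n \<in> {t..<T}" for n
  proof -
    have "(T - t) / real (Suc n) \<le> T - t" using t by (simp add: pos_divide_le_eq mult_left_mono)
    then show ?thesis using t by (simp add: s_def)
  qed
  have "(\<lambda>n. T - (T - t) * inverse (real (Suc n))) \<longlonglongrightarrow> T - (T - t) * 0"
    by (intro tendsto_intros LIMSEQ_inverse_real_of_nat)
  then have sT: "s \<longlonglongrightarrow> T" unfolding s_def by (simp add: divide_inverse)
  have "continuous_on {0..T} (\<lambda>\<tau>. \<phi> (hist x \<tau>))"
    using smooth unfolding ci_smooth_def
    by (intro pos_continuous_on_hist[OF alpha(1) alpha_le _ x]) (use hist_in_G[OF x] in auto)
  then have "(\<lambda>n. \<phi> (hist x (s n))) \<longlonglongrightarrow> \<phi> (hist x T)"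
  proof (rule continuous_on_tendsto_compose[OF _ sT])
    have "s n \<in> {0..T}" for n using s[of n] t by auto
    then show "\<forall>\<^sub>F n in sequentially. s n \<in> {0..T}" by simp
  qed (use T_pos in simp)
  then have "(\<lambda>n. \<phi> (hist x T) - \<phi> (hist x (s n)) + C * (T - s n)) \<longlonglongrightarrow> \<phi> (hist x T) - \<phi> (hist x T) + C * (T - T)"
    by (intro tendsto_intros sT)
  then show thesis using that[OF s] by simp
qed

text \<open>The defect integral is nonnegative and chi is at least -C on the end piece, whose
  contribution disappears as s tends to T.\<close>

lemma cost_ge:
  assumes tw: "(t, w) \<in> G0 \<alpha> T" and u: "u \<in> controls P t T"
  shows "\<phi> (t, w) \<le> cost \<alpha> T f \<sigma> chi (t, w) u"
proof -
  define x where "x = motion \<alpha> f t w T u"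
  have t: "0 \<le> t" "t < T" "w \<in> AC \<alpha> t" using tw by (auto simp: G0_def G_def)
  have xAC: "x \<in> AC \<alpha> T"
    unfolding x_def by (rule is_motionD(1)[OF is_motion_motion]) (use t u in auto)
  obtain R where R: "\<And>\<tau>. \<tau> \<in> {0..T} \<Longrightarrow> norm (x \<tau>) \<le> R"
    using continuous_on_Icc_norm_bound[OF AC_continuous_on[OF alpha(1) alpha_le xAC]] by blast
  obtain C where C: "0 \<le> C" "\<And>\<tau> y v. \<tau> \<in> {0..T} \<Longrightarrow> norm y \<le> R \<Longrightarrow> v \<in> P \<Longrightarrow> \<bar>chi \<tau> y v\<bar> \<le> C"
    by (rule chi_bounded[of R]) blast
  obtain s where s: "\<And>n. s n \<in> {t..<T}" "(\<lambda>n. \<phi> (hist x T) - \<phi> (hist x (s n)) + (- C) * (T - s n)) \<longlonglongrightarrow> 0"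
    using phi_hist_tendsto[OF xAC t(1,2), of "- C"] by blast
  have "\<phi> (hist x T) - \<phi> (hist x (s n)) + (- C) * (T - s n) \<le> cost \<alpha> T f \<sigma> chi (t, w) u - \<phi> (t, w)" for n
  proof -
    note id = cost_identity[OF tw u s(1)[of n], folded x_def]
    have sn: "t \<le> s n" "s n < T" using s(1)[of n] by auto
    have "0 \<le> integral {t..s n} (\<lambda>\<xi>. defect x \<xi> (u \<xi>))"
    proof (rule Henstock_Kurzweil_Integration.integral_nonneg[OF id(1)])
      fix \<xi> assume "\<xi> \<in> {t..s n}"
      then have "\<xi> \<in> {0..<T}" "\<xi> \<in> {t..T}" using sn t by auto
      then show "0 \<le> defect x \<xi> (u \<xi>)" using controlsD(1)[OF u] by (intro defect_nonneg xAC) auto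
    qed
    moreover have "integral {s n..T} (\<lambda>\<tau>. - C) \<le> integral {s n..T} (\<lambda>\<tau>. chi \<tau> (x \<tau>) (u \<tau>))"
    proof (rule integral_le[OF _ id(2)])
      fix \<tau> assume "\<tau> \<in> {s n..T}"
      then have "\<tau> \<in> {0..T}" "\<tau> \<in> {t..T}" using sn t by auto
      then have "\<bar>chi \<tau> (x \<tau>) (u \<tau>)\<bar> \<le> C" by (intro C(2) R controlsD(1)[OF u])
      then show "- C \<le> chi \<tau> (x \<tau>) (u \<tau>)" by (simp only: abs_le_iff minus_le_iff)
    qed (rule integrable_const_ivl)
    ultimately show ?thesis using id(3) sn by (simp add: mult.commute)
  qed
  then have "0 \<le> cost \<alpha> T f \<sigma> chi (t, w) u - \<phi> (t, w)"
    by (intro LIMSEQ_le_const2[OF s(2)]) auto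
  then show ?thesis by simp
qed

section \<open>Near-optimality of extremal strategies\<close>

lemma feedback_nearly_optimal:
  assumes U: "U \<in> G0 \<alpha> T \<rightarrow> P" "optimal_feedback U" and tw: "(t, w) \<in> G0 \<alpha> T" and \<epsilon>: "0 < \<epsilon>"
  shows "\<exists>\<delta>>0. \<forall>k \<Delta>. is_partition t T k \<Delta> \<and> diam k \<Delta> \<le> \<delta> \<longrightarrow>
    cost \<alpha> T f \<sigma> chi (t, w) (law_control \<alpha> f w U u_end k \<Delta>) \<le> \<phi> (t, w) + \<epsilon>"
proof (rule ccontr)
  assume neg: "\<not> ?thesis"
  have t: "0 \<le> t" "t < T" "w \<in> AC \<alpha> t" using tw by (auto simp: G0_def G_def)
  \<comment> \<open>The negation yields one bad partition for each diameter bound 1 / (n +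
    1).\<close>
  have "\<exists>k \<Delta>. is_partition t T k \<Delta> \<and> diam k \<Delta> \<le> 1 / real (Suc n) \<and>
      \<phi> (t, w) + \<epsilon> < cost \<alpha> T f \<sigma> chi (t, w) (law_control \<alpha> f w U u_end k \<Delta>)" for n
  proof -
    have "0 < 1 / real (Suc n)" by simp
    then show ?thesis using neg by (meson not_le)
  qed
  then obtain K D where KD: "\<And>n. is_partition t T (K n) (D n)" "\<And>n. diam (K n) (D n) \<le> 1 / real (Suc n)"
    "\<And>n. \<phi> (t, w) + \<epsilon> < cost \<alpha> T f \<sigma> chi (t, w) (law_control \<alpha> f w U u_end (K n) (D n))"
    by metis
  define u where "u n = law_control \<alpha> f w U u_end (K n) (D n)" for n
  define X where "X n = motion \<alpha> f t w T (u n)" for n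
  have uc: "u n \<in> controls P t T" for n
    unfolding u_def by (rule law_control_in_controls[OF U(1) tw KD(1) u_end])
  have Xm: "is_motion t w T (u n) (X n)" for n
    unfolding X_def by (rule is_motion_motion) (use t uc in auto)
  have fb: "\<exists>s\<in>{t..\<tau>}. \<tau> - s \<le> 1 / real (Suc n) \<and> u n \<tau> = U (hist (X n) s)" if "\<tau> \<in> {t..<T}" for n \<tau>
    using law_control_feedback[OF U(1) tw KD(1) u_end that, of n] KD(2)[of n]
    unfolding u_def[symmetric] X_def[symmetric] by (meson order_trans)
  obtain R M where R: "0 < R" "\<And>n \<tau>. \<tau> \<in> {0..T} \<Longrightarrow> norm (X n \<tau>) \<le> R"
    and M: "\<And>n. \<exists>\<psi>. frac_density T M \<psi> \<and> (\<forall>\<tau>\<in>{0..T}. X n \<tau> = w 0 + frac_int \<alpha> \<psi> \<tau>)"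
    by (rule motion_bounds[OF t(1) less_imp_le[OF t(2)] order_refl t(3)]) (use uc Xm in blast)
  have M0: "0 \<le> M" using M[of 0] frac_densityD(1) by blast
  have G: "0 < Gamma (\<alpha> + 1)" using alpha by (intro Gamma_real_pos) simp
  \<comment> \<open>Common Hoelder constant of all motions, from
    \<open>norm_frac_int_increment_le\<close>.\<close>
  define H where "H = 2 * M / Gamma (\<alpha> + 1)"
  have H: "0 \<le> H" using M0 G by (simp add: H_def)
  have hoelder: "norm (X n a - X n b) \<le> H * \<bar>a - b\<bar> powr \<alpha>" if ab: "a \<in> {0..T}" "b \<in> {0..T}" for n a b
  proof -
    obtain \<psi> where \<psi>: "frac_density T M \<psi>" "\<And>\<tau>. \<tau> \<in> {0..T} \<Longrightarrow> X n \<tau> = w 0 + frac_int \<alpha> \<psi> \<tau>"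
      using M[of n] by blast
    have le: "norm (frac_int \<alpha> \<psi> b - frac_int \<alpha> \<psi> a) \<le> H * \<bar>a - b\<bar> powr \<alpha>" if "0 \<le> a" "a \<le> b" "b \<le> T" for a b
      using norm_frac_int_increment_le[OF alpha(1) alpha_le that frac_densityD(2,3,1)[OF \<psi>(1)]] that
      by (simp add: H_def abs_minus_commute)
    show ?thesis
      unfolding \<psi>(2)[OF ab(1)] \<psi>(2)[OF ab(2)]
      using le[of a b] le[of b a] ab by (cases "a \<le> b") (auto simp: norm_minus_commute abs_minus_commute)
  qed
  have equicont: "\<exists>d. 0 < d \<and> (\<forall>n y. y \<in> {0..T} \<and> norm (z - y) < d \<longrightarrow> norm (X n z - X n y) < e)"
    if z: "z \<in> {0..T}" and e: "0 < e" for z e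
  proof -
    \<comment> \<open>d will satisfy d powr \<alpha> = e / (H + 1); H + 1 instead of H keeps the
      quotient meaningful for H = 0 and the final inequality strict.\<close>
    define q where "q = e / (H + 1)"
    have q: "0 < q" "(H + 1) * q = e" using H e by (auto simp: q_def)
    define d where "d = q powr (1 / \<alpha>)"
    have d: "0 < d" "d powr \<alpha> = q" using q alpha by (auto simp: d_def powr_powr)
    have "norm (X n z - X n y) < e" if y: "y \<in> {0..T}" "norm (z - y) < d" for n y
    proof -
      have "\<bar>z - y\<bar> powr \<alpha> \<le> q"
        using y(2) alpha powr_mono2[of \<alpha> "\<bar>z - y\<bar>" d] d by simp
      then have "H * \<bar>z - y\<bar> powr \<alpha> \<le> H * q" using H by (intro mult_left_mono) auto
      also have "\<dots> < (H + 1) * q" using q(1) by (simp only: distrib_right mult_1 less_add_same_cancel1)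
      finally show ?thesis using hoelder[OF z y(1), of n] q(2) by linarith
    qed
    with d(1) show ?thesis by blast
  qed
  obtain g r where g: "continuous_on {0..T} g" and r: "strict_mono (r :: nat \<Rightarrow> nat)"
    and gl: "\<And>e. 0 < e \<Longrightarrow> \<exists>N. \<forall>n x. n \<ge> N \<and> x \<in> {0..T} \<longrightarrow> norm (X (r n) x - g x) < e"
    using Arzela_Ascoli[of "{0..T}" X R, OF compact_Icc R(2) equicont] by blast
  have "\<exists>\<psi>. frac_density T M \<psi> \<and> (\<forall>\<tau>\<in>{0..T}. g \<tau> = w 0 + frac_int \<alpha> \<psi> \<tau>)"
  proof (rule frac_density_closed[OF alpha less_imp_le[OF T_pos] M0])
    fix e :: real assume "0 < e"
    then obtain N where N: "\<And>x. x \<in> {0..T} \<Longrightarrow> norm (X (r N) x - g x) < e" using gl by blast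
    obtain \<psi> where \<psi>: "frac_density T M \<psi>" "\<And>\<tau>. \<tau> \<in> {0..T} \<Longrightarrow> X (r N) \<tau> = w 0 + frac_int \<alpha> \<psi> \<tau>"
      using M[of "r N"] by blast
    have "norm (g \<tau> - (w 0 + frac_int \<alpha> \<psi> \<tau>)) \<le> e" if "\<tau> \<in> {0..T}" for \<tau>
      using N[OF that] unfolding \<psi>(2)[OF that] by (simp add: norm_minus_commute)
    with \<psi>(1) show "\<exists>h. frac_density T M h \<and> (\<forall>\<tau>\<in>{0..T}. norm (g \<tau> - (w 0 + frac_int \<alpha> h \<tau>)) \<le> e)" by blast
  qed
  then obtain \<psi> where \<psi>: "frac_density T M \<psi>" "\<And>\<tau>. \<tau> \<in> {0..T} \<Longrightarrow> g \<tau> = w 0 + frac_int \<alpha> \<psi> \<tau>" by blast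
  \<comment> \<open>Elements of \<open>AC\<close> are extensional; the uniform limit g need not
    be.\<close>
  define x where "x = restrict g {0..T}"
  have xeq: "x \<tau> = g \<tau>" if "\<tau> \<in> {0..T}" for \<tau> using that by (simp add: x_def)
  have "0 \<in> {0..T}" using T_pos by simp
  then have x0: "x 0 = w 0" using xeq \<psi>(2) by (simp add: frac_int_0)
  have xAC: "x \<in> AC \<alpha> T"
    unfolding AC_iff_frac_density
  proof (intro conjI exI ballI)
    show "x \<in> extensional {0..T}" by (simp add: x_def)
    show "frac_density T M \<psi>" by (rule \<psi>(1))
    show "x \<tau> = x 0 + frac_int \<alpha> \<psi> \<tau>" if "\<tau> \<in> {0..T}" for \<tau>
      unfolding x0 xeq[OF that] by (rule \<psi>(2)[OF that])
  qed
  define Y v where "Y n = X (r n)" and "v n = u (r n)" for n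
  have YAC: "Y n \<in> AC \<alpha> T" for n unfolding Y_def by (rule is_motionD(1)[OF Xm])
  have vP: "v n \<tau> \<in> P" if "\<tau> \<in> {t..T}" for n \<tau> unfolding v_def by (rule controlsD(1)[OF uc that])
  have lim: "\<forall>\<^sub>F n in sequentially. \<forall>\<tau>\<in>{0..T}. norm (Y n \<tau> - x \<tau>) \<le> e" if "0 < e" for e
  proof -
    obtain N where "\<And>n \<tau>. n \<ge> N \<Longrightarrow> \<tau> \<in> {0..T} \<Longrightarrow> norm (X (r n) \<tau> - g \<tau>) < e" using gl[OF \<open>0 < e\<close>] by blast
    then show ?thesis unfolding eventually_sequentially Y_def using xeq by (auto intro!: exI[of _ N] less_imp_le)
  qed
  note cx = AC_continuous_on[OF alpha(1) alpha_le xAC]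

  \<comment> \<open>Otherwise there are instants \<xi> n with defect above e. The node z n that
    governs \<xi> n has the same control value and its distance to \<xi> n vanishes, so along a
    subsequence the defects at \<xi> n and at z n with this value have the same limit; at nodes they
    are zero.\<close>
  have unif: "\<forall>\<^sub>F n in sequentially. \<forall>\<xi>\<in>{t..s}. defect (Y n) \<xi> (v n \<xi>) \<le> e"
    if s: "t \<le> s" "s < T" and e: "0 < e" for s e
  proof (rule ccontr)
    assume "\<not> ?thesis"
    from not_eventually_sequentiallyD[OF this]
    obtain \<rho> :: "nat \<Rightarrow> nat" where \<rho>: "strict_mono \<rho>" "\<And>n. \<exists>\<xi>\<in>{t..s}. e < defect (Y (\<rho> n)) \<xi> (v (\<rho> n) \<xi>)"
      by (auto simp: not_le)
    then obtain \<xi> where \<xi>: "\<And>n. \<xi> n \<in> {t..s}" "\<And>n. e < defect (Y (\<rho> n)) (\<xi> n) (v (\<rho> n) (\<xi> n))"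
      by metis
    have \<xi>T: "\<xi> n \<in> {t..<T}" for n using \<xi>(1)[of n] s by auto
    have "\<exists>z. z \<in> {t..\<xi> n} \<and> \<xi> n - z \<le> 1 / real (Suc (r (\<rho> n))) \<and> v (\<rho> n) (\<xi> n) = U (hist (Y (\<rho> n)) z)" for n
      using fb[OF \<xi>T[of n], of "r (\<rho> n)"] unfolding v_def Y_def by blast
    then obtain z where z: "\<And>n. z n \<in> {t..\<xi> n}" "\<And>n. \<xi> n - z n \<le> 1 / real (Suc (r (\<rho> n)))"
      "\<And>n. v (\<rho> n) (\<xi> n) = U (hist (Y (\<rho> n)) (z n))" by metis
    \<comment> \<open>Control values converge along a subsequence by compactness of
      \<open>P\<close>; U itself has no continuity to offer.\<close>
    have "seq_compact ({t..s} \<times> P)"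
      by (intro compact_imp_seq_compact compact_Times compact_P compact_Icc)
    moreover have "\<forall>n. (\<xi> n, v (\<rho> n) (\<xi> n)) \<in> {t..s} \<times> P"
      using \<xi>(1) \<xi>T vP by (auto simp: less_imp_le)
    ultimately obtain l \<kappa> where l: "l \<in> {t..s} \<times> P" and \<kappa>: "strict_mono (\<kappa> :: nat \<Rightarrow> nat)"
      and ll: "((\<lambda>n. (\<xi> n, v (\<rho> n) (\<xi> n))) \<circ> \<kappa>) \<longlonglongrightarrow> l"
      by (rule seq_compactE)
    define \<xi>' v' where "\<xi>' = fst l" and "v' = snd l"
    have \<xi>l: "(\<lambda>n. \<xi> (\<kappa> n)) \<longlonglongrightarrow> \<xi>'" and vl: "(\<lambda>n. v (\<rho> (\<kappa> n)) (\<xi> (\<kappa> n))) \<longlonglongrightarrow> v'"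
      using tendsto_fst[OF ll] tendsto_snd[OF ll] by (simp_all only: o_def fst_conv snd_conv \<xi>'_def v'_def)
    have \<xi>'T: "\<xi>' < T" using mem_Times_iff[THEN iffD1, OF l] s unfolding \<xi>'_def by simp
    have "(\<lambda>n. \<xi> (\<kappa> n) - z (\<kappa> n)) \<longlonglongrightarrow> 0"
    proof (rule Lim_null_comparison)
      have mono: "strict_mono (\<lambda>n. r (\<rho> (\<kappa> n)))"
        using r \<rho>(1) \<kappa> by (simp add: strict_mono_def)
      show "(\<lambda>n. 1 / real (Suc (r (\<rho> (\<kappa> n))))) \<longlonglongrightarrow> 0"
        using LIMSEQ_subseq_LIMSEQ[OF LIMSEQ_inverse_real_of_nat mono] by (simp add: o_def divide_inverse)
      show "\<forall>\<^sub>F n in sequentially. norm (\<xi> (\<kappa> n) - z (\<kappa> n)) \<le> 1 / real (Suc (r (\<rho> (\<kappa> n))))"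
      proof (intro always_eventually allI)
        fix n
        have "0 \<le> \<xi> (\<kappa> n) - z (\<kappa> n)" using z(1)[of "\<kappa> n"] by simp
        then show "norm (\<xi> (\<kappa> n) - z (\<kappa> n)) \<le> 1 / real (Suc (r (\<rho> (\<kappa> n))))"
          unfolding real_norm_def using z(2)[of "\<kappa> n"] by (simp only: abs_of_nonneg)
      qed
    qed
    from tendsto_diff[OF \<xi>l this] have zl: "(\<lambda>n. z (\<kappa> n)) \<longlonglongrightarrow> \<xi>'" by simp
    have limk: "\<forall>\<^sub>F n in sequentially. \<forall>\<tau>\<in>{0..T}. norm (Y (\<rho> (\<kappa> n)) \<tau> - x \<tau>) \<le> d" if "0 < d" for d
      using eventually_subseq[OF strict_mono_o[OF \<rho>(1) \<kappa>] lim[OF that]] by simp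
    have \<xi>0: "\<xi> n \<in> {0..<T}" and z0: "z n \<in> {0..<T}" for n
      using \<xi>T[of n] z(1)[of n] t by auto
    have vP': "v (\<rho> (\<kappa> n)) (\<xi> (\<kappa> n)) \<in> P" for n
      using \<xi>T[of "\<kappa> n"] by (intro vP) auto
    have 1: "(\<lambda>n. defect (Y (\<rho> (\<kappa> n))) (\<xi> (\<kappa> n)) (v (\<rho> (\<kappa> n)) (\<xi> (\<kappa> n)))) \<longlonglongrightarrow> defect x \<xi>' v'"
      by (rule defect_tendsto[OF YAC xAC limk \<xi>0 \<xi>l \<xi>'T vP' vl])
    have 2: "(\<lambda>n. defect (Y (\<rho> (\<kappa> n))) (z (\<kappa> n)) (v (\<rho> (\<kappa> n)) (\<xi> (\<kappa> n)))) \<longlonglongrightarrow> defect x \<xi>' v'"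
      by (rule defect_tendsto[OF YAC xAC limk z0 zl \<xi>'T vP' vl])
    have "defect (Y (\<rho> (\<kappa> n))) (z (\<kappa> n)) (v (\<rho> (\<kappa> n)) (\<xi> (\<kappa> n))) = 0" for n
      unfolding z(3) by (rule defect_feedback_zero[OF U(2) YAC z0])
    with 2 have "defect x \<xi>' v' = 0" using LIMSEQ_unique[OF _ tendsto_const] by simp
    moreover have "e \<le> defect x \<xi>' v'"
      by (rule LIMSEQ_le_const[OF 1]) (use \<xi>(2) in \<open>auto intro: less_imp_le\<close>)
    ultimately show False using e by simp
  qed

  obtain C where C: "0 \<le> C" "\<And>\<tau> y v. \<tau> \<in> {0..T} \<Longrightarrow> norm y \<le> R \<Longrightarrow> v \<in> P \<Longrightarrow> \<bar>chi \<tau> y v\<bar> \<le> C"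
    by (rule chi_bounded[of R]) blast
  \<comment> \<open>s is fixed by the limit x before the index n is chosen, so convergence of \<phi>
    along Y n is used at the two times s and T only.\<close>
  obtain sq where sq: "\<And>n. sq n \<in> {t..<T}" "(\<lambda>n. \<phi> (hist x T) - \<phi> (hist x (sq n)) + C * (T - sq n)) \<longlonglongrightarrow> 0"
    using phi_hist_tendsto[OF xAC t(1,2), of C] by blast
  have "\<forall>\<^sub>F n in sequentially. \<phi> (hist x T) - \<phi> (hist x (sq n)) + C * (T - sq n) < \<epsilon> / 2"
    using \<epsilon> by (intro order_tendstoD(2)[OF sq(2)]) simp
  then obtain n0 where "\<phi> (hist x T) - \<phi> (hist x (sq n0)) + C * (T - sq n0) < \<epsilon> / 2"
    using eventually_happens'[OF sequentially_bot] by blast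
  then obtain s where s: "t \<le> s" "s < T" and small: "\<phi> (hist x T) - \<phi> (hist x s) + C * (T - s) < \<epsilon> / 2"
    using sq(1)[of n0] by auto
  have "pos_continuous_on (G \<alpha> T) \<phi>" using smooth by (simp add: ci_smooth_def)
  then have c\<phi>: "(\<lambda>n. \<phi> (hist (Y n) \<tau>)) \<longlonglongrightarrow> \<phi> (hist x \<tau>)" if "\<tau> \<in> {0..T}" for \<tau>
    by (rule pos_continuous_on_sequence[OF _ cx lim _ tendsto_const])
      (use that in \<open>auto intro!: hist_in_G[OF xAC] hist_in_G[OF YAC] simp del: restrict_apply\<close>)
  have "(\<lambda>n. \<phi> (hist (Y n) T) - \<phi> (hist (Y n) s) + C * (T - s)) \<longlonglongrightarrow> \<phi> (hist x T) - \<phi> (hist x s) + C * (T - s)"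
    by (intro tendsto_intros c\<phi>) (use s t in auto)
  from order_tendstoD(2)[OF this small]
  have ev1: "\<forall>\<^sub>F n in sequentially. \<phi> (hist (Y n) T) - \<phi> (hist (Y n) s) + C * (T - s) < \<epsilon> / 2" .
  \<comment> \<open>Integrated over a length of at most T - t, the defect bound e contributes
    \<epsilon> / 2; the boundary terms contribute less than \<epsilon> / 2.\<close>
  define e where "e = \<epsilon> / (2 * (T - t))"
  have e: "0 < e" "e * (T - t) = \<epsilon> / 2" using \<epsilon> t by (auto simp: e_def field_simps)
  have "\<forall>\<^sub>F n in sequentially. False"
    using ev1 unif[OF s e(1)]
  proof eventually_elim
    case (elim n)
    have Yx: "motion \<alpha> f t w T (v n) = Y n" by (simp add: X_def Y_def v_def)
    have sm: "s \<in> {t..<T}" using s by simp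
    note id = cost_identity[OF tw uc[of "r n", folded v_def] sm, unfolded Yx]
    have "integral {t..s} (\<lambda>\<xi>. defect (Y n) \<xi> (v n \<xi>)) \<le> integral {t..s} (\<lambda>\<xi>. e)"
      by (rule integral_le[OF id(1) integrable_const_ivl]) (use elim(2) in blast)
    also have "\<dots> = e * (s - t)" using s by simp
    also have "\<dots> \<le> e * (T - t)" using e(1) s by (intro mult_left_mono) auto
    finally have i1: "integral {t..s} (\<lambda>\<xi>. defect (Y n) \<xi> (v n \<xi>)) \<le> \<epsilon> / 2" using e(2) by simp
    have "integral {s..T} (\<lambda>\<tau>. chi \<tau> (Y n \<tau>) (v n \<tau>)) \<le> integral {s..T} (\<lambda>\<tau>. C)"
    proof (rule integral_le[OF id(2) integrable_const_ivl])
      fix \<tau> assume "\<tau> \<in> {s..T}"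
      then have \<tau>: "\<tau> \<in> {0..T}" "\<tau> \<in> {t..T}" using s t by auto
      have "\<bar>chi \<tau> (Y n \<tau>) (v n \<tau>)\<bar> \<le> C"
        using R(2)[OF \<tau>(1), of "r n"] by (intro C(2) \<tau>(1) vP[OF \<tau>(2)]) (simp add: Y_def)
      then show "chi \<tau> (Y n \<tau>) (v n \<tau>) \<le> C" by (rule order_trans[OF abs_ge_self])
    qed
    also have "\<dots> = C * (T - s)" using s by simp
    finally have i2: "integral {s..T} (\<lambda>\<tau>. chi \<tau> (Y n \<tau>) (v n \<tau>)) \<le> C * (T - s)" .
    have "\<epsilon> < cost \<alpha> T f \<sigma> chi (t, w) (v n) - \<phi> (t, w)"
      using KD(3)[of "r n"] by (simp add: v_def u_def)
    also have "\<dots> \<le> (\<phi> (hist (Y n) T) - \<phi> (hist (Y n) s)) + \<epsilon> / 2 + C * (T - s)"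
      unfolding id(3) using i1 i2 by linarith
    also have "\<dots> < \<epsilon> / 2 + \<epsilon> / 2" using elim(1) by linarith
    finally show False by simp
  qed
  then show False by simp
qed

end

section \<open>Identification of the value functional\<close>

lemma partition_exists:
  assumes "t < T" "0 < \<delta>"
  shows "\<exists>k \<Delta>. is_partition t T k \<Delta> \<and> diam k \<Delta> \<le> \<delta>"
proof -
  obtain k where k: "(T - t) / \<delta> < real k" using reals_Archimedean2 by blast
  have "0 < (T - t) / \<delta>" using assms by simp
  then have k0: "0 < real k" using k by linarith
  define c where "c = (T - t) / real k"
  have c: "0 < c" "real k * c = T - t" "c \<le> \<delta>"
    using k k0 assms by (simp_all add: c_def pos_divide_less_eq pos_divide_le_eq mult.commute)
  define \<Delta> where "\<Delta> j = t + real j * c" for j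
  have step: "\<Delta> (Suc j) - \<Delta> j = c" for j
    by (simp add: \<Delta>_def distrib_right)
  have "is_partition t T k \<Delta>"
    unfolding is_partition_def
  proof (intro conjI allI impI)
    show "\<Delta> j < \<Delta> (Suc j)" for j using step[of j] c(1) by linarith
  qed (use k0 c(2) in \<open>simp_all add: \<Delta>_def\<close>)
  moreover have "diam k \<Delta> \<le> \<delta>"
    using k0 c(3) by (auto simp: diam_def step image_constant_conv)
  ultimately show ?thesis by blast
qed

context hjb_system
begin

lemma phi_eq_val_G0:
  assumes tw: "(t, w) \<in> G0 \<alpha> T"
  shows "\<phi> (t, w) = val \<alpha> T P f \<sigma> chi (t, w)"
proof (rule antisym)
  have t: "t < T" using tw by (auto simp: G0_def)
  have ne: "controls P t T \<noteq> {}" using const_control[OF u_end] by blast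
  have val: "val \<alpha> T P f \<sigma> chi (t, w) = (INF u\<in>controls P t T. cost \<alpha> T f \<sigma> chi (t, w) u)"
    by (simp add: val_def)
  show "\<phi> (t, w) \<le> val \<alpha> T P f \<sigma> chi (t, w)"
    unfolding val by (rule cINF_greatest[OF ne cost_ge[OF tw]])
  show "val \<alpha> T P f \<sigma> chi (t, w) \<le> \<phi> (t, w)"
  proof (rule field_le_epsilon)
    fix \<epsilon> :: real assume "0 < \<epsilon>"
    obtain U where U: "U \<in> G0 \<alpha> T \<rightarrow> P" "optimal_feedback U" using optimal_feedback_exists by blast
    from feedback_nearly_optimal[OF U tw \<open>0 < \<epsilon>\<close>]
    obtain \<delta> where \<delta>: "0 < \<delta>" "\<And>k \<Delta>. is_partition t T k \<Delta> \<Longrightarrow> diam k \<Delta> \<le> \<delta> \<Longrightarrow>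
        cost \<alpha> T f \<sigma> chi (t, w) (law_control \<alpha> f w U u_end k \<Delta>) \<le> \<phi> (t, w) + \<epsilon>" by blast
    obtain k \<Delta> where k: "is_partition t T k \<Delta>" "diam k \<Delta> \<le> \<delta>"
      using partition_exists[OF t \<delta>(1)] by blast
    \<comment> \<open>\<open>val\<close> is an infimum of reals; \<open>cost_ge\<close> supplies the
      lower bound that \<open>cINF_lower\<close> requires.\<close>
    have "val \<alpha> T P f \<sigma> chi (t, w) \<le> cost \<alpha> T f \<sigma> chi (t, w) (law_control \<alpha> f w U u_end k \<Delta>)"
      unfolding val
      by (rule cINF_lower[OF bdd_belowI2[of _ "\<phi> (t, w)"] law_control_in_controls[OF U(1) tw k(1) u_end]])
        (rule cost_ge[OF tw])
    also have "\<dots> \<le> \<phi> (t, w) + \<epsilon>" by (rule \<delta>(2)[OF k])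
    finally show "val \<alpha> T P f \<sigma> chi (t, w) \<le> \<phi> (t, w) + \<epsilon>" .
  qed
qed

text \<open>At t = T the motion is w itself and the running cost is an integral over a single point,
  so every control costs \<sigma> (w T).\<close>

lemma phi_eq_val_terminal:
  assumes w: "w \<in> AC \<alpha> T"
  shows "\<phi> (T, w) = val \<alpha> T P f \<sigma> chi (T, w)"
proof -
  have ne: "controls P T T \<noteq> {}" using const_control[OF u_end] by blast
  have "cost \<alpha> T f \<sigma> chi (T, w) u = \<sigma> (w T)" if u: "u \<in> controls P T T" for u
  proof -
    have m: "is_motion T w T u (motion \<alpha> f T w T u)"
      by (rule is_motion_motion) (use T_pos w u in auto)
    then have "motion \<alpha> f T w T u T = w T"
      using T_pos by (intro is_motionD(2)[OF m]) simp
    moreover have "(LINT \<tau>:{T..T}|lebesgue. chi \<tau> (motion \<alpha> f T w T u \<tau>) (u \<tau>)) = 0"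
    proof -
      have "AE \<tau> in lebesgue. indicat_real {T..T} \<tau> *\<^sub>R chi \<tau> (motion \<alpha> f T w T u \<tau>) (u \<tau>) = 0"
        using AE_lebesgue_neq[of T] by eventually_elim (simp add: indicator_def)
      then show ?thesis
        unfolding set_lebesgue_integral_def by (rule integral_eq_zero_AE)
    qed
    ultimately show ?thesis by (simp add: cost_def Let_def)
  qed
  then have "val \<alpha> T P f \<sigma> chi (T, w) = (INF u\<in>controls P T T. \<sigma> (w T))"
    by (simp add: val_def)
  then show ?thesis using ne terminal w by simp
qed

lemma phi_eq_val:
  assumes "(t, w) \<in> G \<alpha> T"
  shows "\<phi> (t, w) = val \<alpha> T P f \<sigma> chi (t, w)"
proof (cases "t = T")
  case True
  then show ?thesis using assms phi_eq_val_terminal by (simp add: G_def)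
next
  case False
  then show ?thesis using assms by (intro phi_eq_val_G0) (auto simp: G0_def G_def)
qed

lemma optimal_feedback_is_optimal:
  assumes U: "U \<in> G0 \<alpha> T \<rightarrow> P" "optimal_feedback U"
  shows "optimal_strategy \<alpha> T P f \<sigma> chi u_end U"
  unfolding optimal_strategy_def
proof (clarify)
  fix t :: real and w :: "real \<Rightarrow> real ^ 'n" and \<epsilon> :: real
  assume tw: "(t, w) \<in> G0 \<alpha> T" and "0 < \<epsilon>"
  show "\<exists>\<delta>>0. \<forall>k \<Delta>. is_partition t T k \<Delta> \<and> diam k \<Delta> \<le> \<delta> \<longrightarrow>
      cost \<alpha> T f \<sigma> chi (t, w) (law_control \<alpha> f w U u_end k \<Delta>) \<le> val \<alpha> T P f \<sigma> chi (t, w) + \<epsilon>"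
    using feedback_nearly_optimal[OF U tw \<open>0 < \<epsilon>\<close>] unfolding phi_eq_val_G0[OF tw] .
qed

end

theorem theorem11p1:
  fixes \<alpha> T :: real
    and P :: "(real ^ 'm) set"
    and f :: "real \<Rightarrow> real ^ 'n \<Rightarrow> real ^ 'm \<Rightarrow> real ^ 'n"
    and \<sigma> :: "real ^ 'n \<Rightarrow> real"
    and chi :: "real \<Rightarrow> real ^ 'n \<Rightarrow> real ^ 'm \<Rightarrow> real"
    and u_end :: "real ^ 'm"
    and \<phi> :: "('n::finite) position \<Rightarrow> real"
  assumes "T > 0" and "0 < \<alpha>" and "\<alpha> < 1"
    and "compact P" and "P \<noteq> {}" and "u_end \<in> P"
    and "continuous_on ({0..T} \<times> UNIV \<times> P) (\<lambda>(\<tau>, x, u). f \<tau> x u)"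
    and "\<forall>R > 0. \<exists>L > 0. \<forall>\<tau> \<in> {0..T}. \<forall>x x'. norm x \<le> R \<and> norm x' \<le> R \<longrightarrow>
           (\<forall>u \<in> P. norm (f \<tau> x u - f \<tau> x' u) \<le> L * norm (x - x'))"
    and "\<exists>c > 0. \<forall>\<tau> \<in> {0..T}. \<forall>x. \<forall>u \<in> P. norm (f \<tau> x u) \<le> (1 + norm x) * c"
    and "continuous_on UNIV \<sigma>"
    and "continuous_on ({0..T} \<times> UNIV \<times> P) (\<lambda>(\<tau>, x, u). chi \<tau> x u)"
    and "ci_smooth \<alpha> T \<phi>"
    and "\<forall>(t, w) \<in> G0 \<alpha> T.
           ci_dt \<alpha> T \<phi> (t, w) + hamiltonian P f chi t (w t) (ci_grad \<alpha> T \<phi> (t, w)) = 0"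
    and "\<forall>w \<in> AC \<alpha> T. \<phi> (T, w) = \<sigma> (w T)"
  shows "(\<forall>(t, w) \<in> G \<alpha> T. \<phi> (t, w) = val \<alpha> T P f \<sigma> chi (t, w)) \<and>
         (\<forall>U \<in> G0 \<alpha> T \<rightarrow> P.
            (\<forall>(t, w) \<in> G0 \<alpha> T.
               is_arg_min (\<lambda>u. ci_grad \<alpha> T \<phi> (t, w) \<bullet> f t (w t) u + chi t (w t) u)
                 (\<lambda>u. u \<in> P) (U (t, w)))
            \<longrightarrow> optimal_strategy \<alpha> T P f \<sigma> chi u_end U)"
proof -
  interpret hjb_system \<alpha> T P f \<sigma> chi u_end \<phi>
    by (unfold_locales; fact)
  have "\<forall>(t, w) \<in> G \<alpha> T. \<phi> (t, w) = val \<alpha> T P f \<sigma> chi (t, w)"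
    using phi_eq_val by blast
  moreover have "\<forall>U \<in> G0 \<alpha> T \<rightarrow> P.
      (\<forall>(t, w) \<in> G0 \<alpha> T.
         is_arg_min (\<lambda>u. ci_grad \<alpha> T \<phi> (t, w) \<bullet> f t (w t) u + chi t (w t) u) (\<lambda>u. u \<in> P) (U (t, w)))
      \<longrightarrow> optimal_strategy \<alpha> T P f \<sigma> chi u_end U"
    using optimal_feedback_is_optimal unfolding optimal_feedback_def by blast
  ultimately show ?thesis by (rule conjI)
qed

end
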